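(* An immersed surface $\Sigma$ in $\mathbb{L}(\mathbb{H}^3)$ is an $\alpha$-surface if and only if $\Sigma$ is the oriented normal congruence of (1) a geodesic sphere, or (2) a horosphere, or (3) a totally geodesic surface in $\mathbb{H}^3$.
   Context: $\mathbb{L}(\mathbb{H}^3)$ is the space of oriented geodesics of hyperbolic 3-space $\mathbb{H}^3=\{(x^0,x^1,x^2): x^0>0\}$ with metric $\frac{(dx^0)^2+(dx^1)^2+(dx^2)^2}{(x^0)^2}$; put $z=x^1+ix^2$, $t=x^0$. It is identified with $\mathbb{P}^1\times\mathbb{P}^1-\overline{\Delta}$, $\overline{\Delta}=\{(\mu_1,\mu_2):\mu_1\bar\mu_2=-1\}$, with holomorphic coordinates $(\mu_1,\mu_2)$; the oriented geodesic with coordinates $(\mu_1,\mu_2)$ (for $\mu_2\ne0$) is parameterized by arc-length $r$ as $$z=\frac{1-\mu_1\bar\mu_2}{2\bar\mu_2}+\left(\frac{1+\mu_1\bar\mu_2}{2\bar\mu_2}\right)\tanh r,\qquad t=\frac{|1+\bar\mu_1\mu_2|}{2|\mu_2|\cosh r}.$$ The neutral Kähler structure on $\mathbb{L}(\mathbb{H}^3)$ consists of the complex structure $\mathbb{J}$ for which $\mu_1,\mu_2$ are holomorphic, the symplectic form $$\Omega=-\left[\frac{1}{(1+\mu_1\bar\mu_2)^2}d\mu_1\wedge d\bar\mu_2+\frac{1}{(1+\bar\mu_1\mu_2)^2}d\bar\mu_1\wedge d\mu_2\right],$$ and the metric $\mathbb{G}(\cdot,\cdot)=\Omega(\mathbb{J}\cdot,\cdot)$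 of signature $(++--)$. A tangent plane is totally null if $\mathbb{G}$ vanishes identically on it. There are two types of totally null planes, $\alpha$-planes and $\beta$-planes; the $\alpha$-planes are those that are both complex ($\mathbb{J}$-invariant) and Lagrangian ($\Omega$ vanishes on them). An $\alpha$-surface is a surface all of whose tangent planes are $\alpha$-planes, i.e. a surface that is both a complex curve and Lagrangian. The geodesic sphere of radius $r_0$ and centre $p\in\mathbb{H}^3$ is the surface obtained by flowing a distance $r_0$ along all oriented geodesics through $p$. A horosphere is a surface in $\mathbb{H}^3$ whose oriented normals end (or begin) at the same point of the boundary $\mathbb{P}^1$. The oriented normal congruence of an oriented surface is the set of oriented geodesics normal to it. Surfaces are connected and understood locally: pieces of geodesic spheres, horospheres and totally geodesic surfaces are allowed. *)

theory Defs
  imports "HOL-Analysis.Analysis"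
begin

section \<open>Smooth immersions of plane domains\<close>

text \<open>The parameter plane $R^2$ is represented by the real normed space \<^typ>\<open>complex\<close>; its complex
  structure is never used. All derivatives below are real Frechet derivatives.\<close>

fun times_differentiable_on ::
  "nat \<Rightarrow> (complex \<Rightarrow> 'b::real_normed_vector) \<Rightarrow> complex set \<Rightarrow> bool" where
  "times_differentiable_on 0 F U \<longleftrightarrow> continuous_on U F"
| "times_differentiable_on (Suc k) F U \<longleftrightarrow>
     (\<forall>u\<in>U. F differentiable (at u)) \<and>
     (\<forall>v. times_differentiable_on k (\<lambda>u. frechet_derivative F (at u) v) U)"

definition smooth_immersion_on :: "complex set \<Rightarrow> (complex \<Rightarrow> 'b::real_normed_vector) \<Rightarrow> bool" where
  "smooth_immersion_on U F \<longleftrightarrow>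
     (\<forall>k. times_differentiable_on k F U) \<and> (\<forall>u\<in>U. inj (frechet_derivative F (at u)))"

text \<open>\<open>\<phi>\<close> is a homeomorphism from a plane domain \<open>U\<close> onto a relatively open part of \<open>M\<close>.\<close>

definition local_param :: "'m::topological_space set \<Rightarrow> complex set \<Rightarrow> (complex \<Rightarrow> 'm) \<Rightarrow> bool" where
  "local_param M U \<phi> \<longleftrightarrow>
     open U \<and> openin (top_of_set M) (\<phi> ` U) \<and> (\<exists>\<psi>. homeomorphism U (\<phi> ` U) \<phi> \<psi>)"


section \<open>Hyperbolic space and its oriented geodesics\<close>

text \<open>A pair \<open>(t, z)\<close> stands for the point with $x^0 = t$ and $x^1 + i x^2 = z$.\<close>

type_synonym half_space = "real \<times> complex"

definition H3 :: "half_space set" where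
  "H3 = {p. fst p > 0}"

definition hyp_inner :: "half_space \<Rightarrow> half_space \<Rightarrow> half_space \<Rightarrow> real" where
  "hyp_inner p v w = (v \<bullet> w) / (fst p)\<^sup>2"

text \<open>The Riemann sphere; \<^term>\<open>None\<close> is the point at infinity.\<close>

type_synonym sphere = "complex option"

definition antidiagonal :: "(sphere \<times> sphere) set" where
  "antidiagonal =
     {(Some \<mu>\<^sub>1, Some \<mu>\<^sub>2) | \<mu>\<^sub>1 \<mu>\<^sub>2. \<mu>\<^sub>1 * cnj \<mu>\<^sub>2 = -1} \<union> {(Some 0, None), (None, Some 0)}"

definition LH3 :: "(sphere \<times> sphere) set" where
  "LH3 = - antidiagonal"

text \<open>Arc-length parameterisation of the oriented geodesic \<open>(\<mu>\<^sub>1, \<mu>\<^sub>2)\<close>. It runs from the boundary point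
  \<open>- \<mu>\<^sub>1\<close> to the boundary point \<open>1 / cnj \<mu>\<^sub>2\<close>. The case \<open>\<mu>\<^sub>1\<close> finite, \<open>\<mu>\<^sub>2\<close> finite and nonzero is the
  generic formula; for \<open>\<mu>\<^sub>2 = \<infinity>\<close> its limit is used; geodesics with one end at infinity are the
  vertical lines, with an arbitrary choice of the origin of the arc-length parameter.\<close>

fun geodesic :: "sphere \<times> sphere \<Rightarrow> real \<Rightarrow> half_space" where
  "geodesic (Some \<mu>\<^sub>1, Some \<mu>\<^sub>2) r =
     (if \<mu>\<^sub>2 = 0 then (exp r, - \<mu>\<^sub>1)
      else (cmod (1 + cnj \<mu>\<^sub>1 * \<mu>\<^sub>2) / (2 * cmod \<mu>\<^sub>2 * cosh r),
            (1 - \<mu>\<^sub>1 * cnj \<mu>\<^sub>2) / (2 * cnj \<mu>\<^sub>2)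
              + (1 + \<mu>\<^sub>1 * cnj \<mu>\<^sub>2) / (2 * cnj \<mu>\<^sub>2) * of_real (tanh r)))"
| "geodesic (Some \<mu>\<^sub>1, None) r =
     (cmod \<mu>\<^sub>1 / (2 * cosh r), - \<mu>\<^sub>1 / 2 + \<mu>\<^sub>1 / 2 * of_real (tanh r))"
| "geodesic (None, Some \<mu>\<^sub>2) r = (exp (- r), 1 / cnj \<mu>\<^sub>2)"
| "geodesic (None, None) r = (exp (- r), 0)"

definition velocity :: "sphere \<times> sphere \<Rightarrow> real \<Rightarrow> half_space" where
  "velocity \<gamma> r = vector_derivative (geodesic \<gamma>) (at r)"

text \<open>Convergence of a curve to a point of the boundary sphere of the half space.\<close>

fun tends_to_boundary :: "(real \<Rightarrow> half_space) \<Rightarrow> sphere \<Rightarrow> real filter \<Rightarrow> bool" where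
  "tends_to_boundary c (Some b) F \<longleftrightarrow> (c \<longlongrightarrow> (0, b)) F"
| "tends_to_boundary c None F \<longleftrightarrow> filterlim c at_infinity F"


section \<open>The neutral Kaehler structure\<close>

text \<open>\<^term>\<open>LH3\<close> is covered by four holomorphic charts: in each factor the coordinate is either \<open>\<mu>\<close>
  (index \<^term>\<open>False\<close>) or \<open>1/\<mu>\<close> (index \<^term>\<open>True\<close>).\<close>

fun coord_domain :: "bool \<Rightarrow> sphere set" where
  "coord_domain False = - {None}"
| "coord_domain True = - {Some 0}"

fun coord :: "bool \<Rightarrow> sphere \<Rightarrow> complex" where
  "coord False (Some \<mu>) = \<mu>"
| "coord True (Some \<mu>) = 1 / \<mu>"
| "coord _ None = 0"

fun chart :: "bool \<Rightarrow> bool \<Rightarrow> sphere \<times> sphere \<Rightarrow> complex \<times> complex" where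
  "chart i j (a, b) = (coord i a, coord j b)"

text \<open>In the chart \<open>(\<zeta>\<^sub>1, \<zeta>\<^sub>2)\<close> with indices \<open>i\<close>, \<open>j\<close> the symplectic form is
  \<open>- (c d\<zeta>\<^sub>1 \<and> d(cnj \<zeta>\<^sub>2) + cnj c d(cnj \<zeta>\<^sub>1) \<and> d\<zeta>\<^sub>2)\<close> with \<open>c\<close> as follows. For \<open>i = j = False\<close> this is the
  expression in \<open>(\<mu>\<^sub>1, \<mu>\<^sub>2)\<close>; the other charts are obtained from it by the substitutions
  \<open>\<mu> = 1 / \<zeta>\<close>, \<open>d\<mu> = - d\<zeta> / \<zeta>\<^sup>2\<close>, see the two transition lemmas.\<close>

definition omega_coeff :: "bool \<Rightarrow> bool \<Rightarrow> complex \<times> complex \<Rightarrow> complex" where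
  "omega_coeff i j \<zeta> =
     (if i = j then 1 / (1 + fst \<zeta> * cnj (snd \<zeta>))\<^sup>2 else - 1 / (fst \<zeta> + cnj (snd \<zeta>))\<^sup>2)"

lemma omega_coeff_transition_fst:
  assumes "z \<noteq> 0"
  shows "omega_coeff i j (z, w) = omega_coeff (\<not> i) j (1 / z, w) * (- 1 / z\<^sup>2)"
proof -
  have "(1 / z + cnj w) * z = 1 + z * cnj w" "(1 + 1 / z * cnj w) * z = z + cnj w"
    using assms by (simp_all add: field_simps)
  then have "(1 / z + cnj w)\<^sup>2 * z\<^sup>2 = (1 + z * cnj w)\<^sup>2"
    "(1 + 1 / z * cnj w)\<^sup>2 * z\<^sup>2 = (z + cnj w)\<^sup>2"
    by (metis power_mult_distrib)+
  then show ?thesis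
    by (auto simp: omega_coeff_def)
qed

lemma omega_coeff_transition_snd:
  assumes "w \<noteq> 0"
  shows "omega_coeff i j (z, w) = omega_coeff i (\<not> j) (z, 1 / w) * cnj (- 1 / w\<^sup>2)"
proof -
  have "(z + 1 / cnj w) * cnj w = 1 + z * cnj w" "(1 + z * (1 / cnj w)) * cnj w = z + cnj w"
    using assms by (simp_all add: field_simps)
  then have "(z + 1 / cnj w)\<^sup>2 * (cnj w)\<^sup>2 = (1 + z * cnj w)\<^sup>2"
    "(1 + z * (1 / cnj w))\<^sup>2 * (cnj w)\<^sup>2 = (z + cnj w)\<^sup>2"
    by (metis power_mult_distrib)+
  then show ?thesis
    by (auto simp: omega_coeff_def)
qed

text \<open>The sum inside is real, being the sum of two conjugate numbers; \<^term>\<open>Re\<close> only adjusts the type.\<close>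

definition Omega ::
  "bool \<Rightarrow> bool \<Rightarrow> complex \<times> complex \<Rightarrow> complex \<times> complex \<Rightarrow> complex \<times> complex \<Rightarrow> real" where
  "Omega i j \<zeta> X Y =
     - Re (omega_coeff i j \<zeta> * (fst X * cnj (snd Y) - fst Y * cnj (snd X))
         + cnj (omega_coeff i j \<zeta>) * (cnj (fst X) * snd Y - cnj (fst Y) * snd X))"

definition JJ :: "complex \<times> complex \<Rightarrow> complex \<times> complex" where
  "JJ X = (\<i> * fst X, \<i> * snd X)"

definition GG ::
  "bool \<Rightarrow> bool \<Rightarrow> complex \<times> complex \<Rightarrow> complex \<times> complex \<Rightarrow> complex \<times> complex \<Rightarrow> real" where
  "GG i j \<zeta> X Y = Omega i j \<zeta> (JJ X) Y"

definition totally_null ::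
  "bool \<Rightarrow> bool \<Rightarrow> complex \<times> complex \<Rightarrow> (complex \<times> complex) set \<Rightarrow> bool" where
  "totally_null i j \<zeta> T \<longleftrightarrow> (\<forall>X\<in>T. \<forall>Y\<in>T. GG i j \<zeta> X Y = 0)"

definition lagrangian ::
  "bool \<Rightarrow> bool \<Rightarrow> complex \<times> complex \<Rightarrow> (complex \<times> complex) set \<Rightarrow> bool" where
  "lagrangian i j \<zeta> T \<longleftrightarrow> (\<forall>X\<in>T. \<forall>Y\<in>T. Omega i j \<zeta> X Y = 0)"

definition alpha_plane ::
  "bool \<Rightarrow> bool \<Rightarrow> complex \<times> complex \<Rightarrow> (complex \<times> complex) set \<Rightarrow> bool" where
  "alpha_plane i j \<zeta> T \<longleftrightarrow>
     subspace T \<and> dim T = 2 \<and> totally_null i j \<zeta> T \<and> JJ ` T = T \<and> lagrangian i j \<zeta> T"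


section \<open>Immersed surfaces in the space of oriented geodesics\<close>

definition LH3_patch :: "'m::topological_space set \<Rightarrow> ('m \<Rightarrow> sphere \<times> sphere) \<Rightarrow> bool \<Rightarrow> bool \<Rightarrow>
    complex set \<Rightarrow> (complex \<Rightarrow> 'm) \<Rightarrow> bool" where
  "LH3_patch M f i j U \<phi> \<longleftrightarrow>
     local_param M U \<phi> \<and> f ` \<phi> ` U \<subseteq> coord_domain i \<times> coord_domain j \<and>
     smooth_immersion_on U (chart i j \<circ> f \<circ> \<phi>)"

text \<open>A separate smooth structure on \<open>M\<close> is not needed: the parameterisations for which \<open>f\<close> is a smooth
  immersion are smoothly compatible with each other, so they make \<open>M\<close> a smooth 2-manifold.\<close>

definition immersed_surface :: "'m::{t2_space,second_countable_topology} set \<Rightarrow>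
    ('m \<Rightarrow> sphere \<times> sphere) \<Rightarrow> bool" where
  "immersed_surface M f \<longleftrightarrow>
     M \<noteq> {} \<and> connected M \<and> f ` M \<subseteq> LH3 \<and>
     (\<forall>m\<in>M. \<exists>i j U \<phi>. LH3_patch M f i j U \<phi> \<and> m \<in> \<phi> ` U)"

definition alpha_surface :: "'m::{t2_space,second_countable_topology} set \<Rightarrow>
    ('m \<Rightarrow> sphere \<times> sphere) \<Rightarrow> bool" where
  "alpha_surface M f \<longleftrightarrow>
     immersed_surface M f \<and>
     (\<forall>i j U \<phi>. LH3_patch M f i j U \<phi> \<longrightarrow>
        (\<forall>u\<in>U. alpha_plane i j (chart i j (f (\<phi> u)))
           (range (frechet_derivative (chart i j \<circ> f \<circ> \<phi>) (at u)))))"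


section \<open>Oriented surfaces in hyperbolic space\<close>

definition H3_patch :: "half_space set \<Rightarrow> complex set \<Rightarrow> (complex \<Rightarrow> half_space) \<Rightarrow> bool" where
  "H3_patch S U \<phi> \<longleftrightarrow> local_param S U \<phi> \<and> smooth_immersion_on U \<phi>"

definition tangent_plane :: "half_space set \<Rightarrow> half_space \<Rightarrow> half_space set" where
  "tangent_plane S p =
     (\<Union>{range (frechet_derivative \<phi> (at u)) | U \<phi> u. H3_patch S U \<phi> \<and> u \<in> U \<and> \<phi> u = p})"

text \<open>The orientation is given by the unit normal field \<open>N\<close>.\<close>

definition oriented_surface :: "half_space set \<Rightarrow> (half_space \<Rightarrow> half_space) \<Rightarrow> bool" where
  "oriented_surface S N \<longleftrightarrow>
     S \<noteq> {} \<and> connected S \<and> S \<subseteq> H3 \<and>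
     (\<forall>p\<in>S. \<exists>U \<phi>. H3_patch S U \<phi> \<and> p \<in> \<phi> ` U) \<and>
     continuous_on S N \<and>
     (\<forall>p\<in>S. hyp_inner p (N p) (N p) = 1 \<and> (\<forall>v\<in>tangent_plane S p. hyp_inner p (N p) v = 0))"

definition normal_congruence ::
  "half_space set \<Rightarrow> (half_space \<Rightarrow> half_space) \<Rightarrow> (sphere \<times> sphere) set" where
  "normal_congruence S N =
     {\<gamma> \<in> LH3. \<exists>r. geodesic \<gamma> r \<in> S \<and> velocity \<gamma> r = N (geodesic \<gamma> r)}"

definition geodesic_sphere :: "half_space \<Rightarrow> real \<Rightarrow> half_space set" where
  "geodesic_sphere p r\<^sub>0 = {geodesic \<gamma> (s + r\<^sub>0) | \<gamma> s. \<gamma> \<in> LH3 \<and> geodesic \<gamma> s = p}"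

text \<open>Pieces of the complete surfaces are allowed in all three cases.\<close>

definition in_geodesic_sphere :: "half_space set \<Rightarrow> bool" where
  "in_geodesic_sphere S \<longleftrightarrow> (\<exists>p\<in>H3. \<exists>r\<^sub>0>0. S \<subseteq> geodesic_sphere p r\<^sub>0)"

definition horosphere :: "half_space set \<Rightarrow> (half_space \<Rightarrow> half_space) \<Rightarrow> bool" where
  "horosphere S N \<longleftrightarrow>
     (\<exists>b. (\<forall>\<gamma>\<in>normal_congruence S N. tends_to_boundary (geodesic \<gamma>) b at_top) \<or>
          (\<forall>\<gamma>\<in>normal_congruence S N. tends_to_boundary (geodesic \<gamma>) b at_bot))"

text \<open>Every geodesic tangent to the surface stays in it for a short time.\<close>

definition totally_geodesic :: "half_space set \<Rightarrow> bool" where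
  "totally_geodesic S \<longleftrightarrow>
     (\<forall>\<gamma>\<in>LH3. \<forall>r. geodesic \<gamma> r \<in> S \<and> velocity \<gamma> r \<in> tangent_plane S (geodesic \<gamma> r) \<longrightarrow>
        (\<forall>\<^sub>F s in nhds r. geodesic \<gamma> s \<in> S))"

end

theory Submission
  imports Defs "HOL-Complex_Analysis.Complex_Analysis"
begin

text \<open>
  Seen from the boundary, an oriented geodesic is a pair of different lines \<open>[v]\<close>, \<open>[w]\<close> in the complex plane
  \<open>C\<^sup>2\<close>, its start and its end. A nonzero Hermitian form \<open>A\<close> on \<open>C\<^sup>2\<close> singles out the geodesics with
  \<open>A(v, w) = 0\<close>, called incident with \<open>A\<close>. In holomorphic charts incidence is one holomorphic equation, and the
  proof shows that both sides of the theorem say the same: all geodesics of the surface are incident with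
  one nonzero form (\<open>alpha_surface_imp_incident\<close>, \<open>alpha_surface_of_incident\<close>).

  From the side of surfaces in space: points of hyperbolic space are positive Hermitian matrices up to scale, so a form \<open>A\<close> defines
  by pairing a function \<open>Phi A\<close>. The squared hyperbolic length of its gradient is
  \<open>(Phi A)\<^sup>2 - 4 hdet A\<close>, and along the geodesic from \<open>[v]\<close> to \<open>[w]\<close> the function is a combination of
  \<open>exp r\<close> and \<open>exp (- r)\<close> with coefficients proportional to \<open>A(w, w)\<close> and \<open>A(v, v)\<close>. Comparing the two by the
  Cauchy-Schwarz inequality, a geodesic is incident with \<open>A\<close> if and only if it runs along the gradient of
  \<open>Phi A\<close> (\<open>incident_iff_hgrad\<close>). So the incident geodesics are the normals of the level surfaces of \<open>Phi A\<close>. For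
  \<open>hdet A > 0\<close> these are the concentric spheres about a point, for \<open>hdet A = 0\<close> the horospheres at a boundary point,
  and for \<open>hdet A < 0\<close> the surfaces at constant distance from a totally geodesic plane. That the normals of
  a sphere or horosphere are incident with one form is then immediate. For a totally geodesic surface, given only by the behaviour
  of its tangent geodesics, the tangent hyperbolic plane is shown to be constant
  (\<open>totally_geodesic_normals_incident\<close>).

  From the side of the space of geodesics: the incidence curve of a form is complex with real slope, in the
  sense required by the symplectic form, hence an \<open>\<alpha>\<close>-surface. Conversely an \<open>\<alpha>\<close>-surface is locally the
  graph of a holomorphic function \<open>h\<close> with \<open>h' / cnj (det2 v w)\<^sup>2\<close> real. Multiplying by a root of \<open>1 / h'\<close>
  makes the determinant of the two lifts, up to conjugation and a constant factor, real; being affine in \<open>cnj z\<close> with holomorphic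
  coefficients, it is then a Hermitian polynomial (\<open>real_mixed_holomorphic_affine\<close>), whose coefficients give the form. A form is
  determined up to a real factor by one point and one tangent of its incidence curve (\<open>incidence_unique\<close>), so
  the local forms agree on a connected surface.

  Given the form, choose a level of \<open>Phi A\<close> that every geodesic of the surface crosses in the growing direction. The
  crossing points form a connected open part of the level surface (\<open>section_surface\<close>), an oriented surface whose
  normal congruence is the given one.
\<close>

section \<open>Hermitian forms on the complex plane\<close>

type_synonym herm = "real \<times> real \<times> complex"

text \<open>The triple \<open>(a, d, b)\<close> is the Hermitian matrix with diagonal \<open>a\<close>, \<open>d\<close> and off-diagonal entry \<open>b\<close>.\<close>

definition hform :: "herm \<Rightarrow> complex \<times> complex \<Rightarrow> complex \<times> complex \<Rightarrow> complex" where
  "hform A v w = (case A of (a, d, b) \<Rightarrow>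
     of_real a * fst v * cnj (fst w) + b * fst v * cnj (snd w)
     + cnj b * snd v * cnj (fst w) + of_real d * snd v * cnj (snd w))"

definition hdet :: "herm \<Rightarrow> real" where
  "hdet A = (case A of (a, d, b) \<Rightarrow> a * d - (cmod b)\<^sup>2)"

definition det2 :: "complex \<times> complex \<Rightarrow> complex \<times> complex \<Rightarrow> complex" where
  "det2 v w = fst v * snd w - snd v * fst w"

definition hquad :: "herm \<Rightarrow> complex \<times> complex \<Rightarrow> real" where
  "hquad A v = Re (hform A v v)"

lemma hform_commute: "hform A w v = cnj (hform A v w)"
  by (cases A) (simp add: hform_def algebra_simps)

lemma of_real_hquad: "of_real (hquad A v) = hform A v v"
  using hform_commute[of A v v] by (simp add: hquad_def complex_eq_iff)

lemma of_real_hdet: "of_real (hdet (a, d, b)) = of_real a * of_real d - b * cnj b"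
  unfolding hdet_def using complex_norm_square[of b] by simp

text \<open>The Gram determinant of a Hermitian form transforms by the square of the modulus of the
  determinant of the two vectors. With \<open>hform A v w = 0\<close> it turns the sign of \<^term>\<open>hdet A\<close> into the
  sign of the product of the two diagonal values, which is what separates the three types of surfaces.\<close>

lemma hform_gram: "hquad A v * hquad A w - (cmod (hform A v w))\<^sup>2 = hdet A * (cmod (det2 v w))\<^sup>2"
proof -
  obtain a d b where A: "A = (a, d, b)" by (cases A)
  have "complex_of_real (hquad A v * hquad A w - (cmod (hform A v w))\<^sup>2)
      = hform A v v * hform A w w - hform A v w * hform A w v"
    by (simp only: of_real_diff of_real_mult of_real_hquad complex_norm_square hform_commute[of A w v])
  also have "\<dots> = of_real (hdet A) * (det2 v w * cnj (det2 v w))"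
    unfolding A of_real_hdet by (simp add: hform_def det2_def algebra_simps)
  also have "\<dots> = of_real (hdet A * (cmod (det2 v w))\<^sup>2)"
    by (simp only: of_real_mult complex_norm_square)
  finally show ?thesis by (simp only: of_real_eq_iff)
qed

lemma herm_eq_0:
  assumes D: "det2 v w \<noteq> 0" and 0: "hquad A v = 0" "hquad A w = 0" "hform A v w = 0"
  shows "A = 0"
proof -
  obtain a d b where A: "A = (a, d, b)" by (cases A)
  have vv: "hform A v v = 0" "hform A w w = 0" "hform A w v = 0"
    using 0 of_real_hquad[of A v] of_real_hquad[of A w] hform_commute[of A w v] by auto
  have "of_real a * (det2 v w * cnj (det2 v w)) = snd w * cnj (snd w) * hform A v v + snd v * cnj (snd v) * hform A w w
     - snd w * cnj (snd v) * hform A v w - snd v * cnj (snd w) * hform A w v"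
    unfolding A by (simp add: hform_def det2_def algebra_simps)
  moreover have "of_real d * (det2 v w * cnj (det2 v w)) = fst w * cnj (fst w) * hform A v v + fst v * cnj (fst v) * hform A w w
     - fst w * cnj (fst v) * hform A v w - fst v * cnj (fst w) * hform A w v"
    unfolding A by (simp add: hform_def det2_def algebra_simps)
  moreover have "b * (det2 v w * cnj (det2 v w)) = - snd w * cnj (fst w) * hform A v v - snd v * cnj (fst v) * hform A w w
     + snd w * cnj (fst v) * hform A v w + snd v * cnj (fst w) * hform A w v"
    unfolding A by (simp add: hform_def det2_def algebra_simps)
  ultimately show ?thesis using D 0 vv unfolding A by (simp add: zero_prod_def)
qed

section \<open>Geodesics as pairs of complex lines\<close>

text \<open>Points of hyperbolic space are positive definite Hermitian matrices up to scale: \<open>(t, z)\<close>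
  corresponds to the matrix with diagonal \<open>t\<^sup>2 + |z|\<^sup>2\<close>, \<open>1\<close> and off-diagonal entry \<open>z\<close>. In this model
  the geodesic joining the boundary points \<open>[v]\<close> and \<open>[w]\<close> consists of the matrices \<open>e w w* + v v* / e\<close>,
  and \<open>geo_point v w e\<close> is such a matrix read in the half space.\<close>

definition geo_point :: "complex \<times> complex \<Rightarrow> complex \<times> complex \<Rightarrow> real \<Rightarrow> half_space" where
  "geo_point v w e = (let W = e * (cmod (snd w))\<^sup>2 + (cmod (snd v))\<^sup>2 / e in
     (cmod (det2 v w) / W, (of_real e * fst w * cnj (snd w) + fst v * cnj (snd v) / of_real e) / of_real W))"

text \<open>The boundary point where the geodesic starts is \<open>- \<mu>\<^sub>1 = fst v / snd v\<close>, a point of the complex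
  projective line with homogeneous coordinates \<open>v\<close>; likewise the end is \<open>1 / cnj \<mu>\<^sub>2 = fst w / snd w\<close>.\<close>

definition is_start :: "complex \<times> complex \<Rightarrow> sphere \<Rightarrow> bool" where
  "is_start v s = (case s of None \<Rightarrow> fst v \<noteq> 0 \<and> snd v = 0 | Some \<mu> \<Rightarrow> snd v \<noteq> 0 \<and> fst v = - \<mu> * snd v)"

definition is_end :: "complex \<times> complex \<Rightarrow> sphere \<Rightarrow> bool" where
  "is_end w s = (case s of None \<Rightarrow> fst w = 0 \<and> snd w \<noteq> 0 | Some \<mu> \<Rightarrow> fst w \<noteq> 0 \<and> snd w = cnj \<mu> * fst w)"

text \<open>The antidiagonal is the set of pairs whose two boundary points coincide.\<close>

lemma LH3_iff_det2:
  assumes "is_start v (fst \<gamma>)" "is_end w (snd \<gamma>)"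
  shows "\<gamma> \<in> LH3 \<longleftrightarrow> det2 v w \<noteq> 0"
proof -
  obtain s1 s2 where g: "\<gamma> = (s1, s2)" by (cases \<gamma>)
  have eq: "\<mu>1 * cnj \<mu>2 = -1 \<longleftrightarrow> det2 v w = 0" if "s1 = Some \<mu>1" "s2 = Some \<mu>2" for \<mu>1 \<mu>2
  proof -
    have "det2 v w = - (snd v * fst w) * (1 + \<mu>1 * cnj \<mu>2)"
      using assms that by (simp add: g is_start_def is_end_def det2_def algebra_simps)
    moreover have "snd v * fst w \<noteq> 0" using assms that by (simp add: g is_start_def is_end_def)
    ultimately show ?thesis by (metis add.commute add_eq_0_iff mult_eq_0_iff neg_equal_0_iff_equal)
  qed
  show ?thesis
    using assms eq
    by (cases s1; cases s2) (auto simp: g LH3_def antidiagonal_def is_start_def is_end_def det2_def)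
qed

text \<open>Rescaling the two lifts only shifts the parameter, so it suffices to compare one choice of lifts
  with the explicit formulas for the geodesics.\<close>

lemma geo_point_scale:
  assumes "l \<noteq> 0" "m \<noteq> 0" "e > 0"
  shows "geo_point (l * v1, l * v2) (m * w1, m * w2) e = geo_point (v1, v2) (w1, w2) (e * cmod m / cmod l)"
proof -
  let ?W = "e * (cmod m / cmod l) * (cmod w2)\<^sup>2 + (cmod v2)\<^sup>2 / (e * (cmod m / cmod l))"
  have W: "e * (cmod (m * w2))\<^sup>2 + (cmod (l * v2))\<^sup>2 / e = cmod l * cmod m * ?W"
    using assms by (simp add: norm_mult field_simps power2_eq_square)
  have D: "cmod (det2 (l * v1, l * v2) (m * w1, m * w2)) = cmod l * cmod m * cmod (det2 (v1, v2) (w1, w2))"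
    unfolding norm_mult[symmetric] by (simp add: det2_def algebra_simps)
  have n: "complex_of_real (cmod l) * of_real (cmod l) = l * cnj l" "complex_of_real (cmod m) * of_real (cmod m) = m * cnj m"
    using complex_norm_square[of l] complex_norm_square[of m] by (simp_all add: power2_eq_square)
  have "cmod l * cmod m \<noteq> 0" using assms by simp
  have Z: "of_real e * (m * w1) * cnj (m * w2) + (l * v1) * cnj (l * v2) / of_real e
     = of_real (cmod l * cmod m) * (of_real (e * (cmod m / cmod l)) * w1 * cnj w2 + v1 * cnj v2 / of_real (e * (cmod m / cmod l)))"
    (is "?L = ?R")
  proof -
    have "?R = of_real e * (of_real (cmod m) * of_real (cmod m)) * w1 * cnj w2 + (of_real (cmod l) * of_real (cmod l)) * v1 * cnj v2 / of_real e"
      using assms by (simp add: field_simps)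
    also have "\<dots> = ?L" unfolding n by (simp add: algebra_simps)
    finally show ?thesis by simp
  qed
  show ?thesis
    unfolding geo_point_def Let_def fst_conv snd_conv W D Z
    using \<open>cmod l * cmod m \<noteq> 0\<close> by (simp add: times_divide_eq_right)
qed

lemma exp_cosh_tanh: "exp r + 1 / exp r = 2 * cosh (r::real)" "exp r - 1 / exp r = 2 * cosh r * tanh r"
proof -
  have e: "1 / exp r = exp (- r)" by (simp only: exp_minus inverse_eq_divide)
  have t: "cosh r * tanh r = sinh r" by (simp only: tanh_def) simp
  show "exp r + 1 / exp r = 2 * cosh r" unfolding e using cosh_plus_sinh[of r] cosh_minus_sinh[of r] by linarith
  show "exp r - 1 / exp r = 2 * cosh r * tanh r" unfolding e mult.assoc t using cosh_plus_sinh[of r] cosh_minus_sinh[of r] by linarith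
qed

lemma complex_exp_cosh_tanh:
  "complex_of_real (exp r) = of_real (cosh r) * (1 + of_real (tanh r))"
  "1 / complex_of_real (exp r) = of_real (cosh r) * (1 - of_real (tanh r))"
proof -
  have "exp r = cosh r * (1 + tanh r)" "1 / exp r = cosh r * (1 - tanh r)"
    using exp_cosh_tanh[of r] by (simp_all only: ring_distribs mult_1_right)
  from this[THEN arg_cong[where f = complex_of_real]]
  show "complex_of_real (exp r) = of_real (cosh r) * (1 + of_real (tanh r))"
    "1 / complex_of_real (exp r) = of_real (cosh r) * (1 - of_real (tanh r))"
    by (simp_all only: of_real_mult of_real_add of_real_diff of_real_divide of_real_1)
qed

lemma geodesic_eq_geo_point_normalized:
  assumes "det2 v w \<noteq> 0" "is_start v s1" "is_end w s2"
    "snd v = (if s1 = None then 0 else 1)" "fst v = (if s1 = None then 1 else fst v)"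
    "fst w = (if s2 = None then 0 else 1)" "snd w = (if s2 = None then 1 else snd w)"
  shows "\<exists>\<kappa>>0. \<forall>r. geodesic (s1, s2) r = geo_point v w (\<kappa> * exp r)"
proof -
  obtain v1 v2 w1 w2 where vw: "v = (v1, v2)" "w = (w1, w2)" by (cases v, cases w)
  show ?thesis
  proof (cases s1; cases s2)
    fix \<mu>1 \<mu>2 assume s: "s1 = Some \<mu>1" "s2 = Some \<mu>2"
    then have v: "v1 = - \<mu>1" "v2 = 1" "w1 = 1" "w2 = cnj \<mu>2"
      using assms by (auto simp: vw is_start_def is_end_def)
    have D: "cmod (det2 v w) = cmod (1 + cnj \<mu>1 * \<mu>2)"
    proof -
      have "det2 v w = - cnj (1 + cnj \<mu>1 * \<mu>2)" by (simp add: det2_def vw v)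
      then show ?thesis by (metis complex_mod_cnj norm_minus_cancel)
    qed
    show ?thesis
    proof (cases "\<mu>2 = 0")
      case True
      have "geodesic (s1, s2) r = geo_point v w (1 * exp r)" for r
        using True by (simp add: s geo_point_def Let_def vw v det2_def)
      then show ?thesis by (metis zero_less_one)
    next
      case False
      define m where "m = cmod \<mu>2"
      have m: "m > 0" "cnj \<mu>2 * \<mu>2 = of_real m * of_real m" using False complex_norm_square[of \<mu>2]
        by (simp_all add: m_def power2_eq_square mult.commute)
      have "geodesic (s1, s2) r = geo_point v w (1 / m * exp r)" for r
      proof -
        have W: "1 / m * exp r * (cmod (snd w))\<^sup>2 + (cmod (snd v))\<^sup>2 / (1 / m * exp r) = 2 * m * cosh r"
        proof -
          have *: "1 / m * E * m\<^sup>2 + 1\<^sup>2 / (1 / m * E) = m * (E + 1 / E)" if "E > 0" for E :: real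
            using m(1) that by (simp add: power2_eq_square field_simps)
          show ?thesis using *[of "exp r"] by (simp only: vw v m_def[symmetric] exp_cosh_tanh fst_conv snd_conv complex_mod_cnj norm_one exp_gt_zero)
        qed
        have c: "cosh r > 0" by simp
        have "(of_real (1 / m * exp r) * fst w * cnj (snd w) + fst v * cnj (snd v) / of_real (1 / m * exp r))
           = of_real (1 / m) * of_real (exp r) * \<mu>2 - \<mu>1 * of_real m * (1 / of_real (exp r))"
          by (simp add: vw v field_simps)
        also have "\<dots> = of_real (cosh r) * ((1 + of_real (tanh r)) * \<mu>2 / of_real m - \<mu>1 * of_real m * (1 - of_real (tanh r)))"
          unfolding complex_exp_cosh_tanh(2) unfolding complex_exp_cosh_tanh(1) using m(1) by (simp add: field_simps)
        also have "\<dots> / of_real (2 * m * cosh r) = ((1 + of_real (tanh r)) * \<mu>2 / of_real m - \<mu>1 * of_real m * (1 - of_real (tanh r))) / (2 * of_real m)"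
          using c m by simp
        also have "\<dots> = ((1 + of_real (tanh r)) * \<mu>2 - \<mu>1 * (of_real m * of_real m) * (1 - of_real (tanh r))) / (2 * (of_real m * of_real m))"
          using m(1) by (simp add: field_simps)
        also have "\<dots> = (1 - \<mu>1 * cnj \<mu>2) / (2 * cnj \<mu>2)
              + (1 + \<mu>1 * cnj \<mu>2) / (2 * cnj \<mu>2) * of_real (tanh r)"
          unfolding m(2)[symmetric] using False by (simp add: field_simps)
        finally show ?thesis
          using False unfolding geo_point_def Let_def W D by (simp add: s m_def)
      qed
      then show ?thesis using m by (metis zero_less_divide_1_iff)
    qed
  next
    fix \<mu>1 assume s: "s1 = Some \<mu>1" "s2 = None"
    then have v: "v1 = - \<mu>1" "v2 = 1" "w1 = 0" "w2 = 1"
      using assms by (auto simp: vw is_start_def is_end_def)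
    have "geodesic (s1, s2) r = geo_point v w (1 * exp r)" for r
    proof -
      have W: "exp r + 1 / exp r = 2 * cosh r" using exp_cosh_tanh[of r] by simp
      have "(- \<mu>1 / of_real (exp r)) / of_real (2 * cosh r) = - \<mu>1 * (1 / of_real (exp r)) / of_real (2 * cosh r)"
        by simp
      also have "\<dots> = - \<mu>1 / 2 + \<mu>1 / 2 * of_real (tanh r)" unfolding complex_exp_cosh_tanh(2) by (simp add: field_simps)
      finally show ?thesis
        by (simp add: s geo_point_def Let_def vw v det2_def W del: of_real_mult)
    qed
    then show ?thesis by (metis zero_less_one)
  next
    fix \<mu>2 assume s: "s1 = None" "s2 = Some \<mu>2"
    then have v: "v1 = 1" "v2 = 0" "w1 = 1" "w2 = cnj \<mu>2"
      using assms by (auto simp: vw is_start_def is_end_def)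
    have nz: "\<mu>2 \<noteq> 0" using assms(1) by (auto simp: vw v det2_def)
    have W: "complex_of_real ((cmod \<mu>2)\<^sup>2) = \<mu>2 * cnj \<mu>2" by (rule complex_norm_square)
    have "geodesic (s1, s2) r = geo_point v w (1 / cmod \<mu>2 * exp r)" for r
    proof -
      define c where "c = cmod \<mu>2"
      define e where "e = 1 / c * exp r"
      have c: "c > 0" "e > 0" and W': "complex_of_real c * of_real c = \<mu>2 * cnj \<mu>2"
        using nz W by (simp_all add: c_def e_def power2_eq_square)
      have "geo_point v w e = (c / (e * (c * c)), of_real e * \<mu>2 / (of_real e * (of_real c * of_real c)))"
        by (simp add: geo_point_def Let_def vw v det2_def c_def power2_eq_square)
      also have "of_real e * \<mu>2 / (of_real e * (of_real c * of_real c)) = 1 / cnj \<mu>2"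
        unfolding W' using c nz by (simp only: mult_divide_mult_cancel_left of_real_eq_0_iff less_imp_neq[OF c(2), symmetric] not_False_eq_True) simp
      also have "c / (e * (c * c)) = exp (- r)"
        using c by (simp only: e_def exp_minus) (simp add: inverse_eq_divide)
      finally show ?thesis by (simp add: s e_def c_def)
    qed
    then show ?thesis using nz by (metis zero_less_norm_iff zero_less_divide_1_iff)
  next
    assume s: "s1 = None" "s2 = None"
    then have v: "v1 = 1" "v2 = 0" "w1 = 0" "w2 = 1"
      using assms by (auto simp: vw is_start_def is_end_def)
    have "geodesic (s1, s2) r = geo_point v w (1 * exp r)" for r
      by (simp add: s geo_point_def Let_def vw v det2_def exp_minus field_simps)
    then show ?thesis by (metis zero_less_one)
  qed
qed

text \<open>In exponential parameter the matrix curve \<open>e w w* + v v* / e\<close> has unit speed, so all five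
  formulas of the definition of \<^term>\<open>geodesic\<close> are instances of one, up to a shift of the arc length.\<close>

lemma geodesic_eq_geo_point:
  assumes "\<gamma> \<in> LH3" "is_start v (fst \<gamma>)" "is_end w (snd \<gamma>)"
  obtains \<kappa> where "\<kappa> > 0" "\<And>r. geodesic \<gamma> r = geo_point v w (\<kappa> * exp r)"
proof -
  obtain s1 s2 where g: "\<gamma> = (s1, s2)" by (cases \<gamma>)
  define l where "l = (if s1 = None then fst v else snd v)"
  define m where "m = (if s2 = None then snd w else fst w)"
  have lm: "l \<noteq> 0" "m \<noteq> 0" using assms by (auto simp: g l_def m_def is_start_def is_end_def split: option.splits)
  define v' where "v' = (fst v / l, snd v / l)"
  define w' where "w' = (fst w / m, snd w / m)"
  have vw: "v = (l * fst v', l * snd v')" "w = (m * fst w', m * snd w')"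
    using lm by (simp_all add: v'_def w'_def)
  have st: "is_start v' s1" "is_end w' s2"
    using assms lm by (auto simp: g v'_def w'_def is_start_def is_end_def split: option.splits)
  then have "det2 v' w' \<noteq> 0" using LH3_iff_det2[of v' "(s1, s2)" w'] assms(1) g by simp
  then have "\<exists>\<kappa>>0. \<forall>r. geodesic (s1, s2) r = geo_point v' w' (\<kappa> * exp r)"
    using st lm by (intro geodesic_eq_geo_point_normalized) (auto simp: v'_def w'_def l_def m_def is_start_def is_end_def split: option.splits)
  then obtain \<kappa> where k: "\<kappa> > 0" "\<And>r. geodesic \<gamma> r = geo_point v' w' (\<kappa> * exp r)" using g by blast
  have "geodesic \<gamma> r = geo_point v w (\<kappa> * cmod l / cmod m * exp r)" for r
    unfolding k vw using geo_point_scale[OF lm, of "\<kappa> * cmod l / cmod m * exp r" "fst v'" "snd v'" "fst w'" "snd w'"] k lm by simp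
  then show ?thesis using k lm by (intro that[of "\<kappa> * cmod l / cmod m"]) auto
qed

section \<open>Level functions of Hermitian forms\<close>

text \<open>This is the trace pairing of the form with the point, seen as a Hermitian matrix of determinant one.
  The level sets of \<open>Phi A\<close> are the spheres about a point, the horospheres at a boundary point, or the
  surfaces equidistant from a plane, according to the sign of \<^term>\<open>hdet A\<close>.\<close>

definition Phi :: "herm \<Rightarrow> half_space \<Rightarrow> real" where
  "Phi A p = (case A of (a, d, b) \<Rightarrow> (a * (p \<bullet> p) + 2 * Re (b * snd p) + d) / fst p)"

text \<open>The gradient with respect to the Euclidean inner product.\<close>

definition hgrad :: "herm \<Rightarrow> half_space \<Rightarrow> half_space" where
  "hgrad A p = (case A of (a, d, b) \<Rightarrow>
     (1 / fst p) *\<^sub>R ((2 * a) *\<^sub>R p + (0, 2 * cnj b)) - (Phi A p / fst p) *\<^sub>R (1, 0))"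

lemma inner_cnj_complex: "cnj b \<bullet> z = Re (b * z)"
  by (simp add: inner_complex_def)

lemma Phi_has_derivative:
  assumes "p \<in> H3"
  shows "(Phi A has_derivative (\<lambda>w. hgrad A p \<bullet> w)) (at p)"
proof -
  obtain a d b where A: "A = (a, d, b)" by (cases A)
  obtain t z where p: "p = (t, z)" by (cases p)
  have t: "t > 0" using assms by (simp add: H3_def p)
  have eq: "Phi A = (\<lambda>p. (a * (p \<bullet> p) + 2 * (cnj b \<bullet> snd p) + d) / fst p)"
    by (auto simp: Phi_def A inner_cnj_complex)
  have "(Phi A has_derivative (\<lambda>w. ((a * (p \<bullet> w + w \<bullet> p) + 2 * (cnj b \<bullet> snd w)) * fst p - (a * (p \<bullet> p) + 2 * (cnj b \<bullet> snd p) + d) * fst w) / (fst p * fst p))) (at p)"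
    unfolding eq using t by (auto intro!: derivative_eq_intros simp: p)
  moreover have "((a * (p \<bullet> w + w \<bullet> p) + 2 * (cnj b \<bullet> snd w)) * fst p - (a * (p \<bullet> p) + 2 * (cnj b \<bullet> snd p) + d) * fst w) / (fst p * fst p) = hgrad A p \<bullet> w" for w
    using t unfolding hgrad_def eq Phi_def A p
    by (cases w) (simp add: inner_diff_left inner_add_left inner_commute[of _ "snd w"] field_simps inner_complex_def)
  ultimately show ?thesis by simp
qed

text \<open>The left side is the squared hyperbolic length of the gradient. On a level set of \<^term>\<open>Phi A\<close> it is
  constant; together with the Gram identity this is where incidence meets the Cauchy-Schwarz inequality.\<close>

lemma norm_hgrad:
  assumes "p \<in> H3"
  shows "(fst p)\<^sup>2 * (hgrad A p \<bullet> hgrad A p) = (Phi A p)\<^sup>2 - 4 * hdet A"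
proof -
  obtain a d b where A: "A = (a, d, b)" by (cases A)
  obtain t z where p: "p = (t, z)" by (cases p)
  have t: "t > 0" using assms by (simp add: H3_def p)
  have 1: "t *\<^sub>R hgrad A p = (2 * a) *\<^sub>R p + (0, 2 * cnj b) - (Phi A p) *\<^sub>R (1, 0)"
    using t by (simp add: hgrad_def A p field_simps)
  have 2: "t * Phi A p = a * (t * t + z \<bullet> z) + 2 * Re (b * z) + d"
    using t by (simp add: Phi_def A p)
  have "(fst p)\<^sup>2 * (hgrad A p \<bullet> hgrad A p) = (t *\<^sub>R hgrad A p) \<bullet> (t *\<^sub>R hgrad A p)"
    by (simp add: p power2_eq_square)
  also have "\<dots> = (2 * a * t - Phi A p)\<^sup>2 + (2 * a * Re z + 2 * Re b)\<^sup>2 + (2 * a * Im z - 2 * Im b)\<^sup>2"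
    unfolding 1 by (simp add: p inner_complex_def power2_eq_square)
  also have "\<dots> = (Phi A p)\<^sup>2 - 4 * a * (t * Phi A p) + 4 * a\<^sup>2 * (t * t + z \<bullet> z) + 8 * a * Re (b * z) + 4 * (cmod b)\<^sup>2"
    unfolding cmod_power2 by (simp add: inner_complex_def power2_eq_square algebra_simps)
  also have "\<dots> = (Phi A p)\<^sup>2 - 4 * hdet A"
    unfolding 2 by (simp add: hdet_def A algebra_simps power2_eq_square)
  finally show ?thesis .
qed

lemma det2_snd_nz: "det2 v w \<noteq> 0 \<Longrightarrow> e > 0 \<Longrightarrow> e * (cmod (snd w))\<^sup>2 + (cmod (snd v))\<^sup>2 / e > 0"
  by (cases "snd w = 0"; cases "snd v = 0") (auto simp: det2_def add_pos_nonneg add_nonneg_pos)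

lemma geo_point_in_H3: "det2 v w \<noteq> 0 \<Longrightarrow> e > 0 \<Longrightarrow> geo_point v w e \<in> H3"
  using det2_snd_nz[of v w e] by (simp add: geo_point_def H3_def Let_def)

lemma geo_point_inner_self:
  assumes "det2 v w \<noteq> 0" "e > 0"
  shows "geo_point v w e \<bullet> geo_point v w e
    = (e * (cmod (fst w))\<^sup>2 + (cmod (fst v))\<^sup>2 / e) / (e * (cmod (snd w))\<^sup>2 + (cmod (snd v))\<^sup>2 / e)"
proof -
  obtain v1 v2 w1 w2 where vw: "v = (v1, v2)" "w = (w1, w2)" by (cases v, cases w)
  define W where "W = e * (cmod w2)\<^sup>2 + (cmod v2)\<^sup>2 / e"
  define V where "V = e * (cmod w1)\<^sup>2 + (cmod v1)\<^sup>2 / e"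
  define E where "E = complex_of_real e"
  define Z where "Z = E * w1 * cnj w2 + v1 * cnj v2 / E"
  have E: "E \<noteq> 0" "cnj E = E" using assms by (auto simp: E_def)
  have W0: "W > 0" using det2_snd_nz[OF assms] by (simp add: W_def vw)
  have "complex_of_real ((cmod (det2 v w))\<^sup>2 + (cmod Z)\<^sup>2) = det2 v w * cnj (det2 v w) + Z * cnj Z"
    by (simp only: of_real_add complex_norm_square)
  also have "\<dots> = (E * (w1 * cnj w1) + (v1 * cnj v1) / E) * (E * (w2 * cnj w2) + (v2 * cnj v2) / E)"
    using E by (simp add: Z_def vw det2_def field_simps)
  also have "\<dots> = complex_of_real (V * W)"
    by (simp only: V_def W_def E_def complex_norm_square of_real_add of_real_mult of_real_divide)
  finally have eq: "(cmod (det2 v w))\<^sup>2 + (cmod Z)\<^sup>2 = V * W" by (simp only: of_real_eq_iff)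
  have "geo_point v w e = (cmod (det2 v w) / W, Z / of_real W)"
    by (simp add: geo_point_def Let_def vw W_def Z_def E_def)
  then have "geo_point v w e \<bullet> geo_point v w e = (cmod (det2 v w))\<^sup>2 / W\<^sup>2 + (cmod Z)\<^sup>2 / W\<^sup>2"
    by (simp only: inner_Pair dot_square_norm[of "_ :: complex"] inner_real_def) (simp add: norm_divide power_divide power2_eq_square)
  also have "\<dots> = V / W" using W0 unfolding add_divide_distrib[symmetric] eq by (simp add: power2_eq_square)
  finally show ?thesis by (simp add: V_def W_def vw)
qed

lemma hquad_eq: "hquad (a, d, b) x = a * (cmod (fst x))\<^sup>2 + 2 * Re (b * (fst x * cnj (snd x))) + d * (cmod (snd x))\<^sup>2"
  unfolding hquad_def hform_def cmod_power2 by (simp add: algebra_simps power2_eq_square)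

text \<open>The pairing is linear in the matrix, and pairs \<open>w w*\<close> with \<open>A\<close> to \<^term>\<open>hquad A w\<close>.\<close>

lemma Phi_geo_point:
  assumes "det2 v w \<noteq> 0" "e > 0"
  shows "Phi A (geo_point v w e) = (e * hquad A w + hquad A v / e) / cmod (det2 v w)"
proof -
  obtain a d b where A: "A = (a, d, b)" by (cases A)
  define W where "W = e * (cmod (snd w))\<^sup>2 + (cmod (snd v))\<^sup>2 / e"
  have W0: "W > 0" using det2_snd_nz[OF assms] by (simp add: W_def)
  define X where "X = a * (e * (cmod (fst w))\<^sup>2 + (cmod (fst v))\<^sup>2 / e)
      + 2 * (e * Re (b * (fst w * cnj (snd w))) + Re (b * (fst v * cnj (snd v))) / e) + d * W"
  have X: "X = e * hquad A w + hquad A v / e"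
  proof -
    have "a * (e * P1 + Q1 / e) + 2 * (e * R1 + R2 / e) + d * (e * P2 + Q2 / e)
        = e * (a * P1 + 2 * R1 + d * P2) + (a * Q1 + 2 * R2 + d * Q2) / e" for P1 Q1 R1 R2 P2 Q2 :: real
      by (simp add: algebra_simps add_divide_distrib)
    then show ?thesis unfolding X_def W_def A hquad_eq .
  qed
  have "Re (b * ((of_real e * fst w * cnj (snd w) + fst v * cnj (snd v) / of_real e) / of_real W))
     = Re ((of_real e * (b * (fst w * cnj (snd w))) + b * (fst v * cnj (snd v)) / of_real e) / of_real W)"
    by (rule arg_cong[where f = Re]) (simp add: algebra_simps add_divide_distrib)
  also have "\<dots> = (e * Re (b * (fst w * cnj (snd w))) + Re (b * (fst v * cnj (snd v))) / e) / W"
    by (simp only: Re_divide_of_real plus_complex.simps Re_complex_of_real times_complex.simps Im_complex_of_real) simp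
  finally have R: "Re (b * snd (geo_point v w e))
      = (e * Re (b * (fst w * cnj (snd w))) + Re (b * (fst v * cnj (snd v))) / e) / W"
    by (simp only: geo_point_def Let_def snd_conv W_def)
  have F: "fst (geo_point v w e) = cmod (det2 v w) / W"
    by (simp only: geo_point_def Let_def fst_conv W_def)
  have "a * (N / W) + 2 * (R / W) + d = (a * N + 2 * R + d * W) / W" for N R
    using W0 by (simp add: field_simps)
  then have "Phi A (geo_point v w e) = (X / W) / (cmod (det2 v w) / W)"
    unfolding Phi_def A prod.case geo_point_inner_self[OF assms] R F X_def W_def[symmetric] by (simp only:)
  then show ?thesis using W0 by (simp add: X)
qed

section \<open>Light rays of unit tangent vectors\<close>

text \<open>If \<open>X\<close> is the matrix of determinant one of the point \<open>p\<close> and \<open>X'\<close> its derivative in the direction \<open>v\<close>,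
  then this is \<open>(fst p)\<^sup>2 (X + X')\<close>, given by its first diagonal, off-diagonal and second diagonal entry.
  For a unit vector it is light-like, that is of rank one, and its direction is the boundary point at
  which the geodesic with this velocity ends. So it recovers the end point from position and velocity.\<close>

definition ray :: "half_space \<Rightarrow> half_space \<Rightarrow> real \<times> complex \<times> real" where
  "ray p v = ((fst p - fst v) * (p \<bullet> p) + 2 * fst p * (p \<bullet> v),
     (fst p - fst v) *\<^sub>R snd p + fst p *\<^sub>R snd v, fst p - fst v)"

text \<open>The rank one matrix \<open>x x*\<close>, in the same coordinates as \<^term>\<open>ray\<close>.\<close>

definition outer :: "complex \<times> complex \<Rightarrow> real \<times> complex \<times> real" where
  "outer x = ((cmod (fst x))\<^sup>2, fst x * cnj (snd x), (cmod (snd x))\<^sup>2)"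

text \<open>Here \<open>S\<close>, \<open>T\<close>, \<open>R\<close>, \<open>U\<close> stand for the summands of the diagonal entries of \<open>e w w* + v v* / e\<close>;
  the equations are the entries of \<open>X + X'\<close> and \<open>X - X'\<close> along a geodesic, in which one summand cancels.\<close>

lemma ray_arith:
  fixes S T D R U :: real
  assumes "S + T > 0"
  defines "W \<equiv> S + T"
  shows "D / W - - D * (S - T) / W\<^sup>2 = 2 * D / W\<^sup>2 * S"
    "D / W + - D * (S - T) / W\<^sup>2 = 2 * D / W\<^sup>2 * T"
    "2 * D / W\<^sup>2 * S * ((R + U) / W) + D / W * ((R - U) / W - (S - T) * (R + U) / W\<^sup>2) = 2 * D / W\<^sup>2 * R"
    "2 * D / W\<^sup>2 * T * ((R + U) / W) - D / W * ((R - U) / W - (S - T) * (R + U) / W\<^sup>2) = 2 * D / W\<^sup>2 * U"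
    "2 * D / W\<^sup>2 * S * (1 / W) + D / W * (1 / W - (S - T) / W\<^sup>2) = 2 * D / W\<^sup>2"
    "2 * D / W\<^sup>2 * S * (1 / W) + D / W * (- (1 / W) - (S - T) / W\<^sup>2) = 0"
    "2 * D / W\<^sup>2 * T * (1 / W) - D / W * (1 / W - (S - T) / W\<^sup>2) = 0"
    "2 * D / W\<^sup>2 * T * (1 / W) - D / W * (- (1 / W) - (S - T) / W\<^sup>2) = 2 * D / W\<^sup>2"
    "1 / W - (S - T) / W\<^sup>2 = 2 / W\<^sup>2 * T"
    "- (1 / W) - (S - T) / W\<^sup>2 = - (2 / W\<^sup>2 * S)"
proof -
  have W: "W \<noteq> 0" and T: "T = W - S" using assms by auto
  show "D / W - - D * (S - T) / W\<^sup>2 = 2 * D / W\<^sup>2 * S"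
    "D / W + - D * (S - T) / W\<^sup>2 = 2 * D / W\<^sup>2 * T"
    "2 * D / W\<^sup>2 * S * ((R + U) / W) + D / W * ((R - U) / W - (S - T) * (R + U) / W\<^sup>2) = 2 * D / W\<^sup>2 * R"
    "2 * D / W\<^sup>2 * T * ((R + U) / W) - D / W * ((R - U) / W - (S - T) * (R + U) / W\<^sup>2) = 2 * D / W\<^sup>2 * U"
    "2 * D / W\<^sup>2 * S * (1 / W) + D / W * (1 / W - (S - T) / W\<^sup>2) = 2 * D / W\<^sup>2"
    "2 * D / W\<^sup>2 * S * (1 / W) + D / W * (- (1 / W) - (S - T) / W\<^sup>2) = 0"
    "2 * D / W\<^sup>2 * T * (1 / W) - D / W * (1 / W - (S - T) / W\<^sup>2) = 0"
    "2 * D / W\<^sup>2 * T * (1 / W) - D / W * (- (1 / W) - (S - T) / W\<^sup>2) = 2 * D / W\<^sup>2"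
    "1 / W - (S - T) / W\<^sup>2 = 2 / W\<^sup>2 * T"
    "- (1 / W) - (S - T) / W\<^sup>2 = - (2 / W\<^sup>2 * S)"
    unfolding T using W by (simp_all add: divide_simps power2_eq_square) (simp_all add: algebra_simps)
qed

text \<open>Along \<open>e w w* + v v* / e\<close> with \<open>e = \<kappa> exp r\<close>, differentiation reverses the sign of the second summand,
  so that \<open>X + X'\<close> and \<open>X - X'\<close> are multiples of \<open>w w*\<close> and of \<open>v v*\<close>.\<close>

lemma geodesic_vector_derivative:
  assumes g: "\<And>r. geodesic \<gamma> r = geo_point v w (\<kappa> * exp r)" and D: "det2 v w \<noteq> 0" and k: "\<kappa> > 0"
  shows "(geodesic \<gamma> has_vector_derivative velocity \<gamma> r) (at r)"
    and "velocity \<gamma> r \<bullet> velocity \<gamma> r = (fst (geodesic \<gamma> r))\<^sup>2"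
    and "\<exists>l>0. ray (geodesic \<gamma> r) (velocity \<gamma> r) = l *\<^sub>R outer w"
    and "\<exists>l>0. ray (geodesic \<gamma> r) (- velocity \<gamma> r) = l *\<^sub>R outer v"
proof -
  obtain v1 v2 w1 w2 where vw: "v = (v1, v2)" "w = (w1, w2)" by (cases v, cases w)
  define D' where "D' = cmod (det2 v w)"
  define e where "e = (\<lambda>r. \<kappa> * exp r)"
  have e0: "e r > 0" for r using k by (simp add: e_def)
  have de: "(e has_real_derivative e r) (at r)" for r
    unfolding e_def by (auto intro!: derivative_eq_intros)
  have dei: "((\<lambda>r. 1 / e r) has_real_derivative - (1 / e r)) (at r)" for r
    using e0[of r] by (auto intro!: derivative_eq_intros de simp: field_simps)
  define S where "S = (\<lambda>r. e r * (cmod w2)\<^sup>2)"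
  define T where "T = (\<lambda>r. (cmod v2)\<^sup>2 / e r)"
  define R where "R = (\<lambda>r. e r * (cmod w1)\<^sup>2)"
  define U where "U = (\<lambda>r. (cmod v1)\<^sup>2 / e r)"
  define P where "P = (\<lambda>r. e r *\<^sub>R (w1 * cnj w2))"
  define Q where "Q = (\<lambda>r. (1 / e r) *\<^sub>R (v1 * cnj v2))"
  have W00: "S r + T r > 0" for r using det2_snd_nz[OF D e0[of r]] by (simp add: S_def T_def vw)
  have D0: "D' > 0" using D by (simp add: D'_def)
  have dS: "(S has_real_derivative S r) (at r)" for r unfolding S_def by (auto intro!: derivative_eq_intros de)
  have dR: "(R has_real_derivative R r) (at r)" for r unfolding R_def by (auto intro!: derivative_eq_intros de)
  have dT: "(T has_real_derivative - T r) (at r)" for r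
    unfolding T_def using DERIV_cmult[OF dei, of "(cmod v2)\<^sup>2"] by simp
  have dU: "(U has_real_derivative - U r) (at r)" for r
    unfolding U_def using DERIV_cmult[OF dei, of "(cmod v1)\<^sup>2"] by simp
  have dP: "(P has_vector_derivative P r) (at r)" for r
    unfolding P_def by (auto intro!: derivative_eq_intros de)
  have dQ: "(Q has_vector_derivative - Q r) (at r)" for r
    unfolding Q_def using has_vector_derivative_scaleR[OF dei has_vector_derivative_const, of "v1 * cnj v2" r] by simp
  define W where "W = (\<lambda>r. S r + T r)"
  have W0: "W r > 0" for r using W00 by (simp add: W_def)
  have ra: "S r + T r = W r" for r by (simp add: W_def)
  note ar = ray_arith[OF W00, unfolded ra]
  have gr: "geodesic \<gamma> r = (D' / W r, (1 / W r) *\<^sub>R (P r + Q r))" for r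
    using e0[of r] unfolding g geo_point_def Let_def
    by (simp add: vw W_def S_def T_def P_def Q_def D'_def e_def scaleR_conv_of_real divide_inverse mult.commute)
  have dW: "(W has_real_derivative (S r - T r)) (at r)" for r
    unfolding W_def using DERIV_add[OF dS dT] by simp
  have dWi: "((\<lambda>r. 1 / W r) has_real_derivative - (S r - T r) / (W r)\<^sup>2) (at r)" for r
    using W0[of r] by (auto intro!: derivative_eq_intros dW simp: field_simps power2_eq_square)
  define V where "V = (\<lambda>r. (- D' * (S r - T r) / (W r)\<^sup>2,
     (1 / W r) *\<^sub>R (P r - Q r) - ((S r - T r) / (W r)\<^sup>2) *\<^sub>R (P r + Q r)))"
  have dg: "(geodesic \<gamma> has_vector_derivative V r) (at r)" for r
  proof -
    have "((\<lambda>x. D' * (1 / W x)) has_vector_derivative D' * (- (S r - T r) / (W r)\<^sup>2)) (at r)"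
      using DERIV_cmult[OF dWi, of D' r] by (simp only: has_real_derivative_iff_has_vector_derivative)
    then have "((\<lambda>r. (D' * (1 / W r), (1 / W r) *\<^sub>R (P r + Q r))) has_vector_derivative
      (D' * (- (S r - T r) / (W r)\<^sup>2), (1 / W r) *\<^sub>R (P r + - Q r) + (- (S r - T r) / (W r)\<^sup>2) *\<^sub>R (P r + Q r))) (at r)"
      by (intro has_vector_derivative_Pair has_vector_derivative_scaleR dWi has_vector_derivative_add dP dQ)
    moreover have "geodesic \<gamma> = (\<lambda>r. (D' * (1 / W r), (1 / W r) *\<^sub>R (P r + Q r)))" by (rule ext) (simp add: gr)
    moreover have "(D' * (- (S r - T r) / (W r)\<^sup>2), (1 / W r) *\<^sub>R (P r + - Q r) + (- (S r - T r) / (W r)\<^sup>2) *\<^sub>R (P r + Q r)) = V r"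
      by (simp only: V_def minus_divide_left[symmetric] scaleR_minus_left) simp
    ultimately show ?thesis by (simp only:)
  qed
  then have vel: "velocity \<gamma> r = V r" for r
    unfolding velocity_def by (rule vector_derivative_at)
  show der: "(geodesic \<gamma> has_vector_derivative velocity \<gamma> r) (at r)" for r using dg vel by simp
  have pp: "geodesic \<gamma> r \<bullet> geodesic \<gamma> r = (R r + U r) / W r" for r
    unfolding g geo_point_inner_self[OF D e0[of r, unfolded e_def]] by (simp add: R_def U_def W_def S_def T_def e_def vw)
  have pv: "2 * (geodesic \<gamma> r \<bullet> velocity \<gamma> r) = (R r - U r) / W r - (S r - T r) * (R r + U r) / (W r)\<^sup>2" for r
  proof -
    have "((\<lambda>r. geodesic \<gamma> r \<bullet> geodesic \<gamma> r) has_real_derivative 2 * (geodesic \<gamma> r \<bullet> velocity \<gamma> r)) (at r)"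
      using bounded_bilinear.has_vector_derivative[OF bounded_bilinear_inner der[of r] der[of r]]
      unfolding has_real_derivative_iff_has_vector_derivative inner_commute[of "velocity \<gamma> r"] mult_2 .
    moreover have "((\<lambda>r. (R r + U r) / W r) has_real_derivative (R r - U r) / W r - (S r - T r) * (R r + U r) / (W r)\<^sup>2) (at r)"
    proof -
      have "((\<lambda>r. (R r + U r) / W r) has_real_derivative ((R r + - U r) * W r - (R r + U r) * (S r - T r)) / (W r * W r)) (at r)"
        using W0[of r] by (intro DERIV_divide DERIV_add dR dU dW) simp
      moreover have "((R r + - U r) * W r - (R r + U r) * (S r - T r)) / (W r * W r) = (R r - U r) / W r - (S r - T r) * (R r + U r) / (W r)\<^sup>2"
        using W0[of r] by (simp add: diff_divide_distrib power2_eq_square)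
      ultimately show ?thesis by (simp only:)
    qed
    ultimately show ?thesis unfolding pp by (rule DERIV_unique)
  qed
  define r0 where "r0 = r"
  have ray1: "ray (geodesic \<gamma> r) (velocity \<gamma> r) = (2 * D' / (W r)\<^sup>2) *\<^sub>R (R r, P r, S r)"
  proof -
    have t: "fst (geodesic \<gamma> r) - fst (velocity \<gamma> r) = 2 * D' / (W r)\<^sup>2 * S r"
      unfolding vel V_def gr fst_conv by (rule ar)
    have c1: "2 * D' / (W r)\<^sup>2 * S r * ((R r + U r) / W r) + fst (geodesic \<gamma> r) * ((R r - U r) / W r - (S r - T r) * (R r + U r) / (W r)\<^sup>2)
       = 2 * D' / (W r)\<^sup>2 * R r"
      unfolding gr fst_conv by (rule ar)
    have c2: "(2 * D' / (W r)\<^sup>2 * S r) *\<^sub>R ((1 / W r) *\<^sub>R (P r + Q r))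
       + (D' / W r) *\<^sub>R ((1 / W r) *\<^sub>R (P r - Q r) - ((S r - T r) / (W r)\<^sup>2) *\<^sub>R (P r + Q r)) = (2 * D' / (W r)\<^sup>2) *\<^sub>R P r"
    proof -
      have x: "2 * D' / (W r)\<^sup>2 * S r * (1 / W r) + D' / W r * (1 / W r - (S r - T r) / (W r)\<^sup>2) = 2 * D' / (W r)\<^sup>2"
        by (rule ar)
      have y: "2 * D' / (W r)\<^sup>2 * S r * (1 / W r) + D' / W r * (- (1 / W r) - (S r - T r) / (W r)\<^sup>2) = 0"
        by (rule ar)
      have "?thesis \<longleftrightarrow> (2 * D' / (W r)\<^sup>2 * S r * (1 / W r) + D' / W r * (1 / W r - (S r - T r) / (W r)\<^sup>2)) *\<^sub>R P r
         + (2 * D' / (W r)\<^sup>2 * S r * (1 / W r) + D' / W r * (- (1 / W r) - (S r - T r) / (W r)\<^sup>2)) *\<^sub>R Q r = (2 * D' / (W r)\<^sup>2) *\<^sub>R P r"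
        by (simp add: algebra_simps)
      then show ?thesis unfolding x y by simp
    qed
    show ?thesis
    proof -
      have "2 * D' / (W r)\<^sup>2 * S r * ((R r + U r) / W r) + 2 * fst (geodesic \<gamma> r) * (geodesic \<gamma> r \<bullet> velocity \<gamma> r)
          = 2 * D' / (W r)\<^sup>2 * R r"
        unfolding c1[unfolded pv[of r, symmetric], symmetric] by simp
      moreover have "(2 * D' / (W r)\<^sup>2 * S r) *\<^sub>R snd (geodesic \<gamma> r) + fst (geodesic \<gamma> r) *\<^sub>R snd (velocity \<gamma> r)
          = (2 * D' / (W r)\<^sup>2) *\<^sub>R P r"
        unfolding c2[symmetric] by (simp add: gr vel V_def)
      ultimately show ?thesis
        unfolding ray_def t pp scaleR_Pair real_scaleR_def by (simp only:)
    qed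
  qed
  show "\<exists>l>0. ray (geodesic \<gamma> r) (velocity \<gamma> r) = l *\<^sub>R outer w"
  proof (intro exI conjI)
    show "2 * D' / (W r)\<^sup>2 * e r > 0" using D0 W0[of r] e0[of r] by simp
    show "ray (geodesic \<gamma> r) (velocity \<gamma> r) = (2 * D' / (W r)\<^sup>2 * e r) *\<^sub>R outer w"
      unfolding ray1 by (simp add: outer_def vw R_def P_def S_def)
  qed
  have ray2: "ray (geodesic \<gamma> r) (- velocity \<gamma> r) = (2 * D' / (W r)\<^sup>2) *\<^sub>R (U r, Q r, T r)"
  proof -
    have t: "fst (geodesic \<gamma> r) - fst (- velocity \<gamma> r) = 2 * D' / (W r)\<^sup>2 * T r"
      using ar(2)[of D' r] unfolding vel V_def gr fst_uminus fst_conv by simp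
    have c1: "2 * D' / (W r)\<^sup>2 * T r * ((R r + U r) / W r) - fst (geodesic \<gamma> r) * ((R r - U r) / W r - (S r - T r) * (R r + U r) / (W r)\<^sup>2)
       = 2 * D' / (W r)\<^sup>2 * U r"
      unfolding gr fst_conv by (rule ar)
    have c2: "(2 * D' / (W r)\<^sup>2 * T r) *\<^sub>R ((1 / W r) *\<^sub>R (P r + Q r))
       - (D' / W r) *\<^sub>R ((1 / W r) *\<^sub>R (P r - Q r) - ((S r - T r) / (W r)\<^sup>2) *\<^sub>R (P r + Q r)) = (2 * D' / (W r)\<^sup>2) *\<^sub>R Q r"
    proof -
      have x: "2 * D' / (W r)\<^sup>2 * T r * (1 / W r) - D' / W r * (1 / W r - (S r - T r) / (W r)\<^sup>2) = 0"
        by (rule ar)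
      have y: "2 * D' / (W r)\<^sup>2 * T r * (1 / W r) - D' / W r * (- (1 / W r) - (S r - T r) / (W r)\<^sup>2) = 2 * D' / (W r)\<^sup>2"
        by (rule ar)
      have "?thesis \<longleftrightarrow> (2 * D' / (W r)\<^sup>2 * T r * (1 / W r) - D' / W r * (1 / W r - (S r - T r) / (W r)\<^sup>2)) *\<^sub>R P r
         + (2 * D' / (W r)\<^sup>2 * T r * (1 / W r) - D' / W r * (- (1 / W r) - (S r - T r) / (W r)\<^sup>2)) *\<^sub>R Q r = (2 * D' / (W r)\<^sup>2) *\<^sub>R Q r"
        by (simp add: algebra_simps)
      then show ?thesis unfolding x y by simp
    qed
    show ?thesis
    proof -
      have "2 * D' / (W r)\<^sup>2 * T r * ((R r + U r) / W r) + 2 * fst (geodesic \<gamma> r) * (geodesic \<gamma> r \<bullet> - velocity \<gamma> r)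
          = 2 * D' / (W r)\<^sup>2 * U r"
        unfolding c1[unfolded pv[of r, symmetric], symmetric] by simp
      moreover have "(2 * D' / (W r)\<^sup>2 * T r) *\<^sub>R snd (geodesic \<gamma> r) + fst (geodesic \<gamma> r) *\<^sub>R snd (- velocity \<gamma> r)
          = (2 * D' / (W r)\<^sup>2) *\<^sub>R Q r"
        unfolding c2[symmetric] snd_uminus scaleR_minus_right by (simp only: gr vel V_def snd_conv fst_conv) simp
      ultimately show ?thesis
        unfolding ray_def t pp scaleR_Pair real_scaleR_def by (simp only:)
    qed
  qed
  show "\<exists>l>0. ray (geodesic \<gamma> r) (- velocity \<gamma> r) = l *\<^sub>R outer v"
  proof (intro exI conjI)
    show "2 * D' / (W r)\<^sup>2 / e r > 0" using D0 W0[of r] e0[of r] by simp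
    show "ray (geodesic \<gamma> r) (- velocity \<gamma> r) = (2 * D' / (W r)\<^sup>2 / e r) *\<^sub>R outer v"
      unfolding ray2 by (simp add: outer_def vw U_def Q_def T_def)
  qed
  show "velocity \<gamma> r \<bullet> velocity \<gamma> r = (fst (geodesic \<gamma> r))\<^sup>2"
  proof -
    have eq: "(1 / W r) *\<^sub>R (P r - Q r) - ((S r - T r) / (W r)\<^sup>2) *\<^sub>R (P r + Q r) = (2 / (W r)\<^sup>2) *\<^sub>R (T r *\<^sub>R P r - S r *\<^sub>R Q r)"
    proof -
      have x: "1 / W r - (S r - T r) / (W r)\<^sup>2 = 2 / (W r)\<^sup>2 * T r"
        by (rule ar)
      have y: "- (1 / W r) - (S r - T r) / (W r)\<^sup>2 = - (2 / (W r)\<^sup>2 * S r)"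
        by (rule ar)
      have "(1 / W r) *\<^sub>R (P r - Q r) - ((S r - T r) / (W r)\<^sup>2) *\<^sub>R (P r + Q r)
        = (1 / W r - (S r - T r) / (W r)\<^sup>2) *\<^sub>R P r + (- (1 / W r) - (S r - T r) / (W r)\<^sup>2) *\<^sub>R Q r"
        by (simp add: algebra_simps)
      then show ?thesis unfolding x y by (simp add: algebra_simps)
    qed
    have "T r *\<^sub>R P r - S r *\<^sub>R Q r = - (cnj v2 * cnj w2 * det2 v w)"
    proof -
      have "T r *\<^sub>R P r = of_real ((cmod v2)\<^sup>2) * (w1 * cnj w2)" "S r *\<^sub>R Q r = of_real ((cmod w2)\<^sup>2) * (v1 * cnj v2)"
        using e0[of r] by (simp_all add: T_def P_def S_def Q_def scaleR_conv_of_real)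
      then show ?thesis unfolding complex_norm_square by (simp add: det2_def vw algebra_simps)
    qed
    then have n: "cmod (T r *\<^sub>R P r - S r *\<^sub>R Q r) = cmod v2 * cmod w2 * D'" by (simp add: norm_mult D'_def)
    have ST: "(cmod v2 * cmod w2)\<^sup>2 = S r * T r" using e0[of r] by (simp add: S_def T_def power_mult_distrib)
    have "velocity \<gamma> r \<bullet> velocity \<gamma> r = (- D' * (S r - T r) / (W r)\<^sup>2)\<^sup>2 + (cmod ((2 / (W r)\<^sup>2) *\<^sub>R (T r *\<^sub>R P r - S r *\<^sub>R Q r)))\<^sup>2"
      unfolding vel V_def eq by (simp only: inner_Pair dot_square_norm[of "_ :: complex"] inner_real_def) (simp only: power2_eq_square)
    also have "\<dots> = (D' * (S r - T r) / (W r)\<^sup>2)\<^sup>2 + 4 * (S r * T r) * D'\<^sup>2 / ((W r)\<^sup>2)\<^sup>2"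
      unfolding norm_scaleR n ST[symmetric] by (simp add: power_mult_distrib power_divide)
    also have "\<dots> = D'\<^sup>2 * ((S r - T r)\<^sup>2 + 4 * (S r * T r)) / ((W r)\<^sup>2)\<^sup>2"
      by (simp only: power_mult_distrib power_divide add_divide_distrib distrib_left mult.commute mult.left_commute mult.assoc)
    also have "(S r - T r)\<^sup>2 + 4 * (S r * T r) = (W r)\<^sup>2" by (simp add: W_def power2_eq_square algebra_simps)
    also have "D'\<^sup>2 * (W r)\<^sup>2 / ((W r)\<^sup>2)\<^sup>2 = (fst (geodesic \<gamma> r))\<^sup>2" using W0[of r] by (simp add: gr power2_eq_square)
    finally show ?thesis .
  qed
qed

section \<open>Lifts of boundary points\<close>

lemma ex_is_start: "v \<noteq> 0 \<Longrightarrow> \<exists>s. is_start v s"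
proof (cases "snd v = 0")
  case True
  assume "v \<noteq> 0"
  then show ?thesis using True by (intro exI[of _ None]) (auto simp: is_start_def prod_eq_iff)
next
  case False
  then show ?thesis by (intro exI[of _ "Some (- fst v / snd v)"]) (auto simp: is_start_def)
qed

lemma ex_is_end: "w \<noteq> 0 \<Longrightarrow> \<exists>s. is_end w s"
proof (cases "fst w = 0")
  case True
  assume "w \<noteq> 0"
  then show ?thesis using True by (intro exI[of _ None]) (auto simp: is_end_def prod_eq_iff)
next
  case False
  then show ?thesis by (intro exI[of _ "Some (cnj (snd w / fst w))"]) (auto simp: is_end_def)
qed

text \<open>The lifts depend on the chart coordinate holomorphically at the start and antiholomorphically at the
  end. As the form is conjugate linear in its second argument, incidence becomes a holomorphic equation
  in the two coordinates, in each of the four charts.\<close>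

definition start_lift :: "bool \<Rightarrow> complex \<Rightarrow> complex \<times> complex" where
  "start_lift i \<zeta> = (if i then (-1, \<zeta>) else (- \<zeta>, 1))"

definition end_lift :: "bool \<Rightarrow> complex \<Rightarrow> complex \<times> complex" where
  "end_lift j \<zeta> = (if j then (cnj \<zeta>, 1) else (1, cnj \<zeta>))"

lemma is_start_start_lift_iff: "is_start (start_lift i \<zeta>) s \<longleftrightarrow> s \<in> coord_domain i \<and> coord i s = \<zeta>"
  by (cases i; cases s) (auto simp: is_start_def start_lift_def divide_eq_eq mult.commute)

lemma is_end_end_lift_iff: "is_end (end_lift j \<zeta>) s \<longleftrightarrow> s \<in> coord_domain j \<and> coord j s = \<zeta>"
proof (cases s)
  case None
  then show ?thesis by (cases j) (auto simp: is_end_def end_lift_def)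
next
  case (Some \<mu>)
  have 1: "cnj \<mu> = cnj \<zeta> \<longleftrightarrow> \<mu> = \<zeta>" by simp
  have "1 = cnj \<mu> * cnj \<zeta> \<longleftrightarrow> \<mu> * \<zeta> = 1"
    by (metis complex_cnj_mult complex_cnj_one complex_cnj_cancel_iff)
  with Some 1 show ?thesis by (cases j) (auto simp: is_end_def end_lift_def divide_eq_eq mult.commute)
qed

lemma obtain_lifts:
  obtains v w where "is_start v (fst \<gamma>)" "is_end w (snd \<gamma>)"
proof -
  have "\<exists>i. s \<in> coord_domain i" for s by (cases s) (auto intro: exI[of _ False] exI[of _ True])
  then show ?thesis by (meson is_start_start_lift_iff is_end_end_lift_iff that)
qed

lemma is_start_scale:
  assumes "is_start v s" "is_start v' s"
  shows "\<exists>l. l \<noteq> 0 \<and> v' = (l * fst v, l * snd v)"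
  using assms
  by (cases s; cases v; cases v')
    (auto simp: is_start_def intro: exI[of _ "fst v' / fst v"] exI[of _ "snd v' / snd v"])

lemma is_end_scale:
  assumes "is_end v s" "is_end v' s"
  shows "\<exists>l. l \<noteq> 0 \<and> v' = (l * fst v, l * snd v)"
  using assms
  by (cases s; cases v; cases v')
    (auto simp: is_end_def intro: exI[of _ "fst v' / fst v"] exI[of _ "snd v' / snd v"])

lemma hform_scale: "hform A (l * v1, l * v2) (m * w1, m * w2) = l * cnj m * hform A (v1, v2) (w1, w2)"
  by (cases A) (simp add: hform_def algebra_simps)

lemma hquad_scale: "hquad A (l * v1, l * v2) = (cmod l)\<^sup>2 * hquad A (v1, v2)"
proof -
  have "complex_of_real (hquad A (l * v1, l * v2)) = of_real ((cmod l)\<^sup>2 * hquad A (v1, v2))"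
    unfolding of_real_hquad hform_scale of_real_mult complex_norm_square by simp
  then show ?thesis by (simp only: of_real_eq_iff)
qed

text \<open>A vector is determined by its rank one matrix up to a phase, so the matrix determines the boundary point.\<close>

lemma is_start_outer:
  assumes "is_start v s" "is_start v' s'" "l > 0" "outer v = l *\<^sub>R outer v'"
  shows "s = s'"
proof -
  have 1: "(cmod (snd v))\<^sup>2 = l * (cmod (snd v'))\<^sup>2" "fst v * cnj (snd v) = l *\<^sub>R (fst v' * cnj (snd v'))"
    using assms(4) by (auto simp: outer_def)
  have n: "complex_of_real ((cmod (snd v))\<^sup>2) = snd v * cnj (snd v)" "complex_of_real ((cmod (snd v'))\<^sup>2) = snd v' * cnj (snd v')"
    by (rule complex_norm_square)+
  show ?thesis
  proof (cases s; cases s')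
    fix \<mu> \<mu>' assume s: "s = Some \<mu>" "s' = Some \<mu>'"
    have nz: "(cmod (snd v))\<^sup>2 \<noteq> 0" using assms by (simp add: s is_start_def)
    have "\<mu> * of_real ((cmod (snd v))\<^sup>2) = - (fst v * cnj (snd v))"
      unfolding n using assms by (simp add: s is_start_def)
    also have "\<dots> = \<mu>' * of_real (l * (cmod (snd v'))\<^sup>2)"
      unfolding 1 of_real_mult n using assms by (simp add: s is_start_def scaleR_conv_of_real)
    also have "\<dots> = \<mu>' * of_real ((cmod (snd v))\<^sup>2)" unfolding 1 ..
    finally show ?thesis using nz s by simp
  qed (use assms 1 in \<open>auto simp: is_start_def\<close>)
qed

lemma is_end_outer:
  assumes "is_end w s" "is_end w' s'" "l > 0" "outer w = l *\<^sub>R outer w'"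
  shows "s = s'"
proof -
  have 1: "(cmod (fst w))\<^sup>2 = l * (cmod (fst w'))\<^sup>2" "fst w * cnj (snd w) = l *\<^sub>R (fst w' * cnj (snd w'))"
    using assms(4) by (auto simp: outer_def)
  have n: "complex_of_real ((cmod (fst w))\<^sup>2) = fst w * cnj (fst w)" "complex_of_real ((cmod (fst w'))\<^sup>2) = fst w' * cnj (fst w')"
    by (rule complex_norm_square)+
  show ?thesis
  proof (cases s; cases s')
    fix \<mu> \<mu>' assume s: "s = Some \<mu>" "s' = Some \<mu>'"
    have nz: "(cmod (fst w))\<^sup>2 \<noteq> 0" using assms by (simp add: s is_end_def)
    have "\<mu> * of_real ((cmod (fst w))\<^sup>2) = fst w * cnj (snd w)"
      unfolding n using assms by (simp add: s is_end_def)
    also have "\<dots> = \<mu>' * of_real (l * (cmod (fst w'))\<^sup>2)"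
      unfolding 1 of_real_mult n using assms by (simp add: s is_end_def scaleR_conv_of_real)
    also have "\<dots> = \<mu>' * of_real ((cmod (fst w))\<^sup>2)" unfolding 1 ..
    finally show ?thesis using nz s by simp
  qed (use assms 1 in \<open>auto simp: is_end_def\<close>)
qed

section \<open>Incidence of a geodesic with a Hermitian form\<close>

text \<open>The two end points are orthogonal with respect to \<open>A\<close>.\<close>

definition incident :: "herm \<Rightarrow> sphere \<times> sphere \<Rightarrow> bool" where
  "incident A \<gamma> \<longleftrightarrow> (\<forall>v w. is_start v (fst \<gamma>) \<longrightarrow> is_end w (snd \<gamma>) \<longrightarrow> hform A v w = 0)"

lemma incident_iff_hform:
  assumes "is_start v (fst \<gamma>)" "is_end w (snd \<gamma>)"
  shows "incident A \<gamma> \<longleftrightarrow> hform A v w = 0"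
proof
  assume 0: "hform A v w = 0"
  show "incident A \<gamma>" unfolding incident_def
  proof (intro allI impI)
    fix v' w' assume "is_start v' (fst \<gamma>)" "is_end w' (snd \<gamma>)"
    then obtain l m where "v' = (l * fst v, l * snd v)" "w' = (m * fst w, m * snd w)"
      using is_start_scale[OF assms(1)] is_end_scale[OF assms(2)] by blast
    then show "hform A v' w' = 0" using 0 by (simp add: hform_scale)
  qed
qed (use assms in \<open>unfold incident_def, blast\<close>)

lemma geodesic_velocity_rays:
  assumes "\<gamma> \<in> LH3"
  shows geodesic_in_H3: "geodesic \<gamma> r \<in> H3"
    and geodesic_has_velocity: "(geodesic \<gamma> has_vector_derivative velocity \<gamma> r) (at r)"
    and velocity_unit: "velocity \<gamma> r \<bullet> velocity \<gamma> r = (fst (geodesic \<gamma> r))\<^sup>2"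
    and ray_velocity: "is_end w (snd \<gamma>) \<Longrightarrow> \<exists>l>0. ray (geodesic \<gamma> r) (velocity \<gamma> r) = l *\<^sub>R outer w"
    and ray_minus_velocity: "is_start v (fst \<gamma>) \<Longrightarrow> \<exists>l>0. ray (geodesic \<gamma> r) (- velocity \<gamma> r) = l *\<^sub>R outer v"
proof -
  obtain v0 w0 where vw: "is_start v0 (fst \<gamma>)" "is_end w0 (snd \<gamma>)" by (rule obtain_lifts)
  have *: "geodesic \<gamma> r \<in> H3 \<and> (geodesic \<gamma> has_vector_derivative velocity \<gamma> r) (at r) \<and>
     velocity \<gamma> r \<bullet> velocity \<gamma> r = (fst (geodesic \<gamma> r))\<^sup>2 \<and>
     (\<exists>l>0. ray (geodesic \<gamma> r) (velocity \<gamma> r) = l *\<^sub>R outer w) \<and>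
     (\<exists>l>0. ray (geodesic \<gamma> r) (- velocity \<gamma> r) = l *\<^sub>R outer v)"
    if vw: "is_start v (fst \<gamma>)" "is_end w (snd \<gamma>)" for v w
  proof -
    have D: "det2 v w \<noteq> 0" using LH3_iff_det2[OF vw] assms by simp
    obtain \<kappa> where k: "\<kappa> > 0" "\<And>r. geodesic \<gamma> r = geo_point v w (\<kappa> * exp r)"
      using geodesic_eq_geo_point[OF assms vw] by blast
    show ?thesis using geodesic_vector_derivative[OF k(2) D k(1)] geo_point_in_H3[OF D, of "\<kappa> * exp r"] k by simp
  qed
  show "geodesic \<gamma> r \<in> H3" "(geodesic \<gamma> has_vector_derivative velocity \<gamma> r) (at r)"
    "velocity \<gamma> r \<bullet> velocity \<gamma> r = (fst (geodesic \<gamma> r))\<^sup>2"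
    "is_end w (snd \<gamma>) \<Longrightarrow> \<exists>l>0. ray (geodesic \<gamma> r) (velocity \<gamma> r) = l *\<^sub>R outer w"
    "is_start v (fst \<gamma>) \<Longrightarrow> \<exists>l>0. ray (geodesic \<gamma> r) (- velocity \<gamma> r) = l *\<^sub>R outer v"
    using *[OF vw] *[of v0 w] *[of v w0] vw by blast+
qed

text \<open>Both end points are read off from the rays of the velocity and of its negative.\<close>

lemma geodesic_unique:
  assumes "\<gamma> \<in> LH3" "\<gamma>' \<in> LH3" "geodesic \<gamma> r = geodesic \<gamma>' r'" "velocity \<gamma> r = velocity \<gamma>' r'"
  shows "\<gamma> = \<gamma>'"
proof -
  obtain v w where vw: "is_start v (fst \<gamma>)" "is_end w (snd \<gamma>)" by (rule obtain_lifts)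
  obtain v' w' where vw': "is_start v' (fst \<gamma>')" "is_end w' (snd \<gamma>')" by (rule obtain_lifts)
  obtain l l' where l: "l > 0" "l' > 0" "l *\<^sub>R outer w = l' *\<^sub>R outer w'"
    using ray_velocity[OF assms(1) vw(2), of r] ray_velocity[OF assms(2) vw'(2), of r'] assms by metis
  obtain m m' where m: "m > 0" "m' > 0" "m *\<^sub>R outer v = m' *\<^sub>R outer v'"
    using ray_minus_velocity[OF assms(1) vw(1), of r] ray_minus_velocity[OF assms(2) vw'(1), of r'] assms by metis
  have *: "x = (b / a) *\<^sub>R y" if "a *\<^sub>R x = b *\<^sub>R y" "a > 0" for a b and x y :: "real \<times> complex \<times> real"
  proof -
    have "x = (1 / a) *\<^sub>R (a *\<^sub>R x)" using that(2) by simp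
    also have "\<dots> = (b / a) *\<^sub>R y" unfolding that(1) by simp
    finally show ?thesis .
  qed
  have "fst \<gamma> = fst \<gamma>'" using is_start_outer[OF vw(1) vw'(1) _ *[OF m(3,1)]] m by simp
  moreover have "snd \<gamma> = snd \<gamma>'" using is_end_outer[OF vw(2) vw'(2) _ *[OF l(3,1)]] l by simp
  ultimately show ?thesis by (simp add: prod_eq_iff)
qed

text \<open>The formula for the derivative follows from that for \<^term>\<open>Phi\<close> by differentiating in the arc length.\<close>

lemma Phi_along_geodesic:
  assumes "\<gamma> \<in> LH3" and vw: "is_start v (fst \<gamma>)" "is_end w (snd \<gamma>)"
  shows "\<exists>\<kappa>>0. \<forall>r. geodesic \<gamma> r = geo_point v w (\<kappa> * exp r) \<and>
    (\<forall>A. Phi A (geodesic \<gamma> r) = (\<kappa> * exp r * hquad A w + hquad A v / (\<kappa> * exp r)) / cmod (det2 v w) \<and>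
      hgrad A (geodesic \<gamma> r) \<bullet> velocity \<gamma> r = (\<kappa> * exp r * hquad A w - hquad A v / (\<kappa> * exp r)) / cmod (det2 v w))"
proof -
  have D: "det2 v w \<noteq> 0" using LH3_iff_det2[OF vw] assms by simp
  obtain \<kappa> where k: "\<kappa> > 0" "\<And>r. geodesic \<gamma> r = geo_point v w (\<kappa> * exp r)"
    using geodesic_eq_geo_point[OF assms] by blast
  have 1: "Phi A (geodesic \<gamma> r) = (\<kappa> * exp r * hquad A w + hquad A v / (\<kappa> * exp r)) / cmod (det2 v w)" for A r
    unfolding k(2) by (rule Phi_geo_point[OF D]) (simp add: k)
  have 2: "hgrad A (geodesic \<gamma> r) \<bullet> velocity \<gamma> r = (\<kappa> * exp r * hquad A w - hquad A v / (\<kappa> * exp r)) / cmod (det2 v w)" for A r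
  proof -
    have "((\<lambda>r. Phi A (geodesic \<gamma> r)) has_derivative (\<lambda>x. hgrad A (geodesic \<gamma> r) \<bullet> (x *\<^sub>R velocity \<gamma> r))) (at r)"
      using has_derivative_compose[OF geodesic_has_velocity[OF assms(1), unfolded has_vector_derivative_def] Phi_has_derivative[OF geodesic_in_H3[OF assms(1)]]] .
    then have "((\<lambda>r. Phi A (geodesic \<gamma> r)) has_real_derivative (hgrad A (geodesic \<gamma> r) \<bullet> velocity \<gamma> r)) (at r)"
      unfolding has_field_derivative_def by (simp add: mult_commute_abs)
    moreover have "((\<lambda>r. (\<kappa> * exp r * hquad A w + hquad A v * (inverse \<kappa> * exp (- r))) / cmod (det2 v w))
       has_real_derivative (\<kappa> * exp r * hquad A w + hquad A v * (inverse \<kappa> * (- exp (- r)))) / cmod (det2 v w)) (at r)"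
      using D by (auto intro!: derivative_eq_intros)
    moreover have "(\<lambda>r. Phi A (geodesic \<gamma> r)) = (\<lambda>r. (\<kappa> * exp r * hquad A w + hquad A v * (inverse \<kappa> * exp (- r))) / cmod (det2 v w))"
      unfolding 1 by (rule ext) (simp add: exp_minus divide_inverse)
    ultimately have "hgrad A (geodesic \<gamma> r) \<bullet> velocity \<gamma> r = (\<kappa> * exp r * hquad A w + hquad A v * (inverse \<kappa> * (- exp (- r)))) / cmod (det2 v w)"
      using DERIV_unique by metis
    then show ?thesis by (simp add: exp_minus divide_inverse)
  qed
  show ?thesis using k 1 2 by blast
qed

text \<open>Incidence means that the geodesic runs along the gradient of \<open>Phi A\<close>: the defect in the
  Cauchy-Schwarz inequality is \<open>4 |hform A v w|\<^sup>2 / |det2 v w|\<^sup>2\<close>. Hence incident geodesics are the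
  common normals of all level surfaces of \<open>Phi A\<close>.\<close>

lemma incident_iff_hgrad:
  assumes "\<gamma> \<in> LH3"
  shows "incident A \<gamma> \<longleftrightarrow> (hgrad A (geodesic \<gamma> r) \<bullet> velocity \<gamma> r)\<^sup>2
     = (hgrad A (geodesic \<gamma> r) \<bullet> hgrad A (geodesic \<gamma> r)) * (velocity \<gamma> r \<bullet> velocity \<gamma> r)"
proof -
  obtain v w where vw: "is_start v (fst \<gamma>)" "is_end w (snd \<gamma>)" by (rule obtain_lifts)
  have D: "cmod (det2 v w) > 0" using LH3_iff_det2[OF vw] assms by simp
  obtain \<kappa> where k: "\<kappa> > 0" and P: "Phi A (geodesic \<gamma> r) = (\<kappa> * exp r * hquad A w + hquad A v / (\<kappa> * exp r)) / cmod (det2 v w)"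
    and G: "hgrad A (geodesic \<gamma> r) \<bullet> velocity \<gamma> r = (\<kappa> * exp r * hquad A w - hquad A v / (\<kappa> * exp r)) / cmod (det2 v w)"
    using Phi_along_geodesic[OF assms vw] by blast
  define e where "e = \<kappa> * exp r"
  have e: "e > 0" using k by (simp add: e_def)
  have "(e * x + y / e)\<^sup>2 - (e * x - y / e)\<^sup>2 = 4 * (y * x)" for x y
    using e by (simp add: power2_eq_square algebra_simps)
  then have "(Phi A (geodesic \<gamma> r))\<^sup>2 - (hgrad A (geodesic \<gamma> r) \<bullet> velocity \<gamma> r)\<^sup>2 = 4 * (hquad A v * hquad A w) / (cmod (det2 v w))\<^sup>2"
    unfolding P G e_def[symmetric] power_divide diff_divide_distrib[symmetric] by simp
  also have "\<dots> = 4 * hdet A + 4 * (cmod (hform A v w))\<^sup>2 / (cmod (det2 v w))\<^sup>2"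
    using hform_gram[of A v w] D by (simp add: field_simps)
  finally have "(hgrad A (geodesic \<gamma> r) \<bullet> hgrad A (geodesic \<gamma> r)) * (velocity \<gamma> r \<bullet> velocity \<gamma> r) - (hgrad A (geodesic \<gamma> r) \<bullet> velocity \<gamma> r)\<^sup>2
    = 4 * (cmod (hform A v w))\<^sup>2 / (cmod (det2 v w))\<^sup>2"
    using norm_hgrad[OF geodesic_in_H3[OF assms, of r], of A] unfolding velocity_unit[OF assms] by (simp add: mult.commute)
  then have "(hgrad A (geodesic \<gamma> r) \<bullet> velocity \<gamma> r)\<^sup>2 = (hgrad A (geodesic \<gamma> r) \<bullet> hgrad A (geodesic \<gamma> r)) * (velocity \<gamma> r \<bullet> velocity \<gamma> r) \<longleftrightarrow>
     4 * (cmod (hform A v w))\<^sup>2 / (cmod (det2 v w))\<^sup>2 = 0" by linarith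
  also have "\<dots> \<longleftrightarrow> incident A \<gamma>" using D by (simp add: incident_iff_hform[OF vw])
  finally show ?thesis by simp
qed

section \<open>Geodesics with prescribed velocity\<close>

text \<open>The determinant of the matrix vanishes because \<open>v\<close> is a unit vector, and its diagonal is nonnegative.\<close>

lemma ray_rank_one:
  assumes p: "p \<in> H3" and v: "v \<bullet> v = (fst p)\<^sup>2"
  shows "\<exists>w l. w \<noteq> 0 \<and> l > 0 \<and> ray p v = l *\<^sub>R outer w"
proof -
  obtain t z where pt: "p = (t, z)" by (cases p)
  obtain t' z' where vt: "v = (t', z')" by (cases v)
  have t: "t > 0" using p by (simp add: pt H3_def)
  have vv: "t' * t' + z' \<bullet> z' = t * t" using v by (simp add: vt pt power2_eq_square)
  define B where "B = (t - t') *\<^sub>R z + t *\<^sub>R z'"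
  define R where "R = (t - t') * (t * t + z \<bullet> z) + 2 * t * (t * t' + z \<bullet> z')"
  have ray: "ray p v = (R, B, t - t')" by (simp add: ray_def pt vt B_def R_def)
  have det: "B \<bullet> B = R * (t - t')"
  proof -
    have "B \<bullet> B = (t - t') * (t - t') * (z \<bullet> z) + 2 * t * (t - t') * (z \<bullet> z') + t * t * (z' \<bullet> z')"
      by (simp add: B_def inner_add_left inner_add_right inner_commute[of z' z] algebra_simps)
    also have "z' \<bullet> z' = t * t - t' * t'" using vv by simp
    finally show ?thesis by (simp add: R_def algebra_simps)
  qed
  have "t' * t' \<le> t * t" using vv inner_ge_zero[of z'] by linarith
  then have le: "t' \<le> t" "- t \<le> t'" using t by (metis abs_le_square_iff abs_of_pos abs_le_iff power2_eq_square minus_le_iff)+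
  show ?thesis
  proof (cases "t' = t")
    case True
    then have z': "z' = 0" using vv by simp
    have "R > 0" using t by (simp add: R_def True z')
    moreover have "ray p v = R *\<^sub>R outer (1, 0)" unfolding ray by (simp add: outer_def B_def True z')
    ultimately show ?thesis by (intro exI[of _ "(1,0)"] exI[of _ R]) (auto simp: zero_prod_def)
  next
    case False
    then have pos: "t - t' > 0" using le by simp
    have "(cmod B)\<^sup>2 = R * (t - t')" using det by (simp add: power2_norm_eq_inner)
    moreover have "(R, B, s) = (1 / s) *\<^sub>R outer (B, of_real s)" if "s > 0" "(cmod B)\<^sup>2 = R * s" for s
      using that by (simp add: outer_def scaleR_conv_of_real) (simp add: power2_eq_square)
    ultimately have "ray p v = (1 / (t - t')) *\<^sub>R outer (B, of_real (t - t'))"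
      unfolding ray using pos by blast
    then show ?thesis using pos by (intro exI[of _ "(B, of_real (t - t'))"] exI[of _ "1 / (t - t')"]) (auto simp: zero_prod_def)
  qed
qed

text \<open>If the rank one matrices of two lines were proportional, so would be the lines.\<close>

lemma outer_independent:
  assumes "det2 v w \<noteq> 0" "l *\<^sub>R outer w + m *\<^sub>R outer v = l' *\<^sub>R outer w + m' *\<^sub>R outer v"
  shows "l = l'"
proof (rule ccontr)
  assume ne: "l \<noteq> l'"
  define c where "c = (m' - m) / (l - l')"
  have "(l - l') *\<^sub>R outer w = (m' - m) *\<^sub>R outer v" using assms(2) by (simp add: algebra_simps)
  then have "(1 / (l - l')) *\<^sub>R ((l - l') *\<^sub>R outer w) = (1 / (l - l')) *\<^sub>R ((m' - m) *\<^sub>R outer v)" by simp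
  then have o: "outer w = c *\<^sub>R outer v" using ne by (simp add: c_def)
  have 1: "(cmod (fst w))\<^sup>2 = c * (cmod (fst v))\<^sup>2" "fst w * cnj (snd w) = of_real c * (fst v * cnj (snd v))"
    "(cmod (snd w))\<^sup>2 = c * (cmod (snd v))\<^sup>2"
    using o by (auto simp: outer_def scaleR_conv_of_real)
  have 2: "fst w * cnj (fst w) = of_real c * (fst v * cnj (fst v))" "snd w * cnj (snd w) = of_real c * (snd v * cnj (snd v))"
    using 1(1,3)[THEN arg_cong[where f = complex_of_real]] unfolding of_real_mult complex_norm_square by auto
  have 3: "snd w * cnj (fst w) = of_real c * (snd v * cnj (fst v))"
    using 1(2)[THEN arg_cong[where f = cnj]] by (simp add: mult.commute)
  have "det2 v w * cnj (det2 v w) = fst v * cnj (fst v) * (snd w * cnj (snd w)) + snd v * cnj (snd v) * (fst w * cnj (fst w))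
     - fst v * cnj (snd v) * (snd w * cnj (fst w)) - snd v * cnj (fst v) * (fst w * cnj (snd w))"
    by (simp add: det2_def algebra_simps)
  also have "\<dots> = 0" unfolding 2 3 1(2) by (simp add: algebra_simps)
  finally show False using assms(1) by simp
qed

lemma ray_add_ray_minus: "ray p u + ray p (- u) = (2 * fst p * (p \<bullet> p), (2 * fst p) *\<^sub>R snd p, 2 * fst p)"
proof -
  have "(x - y) * c + 2 * x * d + ((x + y) * c - 2 * x * d) = 2 * x * c" for x y c d :: real
    by (simp add: ring_distribs)
  moreover have "(x - y) *\<^sub>R a + x *\<^sub>R b + ((x + y) *\<^sub>R a - x *\<^sub>R b) = (2 * x) *\<^sub>R a" for x y and a b :: complex
  proof -
    have "(2 * x) *\<^sub>R a = (x - y) *\<^sub>R a + (x + y) *\<^sub>R a" by (simp only: scaleR_left_distrib[symmetric]) simp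
    then show ?thesis by (simp only:) simp
  qed
  ultimately show ?thesis by (simp add: ray_def)
qed

text \<open>The candidates for the end points are the rays of \<open>u\<close> and \<open>- u\<close>. The sum of the two rays is a multiple
  of the matrix of \<open>p\<close>, which puts \<open>p\<close> on the geodesic between them; comparing rays gives the velocity.\<close>

lemma geodesic_exists:
  assumes p: "p \<in> H3" and u: "u \<bullet> u = (fst p)\<^sup>2"
  shows "\<exists>\<gamma>\<in>LH3. \<exists>r. geodesic \<gamma> r = p \<and> velocity \<gamma> r = u"
proof -
  obtain w l where w: "w \<noteq> 0" "l > 0" "ray p u = l *\<^sub>R outer w" using ray_rank_one[OF assms] by blast
  obtain v m where v: "v \<noteq> 0" "m > 0" "ray p (- u) = m *\<^sub>R outer v" using ray_rank_one[OF p, of "- u"] u by auto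
  obtain t z where pt: "p = (t, z)" by (cases p)
  have t: "t > 0" using p by (simp add: pt H3_def)
  have sum: "l *\<^sub>R outer w + m *\<^sub>R outer v = (2 * t * (p \<bullet> p), (2 * t) *\<^sub>R z, 2 * t)"
    unfolding w(3)[symmetric] v(3)[symmetric] ray_add_ray_minus by (simp add: pt)
  then have s1: "l * (cmod (fst w))\<^sup>2 + m * (cmod (fst v))\<^sup>2 = 2 * t * (p \<bullet> p)"
    and s2: "of_real l * (fst w * cnj (snd w)) + of_real m * (fst v * cnj (snd v)) = of_real (2 * t) * z"
    and s3: "l * (cmod (snd w))\<^sup>2 + m * (cmod (snd v))\<^sup>2 = 2 * t"
    by (auto simp: outer_def scaleR_conv_of_real)
  have lm: "l * m * (cmod (det2 v w))\<^sup>2 = (2 * t * t)\<^sup>2"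
  proof -
    define N where "N = of_real l * (fst w * cnj (snd w)) + of_real m * (fst v * cnj (snd v))"
    have "complex_of_real ((l * (cmod (fst w))\<^sup>2 + m * (cmod (fst v))\<^sup>2) * (l * (cmod (snd w))\<^sup>2 + m * (cmod (snd v))\<^sup>2)) - N * cnj N
      = of_real (l * m) * (det2 v w * cnj (det2 v w))"
      unfolding of_real_mult of_real_add complex_norm_square N_def by (simp add: det2_def algebra_simps)
    then have "complex_of_real ((l * (cmod (fst w))\<^sup>2 + m * (cmod (fst v))\<^sup>2) * (l * (cmod (snd w))\<^sup>2 + m * (cmod (snd v))\<^sup>2) - (cmod N)\<^sup>2) = of_real (l * m * (cmod (det2 v w))\<^sup>2)"
      by (simp only: of_real_diff of_real_mult complex_norm_square)
    then have "l * m * (cmod (det2 v w))\<^sup>2 = (2 * t * (p \<bullet> p)) * (2 * t) - (cmod N)\<^sup>2"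
      unfolding s1 s3 of_real_eq_iff by simp
    also have "cmod N = 2 * t * cmod z" unfolding N_def s2 using t by (simp add: norm_mult)
    also have "(2 * t * (p \<bullet> p)) * (2 * t) - (2 * t * cmod z)\<^sup>2 = (2 * t * t)\<^sup>2"
      unfolding pt inner_Pair dot_square_norm[of z] by (simp add: power2_eq_square algebra_simps)
    finally show ?thesis .
  qed
  then have D: "det2 v w \<noteq> 0" using t by auto
  obtain s1' s2' where st: "is_start v s1'" "is_end w s2'" using ex_is_start[OF v(1)] ex_is_end[OF w(1)] by blast
  define \<gamma> where "\<gamma> = (s1', s2')"
  have vw: "is_start v (fst \<gamma>)" "is_end w (snd \<gamma>)" using st by (simp_all add: \<gamma>_def)
  have L: "\<gamma> \<in> LH3" using LH3_iff_det2[OF vw] D by simp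
  obtain \<kappa> where k: "\<kappa> > 0" "\<And>r. geodesic \<gamma> r = geo_point v w (\<kappa> * exp r)"
    using geodesic_eq_geo_point[OF L vw] by blast
  \<comment> \<open>with \<open>e = l / q\<close> the matrix \<open>e w w* + v v* / e\<close> is \<open>(l w w* + m v v*) / q\<close>\<close>
  define q where "q = sqrt (l * m)"
  have q: "q > 0" "q * q = l * m" using w v by (simp_all add: q_def)
  define r where "r = ln (l / q / \<kappa>)"
  have e: "\<kappa> * exp r = l / q" using k q w by (simp add: r_def)
  have e2: "1 / (l / q) = m / q" using q w by (simp add: field_simps)
  have W: "l / q * (cmod (snd w))\<^sup>2 + (cmod (snd v))\<^sup>2 / (l / q) = 2 * t / q"
  proof -
    have "l / q * (cmod (snd w))\<^sup>2 + (cmod (snd v))\<^sup>2 / (l / q) = l / q * (cmod (snd w))\<^sup>2 + (cmod (snd v))\<^sup>2 * (1 / (l / q))" by simp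
    also have "\<dots> = (l * (cmod (snd w))\<^sup>2 + m * (cmod (snd v))\<^sup>2) / q" unfolding e2 by (simp add: add_divide_distrib)
    finally show ?thesis unfolding s3 .
  qed
  \<comment> \<open>the matrix of \<open>p\<close> at the parameter \<open>l / q\<close> is \<open>(ray p u + ray p (- u)) / q\<close>\<close>
  have Z: "of_real (l / q) * fst w * cnj (snd w) + fst v * cnj (snd v) / of_real (l / q) = of_real (2 * t) * z / of_real q"
  proof -
    have "fst v * cnj (snd v) / complex_of_real (l / q) = fst v * cnj (snd v) * of_real (m / q)"
      unfolding e2[symmetric] by simp
    then have "of_real (l / q) * fst w * cnj (snd w) + fst v * cnj (snd v) / of_real (l / q)
      = (of_real l * (fst w * cnj (snd w)) + of_real m * (fst v * cnj (snd v))) / of_real q"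
      by (simp add: add_divide_distrib mult.commute mult.left_commute)
    then show ?thesis unfolding s2 .
  qed
  have "(q * cmod (det2 v w))\<^sup>2 = (2 * t * t)\<^sup>2"
    unfolding lm[symmetric] power_mult_distrib[of q] power2_eq_square[of q] q(2) ..
  then have Dq: "q * cmod (det2 v w) = 2 * t * t" using q t by (simp add: power2_eq_iff_nonneg)
  have gp: "geodesic \<gamma> r = p"
  proof -
    have "cmod (det2 v w) / (2 * t / q) = t" using Dq t q by (simp add: field_simps)
    moreover have "of_real (2 * t) * z / of_real q / of_real (2 * t / q) = z" using t q by simp
    ultimately show ?thesis unfolding k(2) e geo_point_def Let_def W Z pt by (simp only:)
  qed
  obtain l' m' where l': "ray p (velocity \<gamma> r) = l' *\<^sub>R outer w" "ray p (- velocity \<gamma> r) = m' *\<^sub>R outer v"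
    using ray_velocity[OF L vw(2), of r] ray_minus_velocity[OF L vw(1), of r] gp by auto
  have "l' *\<^sub>R outer w + m' *\<^sub>R outer v = l *\<^sub>R outer w + m *\<^sub>R outer v"
    unfolding sum l'[symmetric] ray_add_ray_minus by (simp add: pt)
  then have "l' = l" using outer_independent[OF D] by blast
  then have "ray p (velocity \<gamma> r) = ray p u" using l' w by simp
  then have "velocity \<gamma> r = u" using t by (auto simp: ray_def pt prod_eq_iff)
  then show ?thesis using L gp by blast
qed

section \<open>Holomorphic curves of real slope\<close>

lemma has_derivative_zero_on_open:
  assumes "open B" "z \<in> B" "\<And>x. x \<in> B \<Longrightarrow> E x = 0" "(E has_derivative E') (at z)"
  shows "E' h = 0"
proof -
  have "((\<lambda>_. 0) has_derivative E') (at z)"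
    using has_derivative_transform_within_open[OF assms(4,1,2)] assms(3) by auto
  then show ?thesis using has_derivative_unique[OF _ has_derivative_const] by metis
qed

text \<open>Applying the two Wirtinger derivatives to the vanishing imaginary part makes \<open>p'\<close> real, hence constant,
  and expresses \<open>q'\<close> by \<open>p\<close>. In other words, a real function \<open>q + cnj z p\<close> that is
  affine in \<open>cnj z\<close> is a Hermitian polynomial of degree one in each of \<open>z\<close> and \<open>cnj z\<close>. This is what produces the Hermitian form.\<close>

lemma real_mixed_holomorphic_affine:
  fixes c :: complex
  assumes p: "p holomorphic_on ball c r" and q: "q holomorphic_on ball c r" and r: "r > 0"
    and re: "\<And>z. z \<in> ball c r \<Longrightarrow> Im (q z + cnj z * p z) = 0"
  shows "\<exists>a d b. \<forall>z\<in>ball c r. p z = of_real a * z - cnj b \<and> q z = of_real d - b * z"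
proof -
  define B where "B = ball c r"
  have B: "open B" "convex B" "c \<in> B" using r by (auto simp: B_def)
  have p: "p holomorphic_on B" and q: "q holomorphic_on B" using p q by (simp_all add: B_def)
  have dp: "(p has_field_derivative deriv p z) (at z)" and dq: "(q has_field_derivative deriv q z) (at z)"
    and d2p: "(deriv p has_field_derivative deriv (deriv p) z) (at z)"
    and d2q: "(deriv q has_field_derivative deriv (deriv q) z) (at z)" if "z \<in> B" for z
    using that p q B by (auto intro!: holomorphic_derivI holomorphic_deriv)
  note dd = dp[unfolded has_field_derivative_def] dq[unfolded has_field_derivative_def]
    d2p[unfolded has_field_derivative_def] d2q[unfolded has_field_derivative_def]
  \<comment> \<open>the complex linear part of the derivative of the imaginary part\<close>
  have G: "deriv q z + cnj z * deriv p z - cnj (p z) = 0" if z: "z \<in> B" for z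
  proof -
    have d1: "((\<lambda>z. q z + cnj z * p z - cnj (q z + cnj z * p z)) has_derivative
       (\<lambda>h. (deriv q z * h + (cnj z * (deriv p z * h) + cnj h * p z)) - cnj (deriv q z * h + (cnj z * (deriv p z * h) + cnj h * p z)))) (at z)"
      by (intro derivative_intros dd z)
    have z0: "q x + cnj x * p x - cnj (q x + cnj x * p x) = 0" if "x \<in> B" for x
      using re[of x] that unfolding B_def[symmetric] by (simp add: complex_eq_iff)
    have *: "(deriv q z * h + (cnj z * (deriv p z * h) + cnj h * p z)) - cnj (deriv q z * h + (cnj z * (deriv p z * h) + cnj h * p z)) = 0" for h
      by (rule has_derivative_zero_on_open[OF B(1) z z0 d1])
    show ?thesis using *[of 1] *[of \<i>] by (simp add: complex_eq_iff)
  qed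
  \<comment> \<open>the complex antilinear part of the derivative of the previous equation\<close>
  have P: "deriv p z = cnj (deriv p z) \<and> deriv (deriv p) z = 0" if z: "z \<in> B" for z
  proof -
    have re': "deriv p z - cnj (deriv p z) = 0" if z: "z \<in> B" for z
    proof -
      have d1: "((\<lambda>z. deriv q z + cnj z * deriv p z - cnj (p z)) has_derivative
         (\<lambda>h. deriv (deriv q) z * h + (cnj z * (deriv (deriv p) z * h) + cnj h * deriv p z) - cnj (deriv p z * h))) (at z)"
        by (intro derivative_intros dd z)
      have *: "deriv (deriv q) z * h + (cnj z * (deriv (deriv p) z * h) + cnj h * deriv p z) - cnj (deriv p z * h) = 0" for h
        by (rule has_derivative_zero_on_open[OF B(1) z G d1])
      show ?thesis using *[of 1] *[of \<i>] by (simp add: complex_eq_iff)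
    qed
    have d1: "((\<lambda>z. deriv p z - cnj (deriv p z)) has_derivative (\<lambda>h. deriv (deriv p) z * h - cnj (deriv (deriv p) z * h))) (at z)"
      by (intro derivative_intros dd z)
    have *: "deriv (deriv p) z * h - cnj (deriv (deriv p) z * h) = 0" for h
      by (rule has_derivative_zero_on_open[OF B(1) z re' d1])
    show ?thesis using *[of 1] *[of \<i>] re'[OF z] by (simp add: complex_eq_iff)
  qed
  have "\<exists>k. \<forall>z\<in>B. deriv p z = k"
    by (rule has_field_derivative_zero_constant[OF B(2)]) (metis P d2p has_field_derivative_at_within)
  then obtain k where k: "\<And>z. z \<in> B \<Longrightarrow> deriv p z = k" by blast
  define a where "a = Re k"
  have ka: "k = of_real a" using P[OF B(3)] k[OF B(3)] by (simp add: a_def complex_eq_iff)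
  have "\<exists>b. \<forall>z\<in>B. p z - of_real a * z = b"
  proof (rule has_field_derivative_zero_constant[OF B(2)])
    fix z assume z: "z \<in> B"
    have "((\<lambda>z. p z - of_real a * z) has_field_derivative (deriv p z - of_real a * 1)) (at z)"
      by (intro DERIV_diff dp z DERIV_cmult DERIV_ident)
    then show "((\<lambda>z. p z - of_real a * z) has_field_derivative 0) (at z within B)"
      using k[OF z] ka by (simp add: has_field_derivative_at_within)
  qed
  then obtain b' where b': "\<And>z. z \<in> B \<Longrightarrow> p z - of_real a * z = b'" by blast
  define b where "b = - cnj b'"
  have pz: "p z = of_real a * z - cnj b" if "z \<in> B" for z using b'[OF that] by (simp add: b_def algebra_simps)
  have "\<exists>d. \<forall>z\<in>B. q z + b * z = d"
  proof (rule has_field_derivative_zero_constant[OF B(2)])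
    fix z assume z: "z \<in> B"
    have "((\<lambda>z. q z + b * z) has_field_derivative (deriv q z + b * 1)) (at z)"
      by (intro DERIV_add dq z DERIV_cmult DERIV_ident)
    moreover have "deriv q z + b * 1 = 0" using G[OF z] k[OF z] ka pz[OF z] by (simp add: algebra_simps)
    ultimately show "((\<lambda>z. q z + b * z) has_field_derivative 0) (at z within B)"
      by (simp add: has_field_derivative_at_within)
  qed
  then obtain d' where d': "\<And>z. z \<in> B \<Longrightarrow> q z + b * z = d'" by blast
  have qz: "q z = d' - b * z" if "z \<in> B" for z using d'[OF that] by (simp add: algebra_simps)
  have "Im d' = 0"
    using re[of c] B(3) qz[OF B(3)] pz[OF B(3)] unfolding B_def[symmetric] by (simp add: algebra_simps)
  then have "d' = of_real (Re d')" by (simp add: complex_eq_iff)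
  then show ?thesis using pz qz unfolding B_def[symmetric] by metis
qed

text \<open>In terms of lifts the symplectic form has the same shape in all four charts.\<close>

lemma omega_coeff_eq_det2:
  "omega_coeff i j (z, w) = (if i = j then 1 else - 1) / (det2 (start_lift i z) (end_lift j w))\<^sup>2"
proof -
  have 1: "(- (z * cnj w) - 1)\<^sup>2 = (1 + z * cnj w)\<^sup>2" "(- 1 - z * cnj w)\<^sup>2 = (1 + z * cnj w)\<^sup>2" "(- z - cnj w)\<^sup>2 = (z + cnj w)\<^sup>2"
    "(- cnj w - z)\<^sup>2 = (z + cnj w)\<^sup>2" "(-1 - cnj w * z)\<^sup>2 = (1 + z * cnj w)\<^sup>2"
    by (simp_all add: power2_eq_square algebra_simps)
  show ?thesis
    by (cases i; cases j) (simp_all add: omega_coeff_def start_lift_def end_lift_def det2_def 1)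
qed

text \<open>The semidefinite form of rank one whose kernel is spanned by \<open>w\<close>; geodesics ending at \<open>[w]\<close>
  or starting there are incident with it.\<close>

definition point_form :: "complex \<times> complex \<Rightarrow> herm" where
  "point_form w = ((cmod (snd w))\<^sup>2, (cmod (fst w))\<^sup>2, - (snd w * cnj (fst w)))"

lemma hform_point_form: "hform (point_form w) x y = det2 x w * cnj (det2 y w)"
  unfolding hform_def point_form_def prod.case complex_norm_square
  by (simp add: det2_def algebra_simps)

lemma point_form_nonzero: "w \<noteq> 0 \<Longrightarrow> point_form w \<noteq> 0"
  by (cases w) (auto simp: point_form_def zero_prod_def)

lemma hform_lifts_holomorphic:
  assumes "h holomorphic_on S"
  shows "(\<lambda>z. hform A (start_lift i z) (end_lift j (h z))) holomorphic_on S"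
proof -
  obtain a d b where A: "A = (a, d, b)" by (cases A)
  show ?thesis
    using assms by (cases i; cases j) (auto simp: A hform_def start_lift_def end_lift_def intro!: holomorphic_intros)
qed

text \<open>The values lie on the two coordinate axes without the origin, and a connected set meets only one of them.\<close>

lemma real_constant_sign:
  fixes S :: "complex \<Rightarrow> complex"
  assumes "connected B" "continuous_on B S" "\<And>z. z \<in> B \<Longrightarrow> S z \<noteq> 0" "\<And>z. z \<in> B \<Longrightarrow> Im ((S z)\<^sup>2) = 0"
  shows "(\<forall>z\<in>B. Im (S z) = 0) \<or> (\<forall>z\<in>B. Re (S z) = 0)"
proof (rule ccontr)
  assume "\<not> ?thesis"
  then obtain x y where xy: "x \<in> B" "Im (S x) \<noteq> 0" "y \<in> B" "Re (S y) \<noteq> 0" by blast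
  have or: "Re (S z) = 0 \<or> Im (S z) = 0" if "z \<in> B" for z
    using assms(4)[OF that] by (auto simp: power2_eq_square)
  have "connected ((\<lambda>z. (Re (S z))\<^sup>2 - (Im (S z))\<^sup>2) ` B)"
    by (intro connected_continuous_image continuous_intros assms)
  moreover have "(Re (S x))\<^sup>2 - (Im (S x))\<^sup>2 < 0" "(Re (S y))\<^sup>2 - (Im (S y))\<^sup>2 > 0"
    using or[OF xy(1)] or[OF xy(3)] xy by auto
  ultimately have "0 \<in> (\<lambda>z. (Re (S z))\<^sup>2 - (Im (S z))\<^sup>2) ` B"
    using connectedD_interval[of _ _ _ 0] xy by (metis (no_types, lifting) imageI less_imp_le)
  then obtain z where "z \<in> B" "(Re (S z))\<^sup>2 = (Im (S z))\<^sup>2" by auto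
  then show False using or[of z] assms(3)[of z] by (auto simp: complex_eq_iff)
qed

text \<open>The Lagrangian condition says that \<open>cnj (h') / det\<^sup>2\<close> is real, where \<open>det\<close> is the determinant of the two
  lifts. With a holomorphic root \<open>q\<close> of \<open>1 / h'\<close>, the function \<open>S = q cnj det\<close> therefore has real square, so that
  after multiplication by \<open>1\<close> or \<open>\<i>\<close> it is real. As \<open>cnj det\<close> is affine in \<open>cnj z\<close> with holomorphic
  coefficients, these coefficients times \<open>q\<close>, which represent the same end point, are affine in \<open>z\<close> with
  Hermitian coefficients, and the graph lies on the incidence curve of a form.\<close>

lemma real_slope_graph_incident_local:
  fixes c :: complex
  assumes h: "h holomorphic_on ball c r" and r: "r > 0"
    and D: "\<And>z. z \<in> ball c r \<Longrightarrow> det2 (start_lift i z) (end_lift j (h z)) \<noteq> 0"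
    and h': "\<And>z. z \<in> ball c r \<Longrightarrow> deriv h z \<noteq> 0"
    and real: "\<And>z. z \<in> ball c r \<Longrightarrow> Im (omega_coeff i j (z, h z) * cnj (deriv h z)) = 0"
  shows "\<exists>A. A \<noteq> 0 \<and> (\<forall>z\<in>ball c r. hform A (start_lift i z) (end_lift j (h z)) = 0)"
proof -
  define B where "B = ball c r"
  have B: "open B" "connected B" "simply_connected B" "c \<in> B"
    using r by (auto simp: B_def convex_imp_simply_connected)
  have "(\<lambda>z. 1 / deriv h z) holomorphic_on B"
    using h h' unfolding B_def[symmetric] by (intro holomorphic_intros holomorphic_deriv B) auto
  moreover have "\<forall>z\<in>B. 1 / deriv h z \<noteq> 0" using h' by (simp add: B_def)
  ultimately obtain q where q: "q holomorphic_on B" and q2: "\<And>z. z \<in> B \<Longrightarrow> 1 / deriv h z = (q z)\<^sup>2"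
    using simply_connected_eq_holomorphic_sqrt[OF B(1), THEN iffD1, OF B(3), THEN conjunct2, rule_format, of "\<lambda>z. 1 / deriv h z"]
    by blast
  define u where "u = (\<lambda>z. end_lift j (h z))"
  define u1 where "u1 = (\<lambda>z. if j then h z else 1)"
  define u2 where "u2 = (\<lambda>z. if j then 1 else h z)"
  have u: "end_lift j (h z) = (cnj (u1 z), cnj (u2 z))" for z by (simp add: end_lift_def u1_def u2_def)
  have hol: "u1 holomorphic_on B" "u2 holomorphic_on B" using h by (cases j; simp add: u1_def u2_def B_def)+
  define S where "S = (\<lambda>z. q z * cnj (det2 (start_lift i z) (end_lift j (h z))))"
  have S: "S z = - (if i then q z * u2 z + cnj z * (q z * u1 z) else q z * u1 z + cnj z * (q z * u2 z))" for z
    unfolding S_def u by (cases i) (simp_all add: start_lift_def det2_def algebra_simps)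
  have cS: "continuous_on B S"
    unfolding S using hol[THEN holomorphic_on_imp_continuous_on] q[THEN holomorphic_on_imp_continuous_on]
    by (cases i; auto intro!: continuous_intros)
  have S0: "S z \<noteq> 0" if "z \<in> B" for z
    using D[of z] q2[OF that] h'[of z] that unfolding B_def[symmetric] S_def by auto
  have S2: "Im ((S z)\<^sup>2) = 0" if z: "z \<in> B" for z
  proof -
    define d where "d = det2 (start_lift i z) (end_lift j (h z))"
    define k where "k = deriv h z"
    have dk: "d \<noteq> 0" "k \<noteq> 0" using D[of z] h'[of z] z unfolding B_def[symmetric] by (auto simp: d_def k_def)
    have im: "Im (cnj k / d\<^sup>2) = 0"
      using real[of z] z unfolding B_def[symmetric] omega_coeff_eq_det2 d_def[symmetric] k_def[symmetric] by (auto split: if_splits)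
    have eq: "(S z)\<^sup>2 = cnj (inverse (cnj k / d\<^sup>2))"
      unfolding S_def d_def[symmetric] power_mult_distrib q2[OF z, symmetric] k_def[symmetric]
      by (simp add: divide_inverse)
    define x where "x = Re (cnj k / d\<^sup>2)"
    have "cnj k / d\<^sup>2 = of_real x" unfolding x_def using im by (simp add: complex_eq_iff)
    then have "(S z)\<^sup>2 = of_real (inverse x)" unfolding eq by simp
    then show ?thesis by simp
  qed
  \<comment> \<open>\<open>s\<close> is \<open>1\<close> or \<open>\<i>\<close>\<close>
  obtain s where s: "s \<noteq> 0" "\<And>z. z \<in> B \<Longrightarrow> Im (s * S z) = 0"
  proof -
    from real_constant_sign[OF B(2) cS S0 S2] have "(\<forall>z\<in>B. Im (1 * S z) = 0) \<or> (\<forall>z\<in>B. Im (\<i> * S z) = 0)" by simp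
    then show ?thesis using that[of 1] that[of \<i>] by auto
  qed
  define X1 where "X1 = (\<lambda>z. s * q z * u1 z)"
  define X2 where "X2 = (\<lambda>z. s * q z * u2 z)"
  have Xh: "X1 holomorphic_on B" "X2 holomorphic_on B"
    unfolding X1_def X2_def by (intro holomorphic_intros q hol)+
  have sS: "s * S z = - (if i then X2 z + cnj z * X1 z else X1 z + cnj z * X2 z)" for z
    unfolding S X1_def X2_def by (simp add: algebra_simps)
  have X0: "(X1 z, X2 z) \<noteq> (0, 0)" if "z \<in> B" for z
    using sS[of z] S0[OF that] s(1) by (auto split: if_splits)
  have fin: "\<exists>A. A \<noteq> 0 \<and> (\<forall>z\<in>B. hform A (start_lift i z) (end_lift j (h z)) = 0)"
    if A: "\<And>z. z \<in> B \<Longrightarrow> hform A (start_lift i z) (cnj (X1 z), cnj (X2 z)) = 0"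
       and nz: "A \<noteq> 0" for A
  proof (intro exI[of _ A] conjI ballI nz)
    fix z assume z: "z \<in> B"
    have "(cnj (X1 z), cnj (X2 z)) = (cnj (s * q z) * cnj (u1 z), cnj (s * q z) * cnj (u2 z))"
      by (simp add: X1_def X2_def)
    then have "0 = s * q z * hform A (start_lift i z) (cnj (u1 z), cnj (u2 z))"
      using A[OF z] hform_scale[of A 1 "fst (start_lift i z)" "snd (start_lift i z)" "cnj (s * q z)" "cnj (u1 z)" "cnj (u2 z)"] by simp
    moreover have "q z \<noteq> 0" using S0[OF z] by (auto simp: S_def)
    ultimately show "hform A (start_lift i z) (end_lift j (h z)) = 0" using s(1) by (simp add: u)
  qed
  show ?thesis unfolding B_def[symmetric]
  proof (cases i)
    case False
    have "Im (X1 z + cnj z * X2 z) = 0" if "z \<in> ball c r" for z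
      using s(2)[of z] that False unfolding B_def[symmetric] sS by simp
    then obtain a d b where X: "\<And>z. z \<in> B \<Longrightarrow> X2 z = of_real a * z - cnj b \<and> X1 z = of_real d - b * z"
      using real_mixed_holomorphic_affine[of X2 c r X1] Xh r unfolding B_def[symmetric] by blast
    show "\<exists>A. A \<noteq> 0 \<and> (\<forall>z\<in>B. hform A (start_lift i z) (end_lift j (h z)) = 0)"
    proof (rule fin)
      show "hform (a, d, b) (start_lift i z) (cnj (X1 z), cnj (X2 z)) = 0" if "z \<in> B" for z
        using False by (simp add: hform_def start_lift_def X[OF that] algebra_simps)
      show "(a, d, b) \<noteq> 0" using X0[OF B(4)] X[OF B(4)] by (auto simp: zero_prod_def)
    qed
  next
    case True
    have "Im (X2 z + cnj z * X1 z) = 0" if "z \<in> ball c r" for z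
      using s(2)[of z] that True unfolding B_def[symmetric] sS by simp
    then obtain a d b where X: "\<And>z. z \<in> B \<Longrightarrow> X1 z = of_real a * z - cnj b \<and> X2 z = of_real d - b * z"
      using real_mixed_holomorphic_affine[of X1 c r X2] Xh r unfolding B_def[symmetric] by blast
    show "\<exists>A. A \<noteq> 0 \<and> (\<forall>z\<in>B. hform A (start_lift i z) (end_lift j (h z)) = 0)"
    proof (rule fin)
      show "hform (d, a, cnj b) (start_lift i z) (cnj (X1 z), cnj (X2 z)) = 0" if "z \<in> B" for z
        using True by (simp add: hform_def start_lift_def X[OF that] algebra_simps)
      show "(d, a, cnj b) \<noteq> 0" using X0[OF B(4)] X[OF B(4)] by (auto simp: zero_prod_def)
    qed
  qed
qed

text \<open>A form obtained near one point where the slope is not zero works on the whole disc by the identity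
  theorem. If the slope is zero everywhere, the geodesics have a common end point.\<close>

lemma real_slope_graph_incident:
  fixes c :: complex
  assumes h: "h holomorphic_on ball c r" and r: "r > 0"
    and D: "\<And>z. z \<in> ball c r \<Longrightarrow> det2 (start_lift i z) (end_lift j (h z)) \<noteq> 0"
    and real: "\<And>z. z \<in> ball c r \<Longrightarrow> Im (omega_coeff i j (z, h z) * cnj (deriv h z)) = 0"
  shows "\<exists>A. A \<noteq> 0 \<and> (\<forall>z\<in>ball c r. hform A (start_lift i z) (end_lift j (h z)) = 0)"
proof (cases "\<exists>z1\<in>ball c r. deriv h z1 \<noteq> 0")
  case True
  then obtain z1 where z1: "z1 \<in> ball c r" "deriv h z1 \<noteq> 0" by blast
  have "continuous_on (ball c r) (deriv h)"
    by (intro holomorphic_on_imp_continuous_on holomorphic_deriv h) auto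
  then obtain e1 where e1: "e1 > 0" "\<And>y. dist z1 y < e1 \<Longrightarrow> deriv h y \<noteq> 0"
    using continuous_on_open_avoid[of "ball c r" "deriv h" z1 0] z1 by auto
  obtain e2 where e2: "e2 > 0" "ball z1 e2 \<subseteq> ball c r" using z1(1) open_contains_ball[of "ball c r"] by blast
  define e where "e = min e1 e2"
  have e: "e > 0" and sub: "ball z1 e \<subseteq> ball c r" and h'e: "\<And>z. z \<in> ball z1 e \<Longrightarrow> deriv h z \<noteq> 0"
    using e1 e2 by (auto simp: e_def)
  have "\<exists>A. A \<noteq> 0 \<and> (\<forall>z\<in>ball z1 e. hform A (start_lift i z) (end_lift j (h z)) = 0)"
    using e sub h'e by (intro real_slope_graph_incident_local holomorphic_on_subset[OF h] D real) auto
  then obtain A where A: "A \<noteq> 0" "\<And>z. z \<in> ball z1 e \<Longrightarrow> hform A (start_lift i z) (end_lift j (h z)) = 0" by blast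
  have "hform A (start_lift i z) (end_lift j (h z)) = 0" if "z \<in> ball c r" for z
    by (rule analytic_continuation_open[of "ball z1 e" "ball c r" "\<lambda>z. hform A (start_lift i z) (end_lift j (h z))" "\<lambda>_. 0"])
       (use A e sub that in \<open>auto intro!: hform_lifts_holomorphic h\<close>)
  then show ?thesis using A(1) by blast
next
  case False
  have "\<exists>h0. \<forall>z\<in>ball c r. h z = h0"
  proof (rule has_field_derivative_zero_constant)
    fix z assume z: "z \<in> ball c r"
    then show "(h has_field_derivative 0) (at z within ball c r)"
      using False holomorphic_derivI[OF h open_ball z] by (metis has_field_derivative_at_within)
  qed simp
  then obtain h0 where h0: "\<And>z. z \<in> ball c r \<Longrightarrow> h z = h0" by blast
  have "end_lift j h0 \<noteq> 0" by (simp add: end_lift_def zero_prod_def)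
  then show ?thesis
    by (intro exI[of _ "point_form (end_lift j h0)"])
       (auto simp: point_form_nonzero hform_point_form h0 det2_def)
qed

text \<open>By the inverse function theorem the surface is a graph over the first coordinate. Invariance of the
  tangent planes under \<open>J\<close> is the Cauchy-Riemann equation for the graph function, and the Lagrangian
  condition makes its slope real.\<close>

lemma alpha_graph_incident:
  fixes F :: "complex \<Rightarrow> complex \<times> complex"
  assumes U: "open U" "u0 \<in> U"
    and dF: "\<And>u. u \<in> U \<Longrightarrow> (F has_derivative L u) (at u)"
    and cL: "\<And>x. continuous_on U (\<lambda>u. L u x)"
    and inj: "\<And>x. fst (L u0 x) = 0 \<Longrightarrow> x = 0"
    and J: "\<And>u x. u \<in> U \<Longrightarrow> \<exists>y. L u y = JJ (L u x)"
    and lag: "\<And>u x. u \<in> U \<Longrightarrow> Im (omega_coeff i j (F u) * fst (L u x) * cnj (snd (L u x))) = 0"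
    and D: "\<And>u. u \<in> U \<Longrightarrow> det2 (start_lift i (fst (F u))) (end_lift j (snd (F u))) \<noteq> 0"
  shows "\<exists>A V. A \<noteq> 0 \<and> open V \<and> u0 \<in> V \<and> V \<subseteq> U
    \<and> (\<forall>u\<in>V. hform A (start_lift i (fst (F u))) (end_lift j (snd (F u))) = 0)"
proof -
  define f where "f = (\<lambda>u. fst (F u))"
  define f' where "f' = (\<lambda>u. Blinfun (\<lambda>x. fst (L u x)))"
  have blL: "bounded_linear (L u)" if "u \<in> U" for u using dF[OF that] by (rule has_derivative_bounded_linear)
  have f': "blinfun_apply (f' u) = (\<lambda>x. fst (L u x))" if "u \<in> U" for u
    unfolding f'_def by (intro bounded_linear_Blinfun_apply bounded_linear_compose[OF bounded_linear_fst blL] that)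
  have df: "(f has_derivative blinfun_apply (f' u)) (at u)" if "u \<in> U" for u
    unfolding f'[OF that] f_def by (rule has_derivative_fst[OF dF[OF that]])
  have cf': "continuous_on U f'"
  proof (rule continuous_on_blinfun_componentwise)
    fix b :: complex
    have "continuous_on U (\<lambda>u. fst (L u b))" by (intro continuous_intros cL)
    then show "continuous_on U (\<lambda>u. blinfun_apply (f' u) b)" by (simp add: f' cong: continuous_on_cong)
  qed
  have lin: "linear (\<lambda>x. fst (L u0 x))"
    using f'[OF U(2)] by (metis blinfun.bounded_linear_right bounded_linear.linear)
  have "inj (\<lambda>x. fst (L u0 x))" using inj linear_injective_0[OF lin] by blast
  then obtain k where k: "linear k" "k \<circ> (\<lambda>x. fst (L u0 x)) = id"
    using linear_injective_left_inverse[OF lin] by blast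
  have bk: "blinfun_apply (Blinfun k) = k" using k(1) by (intro bounded_linear_Blinfun_apply) (simp add: linear_conv_bounded_linear)
  have "Blinfun k o\<^sub>L f' u0 = id_blinfun"
    by (rule blinfun_eqI) (use k(2) in \<open>simp add: bk f'[OF U(2)] fun_eq_iff\<close>)
  from inverse_function_theorem[OF U(1) df cf' U(2) this]
  obtain U' V g g' where U': "open U'" "U' \<subseteq> U" "u0 \<in> U'" and V: "open V" "f u0 \<in> V" and hom: "homeomorphism U' V f g"
    and dg: "\<And>y. y \<in> V \<Longrightarrow> (g has_derivative (g' y)) (at y)"
    and g': "\<And>y. y \<in> V \<Longrightarrow> g' y = inv (blinfun_apply (f' (g y)))"
    and bij: "\<And>y. y \<in> V \<Longrightarrow> bij (blinfun_apply (f' (g y)))"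
    by metis
  have gV: "g y \<in> U" "f (g y) = y" if "y \<in> V" for y
    using hom that U'(2) by (auto simp: homeomorphism_def)
  define h where "h = (\<lambda>y. snd (F (g y)))"
  have Fg: "F (g y) = (y, h y)" if "y \<in> V" for y
    using gV(2)[OF that] by (simp add: h_def f_def prod_eq_iff)
  have dh: "\<exists>k. (h has_field_derivative k) (at y) \<and> Im (omega_coeff i j (y, h y) * cnj k) = 0" if y: "y \<in> V" for y
  proof -
    define T where "T = (\<lambda>x. L (g y) (g' y x))"
    have dT: "((\<lambda>y. F (g y)) has_derivative T) (at y)"
      unfolding T_def by (rule has_derivative_compose[OF dg[OF y] dF[OF gV(1)[OF y]]])
    then have lT: "linear T" using has_derivative_bounded_linear bounded_linear.linear by blast
    have fT: "fst (T x) = x" for x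
      using bij[OF y] g'[OF y] f'[OF gV(1)[OF y]] unfolding T_def by (metis bij_inv_eq_iff)
    define k where "k = snd (T 1)"
    obtain w where w: "L (g y) w = JJ (T 1)" using J[OF gV(1)[OF y]] unfolding T_def by blast
    have "fst (L (g y) w) = \<i>" unfolding w by (simp add: JJ_def fT)
    then have "g' y \<i> = w" using bij[OF y] g'[OF y] f'[OF gV(1)[OF y]] by (metis bij_inv_eq_iff)
    then have Ti: "T \<i> = JJ (T 1)" unfolding T_def using w T_def by simp
    have sT: "snd (T x) = k * x" for x
    proof -
      have "T x = T (Re x *\<^sub>R 1 + Im x *\<^sub>R \<i>)" by (rule arg_cong[where f = T]) (simp add: complex_eq_iff)
      also have "\<dots> = Re x *\<^sub>R T 1 + Im x *\<^sub>R T \<i>" by (simp only: linear_add[OF lT] linear_scale[OF lT])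
      finally have "snd (T x) = Re x *\<^sub>R k + Im x *\<^sub>R (\<i> * k)" by (simp add: Ti JJ_def k_def)
      also have "\<dots> = k * x" by (simp add: complex_eq_iff algebra_simps)
      finally show ?thesis .
    qed
    have "(h has_derivative (\<lambda>x. snd (T x))) (at y)"
      unfolding h_def by (rule has_derivative_snd[OF dT])
    then have "(h has_field_derivative k) (at y)" unfolding has_field_derivative_def sT .
    moreover have "Im (omega_coeff i j (y, h y) * cnj k) = 0"
      using lag[OF gV(1)[OF y], of "g' y 1"] fT[of 1] unfolding Fg[OF y] k_def T_def by simp
    ultimately show ?thesis by blast
  qed
  obtain r where r: "r > 0" "ball (f u0) r \<subseteq> V" using V open_contains_ball by blast
  have hol: "h holomorphic_on ball (f u0) r"
    using dh r(2) by (subst holomorphic_on_open) auto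
  have "\<exists>A. A \<noteq> 0 \<and> (\<forall>z\<in>ball (f u0) r. hform A (start_lift i z) (end_lift j (h z)) = 0)"
  proof (rule real_slope_graph_incident[OF hol r(1)])
    fix z assume "z \<in> ball (f u0) r"
    then have z: "z \<in> V" using r(2) by blast
    show "det2 (start_lift i z) (end_lift j (h z)) \<noteq> 0" using D[OF gV(1)[OF z]] Fg[OF z] by simp
    show "Im (omega_coeff i j (z, h z) * cnj (deriv h z)) = 0" using dh[OF z] DERIV_imp_deriv by metis
  qed
  then obtain A where A: "A \<noteq> 0" "\<And>z. z \<in> ball (f u0) r \<Longrightarrow> hform A (start_lift i z) (end_lift j (h z)) = 0" by blast
  have "continuous_on U' f" using hom by (simp add: homeomorphism_def)
  then have "open (U' \<inter> f -` ball (f u0) r)" by (rule continuous_open_preimage) (use U' in auto)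
  moreover have "hform A (start_lift i (fst (F u))) (end_lift j (snd (F u))) = 0" if "u \<in> U' \<inter> f -` ball (f u0) r" for u
  proof -
    have "g (f u) = u" using hom that by (simp add: homeomorphism_def)
    then show ?thesis using A(2)[of "f u"] that by (simp add: h_def f_def)
  qed
  ultimately show ?thesis using A(1) U' r(1)
    by (intro exI[of _ A] exI[of _ "U' \<inter> f -` ball (f u0) r"]) auto
qed

text \<open>Exchanging the two factors amounts to reversing all geodesics and applying the antipodal map of the boundary
  sphere; together with the next two lemmas this reduces the case of a graph over the second coordinate to that of a graph over the first.\<close>

lemma swap_hform:
  "hform (a, d, b) (start_lift i z) (end_lift j w) = - hform (d, a, - b) (start_lift j w) (end_lift i z)"
  by (cases i; cases j) (simp_all add: hform_def start_lift_def end_lift_def algebra_simps)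

lemma swap_det2: "det2 (start_lift j w) (end_lift i z) = cnj (det2 (start_lift i z) (end_lift j w))"
  by (cases i; cases j) (simp_all add: det2_def start_lift_def end_lift_def algebra_simps)

lemma swap_omega_coeff: "omega_coeff j i (w, z) = cnj (omega_coeff i j (z, w))"
  unfolding omega_coeff_eq_det2 swap_det2[of j w i z] by simp

lemma alpha_plane_imp:
  assumes "alpha_plane i j \<zeta> (range L)"
  shows "\<exists>y. L y = JJ (L x)" "Im (omega_coeff i j \<zeta> * fst (L x) * cnj (snd (L x))) = 0" "dim (range L) = 2"
proof -
  show y: "\<exists>y. L y = JJ (L x)" using assms unfolding alpha_plane_def by (metis imageI rangeE rangeI)
  have "Omega i j \<zeta> (L x) (JJ (L x)) = 0" using assms y unfolding alpha_plane_def lagrangian_def by (metis rangeI)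
  moreover have "Omega i j \<zeta> X (JJ X) = - 4 * Im (omega_coeff i j \<zeta> * fst X * cnj (snd X))" for X
    by (simp add: Omega_def JJ_def algebra_simps)
  ultimately show "Im (omega_coeff i j \<zeta> * fst (L x) * cnj (snd (L x))) = 0" by simp
  show "dim (range L) = 2" using assms by (simp add: alpha_plane_def)
qed

text \<open>If the first coordinate is not a local diffeomorphism, then its differential has a kernel, and by complex
  linearity the tangent plane is the whole second factor; then the second coordinate can be used.\<close>

lemma alpha_patch_incident:
  fixes F :: "complex \<Rightarrow> complex \<times> complex"
  assumes U: "open U" "u0 \<in> U"
    and dF: "\<And>u. u \<in> U \<Longrightarrow> (F has_derivative L u) (at u)"
    and cL: "\<And>x. continuous_on U (\<lambda>u. L u x)"
    and inj: "inj (L u0)"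
    and al: "\<And>u. u \<in> U \<Longrightarrow> alpha_plane i j (F u) (range (L u))"
    and D: "\<And>u. u \<in> U \<Longrightarrow> det2 (start_lift i (fst (F u))) (end_lift j (snd (F u))) \<noteq> 0"
  shows "\<exists>A V. A \<noteq> 0 \<and> open V \<and> u0 \<in> V \<and> V \<subseteq> U
    \<and> (\<forall>u\<in>V. hform A (start_lift i (fst (F u))) (end_lift j (snd (F u))) = 0)"
proof (cases "\<forall>x. fst (L u0 x) = 0 \<longrightarrow> x = 0")
  case True
  then show ?thesis
    using alpha_plane_imp[OF al] by (intro alpha_graph_incident[OF U dF cL _ _ _ D]) auto
next
  case False
  then obtain x where x: "fst (L u0 x) = 0" "x \<noteq> 0" by blast
  have lin: "linear (L u0)" using dF[OF U(2)] has_derivative_bounded_linear bounded_linear.linear by blast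
  have snd_inj: "y = 0" if y: "snd (L u0 y) = 0" for y
  proof -
    define s where "s = snd (L u0 x)"
    have "L u0 x \<noteq> L u0 0" using x(2) inj by (simp add: inj_eq)
    then have s: "L u0 x = (0, s)" "s \<noteq> 0"
      using x(1) unfolding linear_0[OF lin] by (simp_all add: s_def prod_eq_iff)
    have "{0} \<times> UNIV \<subseteq> range (L u0)"
    proof clarify
      fix t :: complex
      define k where "k = t / s"
      obtain x' where x': "L u0 x' = JJ (L u0 x)" using alpha_plane_imp(1)[OF al[OF U(2)]] by blast
      have "L u0 (Re k *\<^sub>R x + Im k *\<^sub>R x') = Re k *\<^sub>R L u0 x + Im k *\<^sub>R JJ (L u0 x)"
        by (simp only: linear_add[OF lin] linear_scale[OF lin] x')
      also have "\<dots> = (0, k * s)" by (simp add: s JJ_def complex_eq_iff algebra_simps)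
      also have "k * s = t" using s by (simp add: k_def)
      finally show "(0, t) \<in> range (L u0)" by (metis rangeI)
    qed
    moreover have "subspace ({0} \<times> (UNIV :: complex set) :: (complex \<times> complex) set)" "subspace (range (L u0))"
      using al[OF U(2)] by (auto simp: alpha_plane_def intro!: subspace_Times)
    moreover have "dim ({0} \<times> (UNIV :: complex set) :: (complex \<times> complex) set) = 2"
      by (subst dim_Times) (auto simp: subspace_0)
    ultimately have "{0} \<times> UNIV = range (L u0)"
      using subspace_dim_equal alpha_plane_imp(3)[OF al[OF U(2)]] by (metis order_refl)
    then have "fst (L u0 y) = 0" by (metis SigmaE fst_conv rangeI singletonD)
    then have "L u0 y = L u0 0" using y linear_0[OF lin] by (simp add: prod_eq_iff)
    then show "y = 0" using inj by (simp add: inj_eq)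
  qed
  define F2 where "F2 = (\<lambda>u. (snd (F u), fst (F u)))"
  define L2 where "L2 = (\<lambda>u x. (snd (L u x), fst (L u x)))"
  have "\<exists>A V. A \<noteq> 0 \<and> open V \<and> u0 \<in> V \<and> V \<subseteq> U
    \<and> (\<forall>u\<in>V. hform A (start_lift j (fst (F2 u))) (end_lift i (snd (F2 u))) = 0)"
  proof (rule alpha_graph_incident[OF U])
    show "(F2 has_derivative L2 u) (at u)" if "u \<in> U" for u
      unfolding F2_def L2_def using dF[OF that] by (intro has_derivative_Pair has_derivative_fst has_derivative_snd)
    show "continuous_on U (\<lambda>u. L2 u x)" for x unfolding L2_def by (intro continuous_intros cL)
    show "x = 0" if "fst (L2 u0 x) = 0" for x using snd_inj that by (simp add: L2_def)
    show "\<exists>y. L2 u y = JJ (L2 u x)" if "u \<in> U" for u x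
      using alpha_plane_imp(1)[OF al[OF that], of x] by (auto simp: L2_def JJ_def) (metis fst_conv snd_conv)
    show "Im (omega_coeff j i (F2 u) * fst (L2 u x) * cnj (snd (L2 u x))) = 0" if "u \<in> U" for u x
    proof -
      have "omega_coeff j i (F2 u) * fst (L2 u x) * cnj (snd (L2 u x)) = cnj (omega_coeff i j (F u) * fst (L u x) * cnj (snd (L u x)))"
        using swap_omega_coeff[of j i "snd (F u)" "fst (F u)"] by (simp add: F2_def L2_def)
      then have "Im (omega_coeff j i (F2 u) * fst (L2 u x) * cnj (snd (L2 u x))) = - Im (omega_coeff i j (F u) * fst (L u x) * cnj (snd (L u x)))"
        by (simp only: cnj.sel)
      then show ?thesis unfolding alpha_plane_imp(2)[OF al[OF that], of x] by simp
    qed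
    show "det2 (start_lift j (fst (F2 u))) (end_lift i (snd (F2 u))) \<noteq> 0" if "u \<in> U" for u
      using D[OF that] swap_det2[of j "snd (F u)" i "fst (F u)"] by (simp add: F2_def)
  qed
  then obtain A V where AV: "A \<noteq> 0" "open V" "u0 \<in> V" "V \<subseteq> U"
    "\<And>u. u \<in> V \<Longrightarrow> hform A (start_lift j (fst (F2 u))) (end_lift i (snd (F2 u))) = 0" by blast
  obtain a d b where A: "A = (a, d, b)" by (cases A)
  have "(d, a, - b) \<noteq> 0" using AV(1) by (auto simp: A zero_prod_def)
  moreover have "hform (d, a, - b) (start_lift i (fst (F u))) (end_lift j (snd (F u))) = 0" if "u \<in> V" for u
    using AV(5)[OF that] unfolding A swap_hform[of d a "- b"] by (simp add: F2_def)
  ultimately show ?thesis using AV by blast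
qed

section \<open>Tangent planes of incidence curves\<close>

lemma hform_linear: "hform (c *\<^sub>R A + d *\<^sub>R B) v w = of_real c * hform A v w + of_real d * hform B v w"
  by (cases A; cases B) (simp add: hform_def scaleR_conv_of_real algebra_simps)

lemma hquad_linear: "hquad (c *\<^sub>R A + d *\<^sub>R B) v = c * hquad A v + d * hquad B v"
  by (simp add: hquad_def hform_linear)

text \<open>The derivative of \<^term>\<open>start_lift\<close> in the coordinate.\<close>

definition start_dir :: "bool \<Rightarrow> complex \<times> complex" where
  "start_dir i = (if i then (0, 1) else (- 1, 0))"

text \<open>The derivative of \<^term>\<open>end_lift\<close> in the conjugate of the coordinate.\<close>

definition end_dir :: "bool \<Rightarrow> complex \<times> complex" where
  "end_dir j = (if j then (1, 0) else (0, 1))"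

lemma hform_start_diff:
  "hform A (start_lift i z) w - hform A (start_lift i z') w = (z - z') * hform A (start_dir i) w"
  by (cases A; cases i) (simp_all add: hform_def start_lift_def start_dir_def algebra_simps)

lemma hform_end_diff:
  "hform A v (end_lift j z) - hform A v (end_lift j z') = (z - z') * hform A v (end_dir j)"
  by (cases A; cases j) (simp_all add: hform_def end_lift_def end_dir_def algebra_simps)

lemma hform_lifts_has_derivative:
  assumes "(F has_derivative L) (at u)"
  shows "((\<lambda>u. hform A (start_lift i (fst (F u))) (end_lift j (snd (F u)))) has_derivative
    (\<lambda>x. fst (L x) * hform A (start_dir i) (end_lift j (snd (F u))) + snd (L x) * hform A (start_lift i (fst (F u))) (end_dir j))) (at u)"
proof -
  obtain a d b where A: "A = (a, d, b)" by (cases A)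
  note d1 = has_derivative_fst[OF assms] and d2 = has_derivative_snd[OF assms]
  show ?thesis
    by (cases i; cases j) (auto simp: A hform_def start_lift_def end_lift_def start_dir_def end_dir_def algebra_simps
        intro!: derivative_eq_intros d1 d2 assms)
qed

lemma hform_expand_left:
  "det2 v w * hform A x w = det2 x w * hform A v w + det2 v x * hform A w w"
  by (cases A) (simp add: hform_def det2_def algebra_simps)

lemma hform_expand_right:
  "cnj (det2 v w) * hform A v x = cnj (det2 x w) * hform A v v + cnj (det2 v x) * hform A v w"
  by (cases A) (simp add: hform_def det2_def algebra_simps)

text \<open>On the incidence curve the partial derivatives of its equation are, up to nonzero factors, the real
  numbers \<^term>\<open>hquad A w\<close> and \<^term>\<open>hquad A v\<close>. So the curve is smooth, its slope is real, and its tangent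
  determines the ratio of these two numbers.\<close>

lemma incidence_gradient:
  fixes i j :: bool and z \<zeta> :: complex
  defines "v \<equiv> start_lift i z" and "w \<equiv> end_lift j \<zeta>"
  assumes E: "hform A v w = 0"
  shows "det2 v w * hform A (start_dir i) w = (if i then -1 else 1) * of_real (hquad A w)"
    and "cnj (det2 v w) * hform A v (end_dir j) = (if j then 1 else -1) * of_real (hquad A v)"
proof -
  show "det2 v w * hform A (start_dir i) w = (if i then -1 else 1) * of_real (hquad A w)"
    unfolding hform_expand_left E of_real_hquad
    by (cases i) (simp_all add: v_def start_lift_def start_dir_def det2_def)
  show "cnj (det2 v w) * hform A v (end_dir j) = (if j then 1 else -1) * of_real (hquad A v)"
    unfolding hform_expand_right E of_real_hquad
    by (cases j) (simp_all add: w_def end_lift_def end_dir_def det2_def)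
qed

lemma incidence_gradient_nonzero:
  assumes "det2 (start_lift i z) (end_lift j \<zeta>) \<noteq> 0" "A \<noteq> 0" "hform A (start_lift i z) (end_lift j \<zeta>) = 0"
  shows "hform A (start_dir i) (end_lift j \<zeta>) \<noteq> 0 \<or> hform A (start_lift i z) (end_dir j) \<noteq> 0"
proof (rule ccontr)
  assume "\<not> ?thesis"
  then have "hquad A (end_lift j \<zeta>) = 0" "hquad A (start_lift i z) = 0"
    using incidence_gradient[OF assms(3)] by (auto split: if_splits)
  then show False using herm_eq_0[OF assms(1)] assms by blast
qed

text \<open>A point and a tangent direction determine the form up to a real factor. The real combinations of \<open>A\<close> and \<open>B\<close> are
  incident and tangent as well; one of them vanishes on a further vector of a basis, hence is zero.\<close>

lemma incidence_unique:
  fixes i j :: bool and z \<zeta> :: complex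
  defines "v \<equiv> start_lift i z" and "w \<equiv> end_lift j \<zeta>"
  assumes D: "det2 v w \<noteq> 0" and m: "(m1, m2) \<noteq> (0, 0)" and A: "A \<noteq> 0"
    and E: "hform A v w = 0" "hform B v w = 0"
    and t: "m1 * hform A (start_dir i) w + m2 * hform A v (end_dir j) = 0"
      "m1 * hform B (start_dir i) w + m2 * hform B v (end_dir j) = 0"
  shows "\<exists>c. B = c *\<^sub>R A"
proof -
  define s where "s = (if i then -1 else 1 :: complex)"
  define s' where "s' = (if j then 1 else -1 :: complex)"
  have s: "s \<noteq> 0" "s' \<noteq> 0" by (auto simp: s_def s'_def)
  \<comment> \<open>tangency, expressed by the two diagonal values of the form\<close>
  have rel: "m1 * cnj (det2 v w) * s * of_real (hquad C w) + m2 * det2 v w * s' * of_real (hquad C v) = 0"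
    if "hform C v w = 0" "m1 * hform C (start_dir i) w + m2 * hform C v (end_dir j) = 0" for C
  proof -
    note g = incidence_gradient[OF that(1)[unfolded v_def w_def], folded v_def w_def, folded s_def s'_def]
    have "m1 * cnj (det2 v w) * s * of_real (hquad C w) + m2 * det2 v w * s' * of_real (hquad C v)
       = m1 * cnj (det2 v w) * (s * of_real (hquad C w)) + m2 * det2 v w * (s' * of_real (hquad C v))" by (simp only: mult.assoc)
    also have "\<dots> = det2 v w * cnj (det2 v w) * (m1 * hform C (start_dir i) w + m2 * hform C v (end_dir j))"
      unfolding g[symmetric] by (simp add: algebra_simps)
    finally show ?thesis using that(2) by simp
  qed
  have comb: "hform (c *\<^sub>R A + d *\<^sub>R B) v w = 0"
    "m1 * hform (c *\<^sub>R A + d *\<^sub>R B) (start_dir i) w + m2 * hform (c *\<^sub>R A + d *\<^sub>R B) v (end_dir j) = 0" for c d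
  proof -
    show "hform (c *\<^sub>R A + d *\<^sub>R B) v w = 0" using E by (simp add: hform_linear)
    have "m1 * hform (c *\<^sub>R A + d *\<^sub>R B) (start_dir i) w + m2 * hform (c *\<^sub>R A + d *\<^sub>R B) v (end_dir j)
      = of_real c * (m1 * hform A (start_dir i) w + m2 * hform A v (end_dir j)) + of_real d * (m1 * hform B (start_dir i) w + m2 * hform B v (end_dir j))"
      unfolding hform_linear by (simp add: algebra_simps)
    then show "m1 * hform (c *\<^sub>R A + d *\<^sub>R B) (start_dir i) w + m2 * hform (c *\<^sub>R A + d *\<^sub>R B) v (end_dir j) = 0"
      unfolding t by simp
  qed
  have fin: "\<exists>c. B = c *\<^sub>R A" if x: "hquad A x \<noteq> 0" and 0: "(- hquad B x) *\<^sub>R A + hquad A x *\<^sub>R B = 0" for x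
  proof -
    have "hquad A x *\<^sub>R B = hquad B x *\<^sub>R A" using 0 by (simp add: add_eq_0_iff)
    then have "(1 / hquad A x) *\<^sub>R (hquad A x *\<^sub>R B) = (1 / hquad A x) *\<^sub>R (hquad B x *\<^sub>R A)" by simp
    then show ?thesis using x by auto
  qed
  show ?thesis
  proof (cases "m1 = 0")
    case False
    have z: "C = 0" if "hform C v w = 0" "m1 * hform C (start_dir i) w + m2 * hform C v (end_dir j) = 0" "hquad C v = 0" for C
    proof -
      have "hquad C w = 0" using rel[OF that(1,2)] that(3) False s D by simp
      then show ?thesis using herm_eq_0[OF D] that by blast
    qed
    show ?thesis
    proof (rule fin)
      show "hquad A v \<noteq> 0" using z[OF E(1) t(1)] A by blast
      show "(- hquad B v) *\<^sub>R A + hquad A v *\<^sub>R B = 0" by (rule z[OF comb], unfold hquad_linear) simp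
    qed
  next
    case True
    have z: "C = 0" if "hform C v w = 0" "m1 * hform C (start_dir i) w + m2 * hform C v (end_dir j) = 0" "hquad C w = 0" for C
    proof -
      have "hquad C v = 0" using rel[OF that(1,2)] that(3) True m s D by simp
      then show ?thesis using herm_eq_0[OF D] that by blast
    qed
    show ?thesis
    proof (rule fin)
      show "hquad A w \<noteq> 0" using z[OF E(1) t(1)] A by blast
      show "(- hquad B w) *\<^sub>R A + hquad A w *\<^sub>R B = 0" by (rule z[OF comb], unfold hquad_linear) simp
    qed
  qed
qed

text \<open>The tangent plane is the complex line annihilated by the gradient, and it is Lagrangian because the slope
  of this line is real.\<close>

lemma alpha_plane_of_incidence:
  fixes i j :: bool and z \<zeta> :: complex and L :: "complex \<Rightarrow> complex \<times> complex"
  defines "v \<equiv> start_lift i z" and "w \<equiv> end_lift j \<zeta>"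
  assumes D: "det2 v w \<noteq> 0" and A: "A \<noteq> 0" and E: "hform A v w = 0"
    and L: "linear L" "inj L"
    and t: "\<And>x. fst (L x) * hform A (start_dir i) w + snd (L x) * hform A v (end_dir j) = 0"
  shows "alpha_plane i j (z, \<zeta>) (range L)"
proof -
  define P where "P = hform A (start_dir i) w"
  define Q where "Q = hform A v (end_dir j)"
  have PQ: "P \<noteq> 0 \<or> Q \<noteq> 0" using incidence_gradient_nonzero[of i z j \<zeta> A] D A E by (auto simp: P_def Q_def v_def w_def)
  define K where "K = (\<lambda>k. (k * Q, - k * P))"
  have linK: "linear K" by (rule linearI) (simp_all add: K_def algebra_simps)
  have injK: "inj K" using PQ by (auto simp: K_def inj_def)
  have dimr: "dim (range f) = 2" if "linear f" "inj f" for f :: "complex \<Rightarrow> complex \<times> complex"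
    using dim_image_eq[of f UNIV] that by (simp add: inj_on_subset[OF that(2)])
  have sub: "range L \<subseteq> range K"
  proof (rule image_subsetI)
    fix x
    have tx: "fst (L x) * P + snd (L x) * Q = 0" using t[of x] by (simp add: P_def Q_def)
    show "L x \<in> range K"
    proof (cases "Q = 0")
      case False
      then have "L x = K (fst (L x) / Q)" using tx by (simp add: K_def prod_eq_iff field_simps add_eq_0_iff)
      then show ?thesis by (metis rangeI)
    next
      case True
      then have "L x = K (- snd (L x) / P)" using tx PQ by (simp add: K_def prod_eq_iff)
      then show ?thesis by (metis rangeI)
    qed
  qed
  have eq: "range L = range K"
    using subspace_dim_equal[OF _ _ sub] linear_subspace_image[OF L(1), of UNIV] linear_subspace_image[OF linK, of UNIV]
      dimr[OF L] dimr[OF linK injK] by simp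
  have JK: "JJ (K k) = K (\<i> * k)" for k by (simp add: JJ_def K_def)
  have JJK: "JJ ` range K = range K"
  proof
    show "JJ ` range K \<subseteq> range K" using JK by auto
    have "K k = JJ (K (- \<i> * k))" for k unfolding JK by (simp add: mult.assoc[symmetric])
    then show "range K \<subseteq> JJ ` range K" by (metis image_subsetI rangeI image_eqI)
  qed
  define s where "s = (if i then -1 else 1 :: real)"
  define s' where "s' = (if j then 1 else -1 :: real)"
  define \<sigma> where "\<sigma> = (if i = j then 1 else -1 :: real)"
  have g: "det2 v w * P = of_real (s * hquad A w)" "cnj (det2 v w) * Q = of_real (s' * hquad A v)"
    using incidence_gradient[OF E[unfolded v_def w_def], folded v_def w_def] by (simp_all add: P_def Q_def s_def s'_def)
  define d where "d = det2 v w"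
  have d: "d \<noteq> 0" using D by (simp add: d_def)
  have c: "omega_coeff i j (z, \<zeta>) * Q * cnj P = of_real (\<sigma> * (s' * hquad A v) * (s * hquad A w) / (cmod d ^ 2)\<^sup>2)"
  proof -
    have "cnj d * cnj P = of_real (s * hquad A w)" using g(1)[THEN arg_cong[where f = cnj]] by (simp add: d_def)
    moreover have "omega_coeff i j (z, \<zeta>) = of_real \<sigma> / d\<^sup>2" unfolding omega_coeff_eq_det2 d_def v_def w_def by (simp add: \<sigma>_def)
    ultimately have "omega_coeff i j (z, \<zeta>) * Q * cnj P * (d * cnj d)\<^sup>2 = of_real \<sigma> * of_real (s' * hquad A v) * of_real (s * hquad A w)"
      using d g(2)[folded d_def] by (simp add: power_mult_distrib power2_eq_square algebra_simps)
        (metis (no_types, opaque_lifting) mult.assoc mult.commute)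
    moreover have "d * cnj d = of_real ((cmod d)\<^sup>2)" by (rule complex_norm_square[symmetric])
    moreover have "complex_of_real ((cmod d)\<^sup>2) \<noteq> 0" using d by simp
    ultimately show ?thesis by (simp add: field_simps)
  qed
  have Om: "Omega i j (z, \<zeta>) (K k) (K l) = 0" for k l
  proof -
    define r where "r = \<sigma> * (s' * hquad A v) * (s * hquad A w) / (cmod d ^ 2)\<^sup>2"
    define cc where "cc = omega_coeff i j (z, \<zeta>)"
    have 1: "cc * (fst (K k) * cnj (snd (K l)) - fst (K l) * cnj (snd (K k))) = (cc * Q * cnj P) * (l * cnj k - k * cnj l)"
      by (simp add: K_def algebra_simps)
    have 2: "cnj cc * (cnj (fst (K k)) * snd (K l) - cnj (fst (K l)) * snd (K k)) = cnj (cc * (fst (K k) * cnj (snd (K l)) - fst (K l) * cnj (snd (K k))))"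
      by simp
    have "Re ((cc * Q * cnj P) * (l * cnj k - k * cnj l)) = 0"
      unfolding cc_def c by (simp add: algebra_simps)
    then show ?thesis unfolding Omega_def cc_def[symmetric] 2 unfolding 1 plus_complex.sel cnj.sel by auto
  qed
  show ?thesis
    unfolding alpha_plane_def eq totally_null_def lagrangian_def GG_def
    using Om JK JJK dimr[OF linK injK] linear_subspace_image[OF linK, of UNIV] by auto
qed

text \<open>An incidence curve is locally a graph over one coordinate, because its equation is affine in the other one.
  An immersed surface inside it projects to that coordinate with invertible differential, so it covers
  a neighbourhood by the open mapping property, and the equation yields the other coordinate.\<close>

lemma incidence_curve_locally_surjective:
  fixes F :: "complex \<Rightarrow> complex \<times> complex"
  assumes U: "open U" "u0 \<in> U"
    and dF: "\<And>u. u \<in> U \<Longrightarrow> (F has_derivative L u) (at u)"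
    and inj: "inj (L u0)" and A: "A \<noteq> 0"
    and E: "\<And>u. u \<in> U \<Longrightarrow> hform A (start_lift i (fst (F u))) (end_lift j (snd (F u))) = 0"
    and D: "det2 (start_lift i (fst (F u0))) (end_lift j (snd (F u0))) \<noteq> 0"
  shows "\<exists>e>0. \<forall>z \<zeta>. dist z (fst (F u0)) < e \<longrightarrow> dist \<zeta> (snd (F u0)) < e \<longrightarrow>
    hform A (start_lift i z) (end_lift j \<zeta>) = 0 \<longrightarrow> (\<exists>u\<in>U. F u = (z, \<zeta>))"
proof -
  have cF: "continuous_on U F"
    using dF by (meson continuous_at_imp_continuous_on has_derivative_continuous)
  have lin: "linear (L u0)" using dF[OF U(2)] has_derivative_bounded_linear bounded_linear.linear by blast
  have tan: "fst (L u0 x) * hform A (start_dir i) (end_lift j (snd (F u0))) + snd (L u0 x) * hform A (start_lift i (fst (F u0))) (end_dir j) = 0" for x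
    by (rule has_derivative_zero_on_open[OF U E hform_lifts_has_derivative[OF dF[OF U(2)]]])
  have opn: "\<exists>e>0. ball (f (F u0)) e \<subseteq> (\<lambda>u. f (F u)) ` U"
    if f: "bounded_linear f" and fin: "\<And>x. f (L u0 x) = 0 \<Longrightarrow> x = 0" for f :: "complex \<times> complex \<Rightarrow> complex"
  proof -
    have lf: "linear (\<lambda>x. f (L u0 x))"
      using linear_compose[OF lin bounded_linear.linear[OF f]] by (simp add: o_def)
    have "inj (\<lambda>x. f (L u0 x))" using fin linear_injective_0[OF lf] by blast
    then obtain g where g: "linear g" "(\<lambda>x. f (L u0 x)) \<circ> g = id"
      using linear_injective_isomorphism[OF lf] by (auto simp: fun_eq_iff)
    have "f (F u0) \<in> interior ((\<lambda>u. f (F u)) ` U)"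
    proof (rule sussmann_open_mapping[where f' = "\<lambda>x. f (L u0 x)" and g' = g and S = U and T = U])
      show "continuous_on U (\<lambda>u. f (F u))" by (intro bounded_linear.continuous_on[OF f] cF)
      show "((\<lambda>u. f (F u)) has_derivative (\<lambda>x. f (L u0 x))) (at u0)"
        by (rule bounded_linear.has_derivative[OF f dF[OF U(2)]])
      show "u0 \<in> interior U" using U by (simp add: interior_open)
    qed (use U g in \<open>auto simp: linear_conv_bounded_linear\<close>)
    then show ?thesis by (meson mem_interior)
  qed
  have cont0: "\<exists>e>0. \<forall>y. dist y x < e \<longrightarrow> f y \<noteq> 0" if "continuous_on UNIV f" "f x \<noteq> 0" for f :: "complex \<Rightarrow> complex" and x
    using continuous_on_open_avoid[OF that(1) open_UNIV _ that(2)] by (simp add: dist_commute)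
  consider "hform A (start_lift i (fst (F u0))) (end_dir j) \<noteq> 0" | "hform A (start_dir i) (end_lift j (snd (F u0))) \<noteq> 0"
    using incidence_gradient_nonzero[OF D A E[OF U(2)]] by blast
  then show ?thesis
  proof cases
    case 1
    have "x = 0" if "fst (L u0 x) = 0" for x
    proof -
      have "L u0 x = L u0 0" using tan[of x] that 1 by (simp add: linear_0[OF lin] prod_eq_iff)
      then show ?thesis using inj by (simp add: inj_eq)
    qed
    from opn[OF bounded_linear_fst this] obtain e1 where e1: "e1 > 0" "ball (fst (F u0)) e1 \<subseteq> (\<lambda>u. fst (F u)) ` U" by blast
    have "continuous_on UNIV (\<lambda>z. hform A (start_lift i z) (end_dir j))"
      by (cases A; cases i) (auto simp: hform_def start_lift_def intro!: continuous_intros)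
    from cont0[OF this 1] obtain e2 where e2: "e2 > 0" "\<And>z. dist z (fst (F u0)) < e2 \<Longrightarrow> hform A (start_lift i z) (end_dir j) \<noteq> 0" by blast
    show ?thesis
    proof (intro exI[of _ "min e1 e2"] conjI allI impI)
      fix z \<zeta> assume z: "dist z (fst (F u0)) < min e1 e2" and 0: "hform A (start_lift i z) (end_lift j \<zeta>) = 0"
      obtain u where u: "u \<in> U" "fst (F u) = z" using e1(2) z by (force simp: dist_commute)
      have "(\<zeta> - snd (F u)) * hform A (start_lift i z) (end_dir j) = 0"
        unfolding hform_end_diff[symmetric] using 0 E[OF u(1)] u(2) by simp
      then have "\<zeta> = snd (F u)" using e2(2)[of z] z by simp
      then show "\<exists>u\<in>U. F u = (z, \<zeta>)" using u by (intro bexI[of _ u]) (auto simp: prod_eq_iff)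
    qed (use e1 e2 in auto)
  next
    case 2
    have "x = 0" if "snd (L u0 x) = 0" for x
    proof -
      have "L u0 x = L u0 0" using tan[of x] that 2 by (simp add: linear_0[OF lin] prod_eq_iff)
      then show ?thesis using inj by (simp add: inj_eq)
    qed
    from opn[OF bounded_linear_snd this] obtain e1 where e1: "e1 > 0" "ball (snd (F u0)) e1 \<subseteq> (\<lambda>u. snd (F u)) ` U" by blast
    have "continuous_on UNIV (\<lambda>z. hform A (start_dir i) (end_lift j z))"
      by (cases A; cases j) (auto simp: hform_def end_lift_def intro!: continuous_intros)
    from cont0[OF this 2] obtain e2 where e2: "e2 > 0" "\<And>z. dist z (snd (F u0)) < e2 \<Longrightarrow> hform A (start_dir i) (end_lift j z) \<noteq> 0" by blast
    show ?thesis
    proof (intro exI[of _ "min e1 e2"] conjI allI impI)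
      fix z \<zeta> assume z: "dist \<zeta> (snd (F u0)) < min e1 e2" and 0: "hform A (start_lift i z) (end_lift j \<zeta>) = 0"
      obtain u where u: "u \<in> U" "snd (F u) = \<zeta>" using e1(2) z by (force simp: dist_commute)
      have "(z - fst (F u)) * hform A (start_dir i) (end_lift j \<zeta>) = 0"
        unfolding hform_start_diff[symmetric] using 0 E[OF u(1)] u(2) by simp
      then have "z = fst (F u)" using e2(2)[of \<zeta>] z by simp
      then show "\<exists>u\<in>U. F u = (z, \<zeta>)" using u by (intro bexI[of _ u]) (auto simp: prod_eq_iff)
    qed (use e1 e2 in auto)
  qed
qed

section \<open>Calculus of smooth maps\<close>

lemma times_differentiable_on_cong:
  assumes "open U" "\<And>u. u \<in> U \<Longrightarrow> F u = G u" "times_differentiable_on k F U"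
  shows "times_differentiable_on k G U"
  using assms(2,3)
proof (induction k arbitrary: F G)
  case 0
  then show ?case using continuous_on_cong by (metis times_differentiable_on.simps(1))
next
  case (Suc k)
  have d: "(G has_derivative frechet_derivative F (at u)) (at u)" if "u \<in> U" for u
    using Suc.prems that has_derivative_transform_within_open[OF _ assms(1) that, of F "frechet_derivative F (at u)" UNIV G]
    by (simp add: frechet_derivative_works)
  then have eq: "frechet_derivative F (at u) = frechet_derivative G (at u)" if "u \<in> U" for u
    using frechet_derivative_at that by blast
  have "times_differentiable_on k (\<lambda>u. frechet_derivative G (at u) v) U" for v
  proof (rule Suc.IH)
    show "frechet_derivative F (at u) v = frechet_derivative G (at u) v" if "u \<in> U" for u by (simp only: eq[OF that])
    show "times_differentiable_on k (\<lambda>u. frechet_derivative F (at u) v) U" using Suc.prems(2) by simp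
  qed
  then show ?case using d by (auto simp: differentiable_def)
qed

lemma times_differentiable_on_SucI:
  assumes "open U" "\<And>u. u \<in> U \<Longrightarrow> (F has_derivative D u) (at u)" "\<And>v. times_differentiable_on k (\<lambda>u. D u v) U"
  shows "times_differentiable_on (Suc k) F U"
proof -
  have "D u = frechet_derivative F (at u)" if "u \<in> U" for u using frechet_derivative_at assms(2) that by blast
  then have "times_differentiable_on k (\<lambda>u. frechet_derivative F (at u) v) U" for v
    by (intro times_differentiable_on_cong[OF assms(1) _ assms(3)[of v]]) simp
  then show ?thesis using assms(2) by (auto simp: differentiable_def)
qed

lemma times_differentiable_on_SucD:
  assumes "times_differentiable_on (Suc k) F U"
  shows "u \<in> U \<Longrightarrow> (F has_derivative frechet_derivative F (at u)) (at u)"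
    and "times_differentiable_on k (\<lambda>u. frechet_derivative F (at u) v) U"
  using assms by (auto simp: frechet_derivative_works)

lemma times_differentiable_on_Suc_imp:
  "times_differentiable_on (Suc k) F U \<Longrightarrow> times_differentiable_on k F U"
proof (induction k arbitrary: F)
  case 0
  then show ?case
    by (auto intro!: differentiable_imp_continuous_on differentiable_at_imp_differentiable_on)
next
  case (Suc k)
  have 1: "\<forall>u\<in>U. F differentiable (at u)"
    and 2: "\<And>v. times_differentiable_on (Suc k) (\<lambda>u. frechet_derivative F (at u) v) U"
    using Suc.prems times_differentiable_on.simps(2)[of "Suc k" F U] by blast+
  show ?case unfolding times_differentiable_on.simps(2)[of k] using 1 Suc.IH[OF 2] by blast
qed

lemma times_differentiable_on_const: "open U \<Longrightarrow> times_differentiable_on k (\<lambda>_. c) U"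
proof (induction k arbitrary: c)
  case (Suc k)
  show ?case by (rule times_differentiable_on_SucI[OF Suc.prems, where D = "\<lambda>_ _. 0"]) (auto intro: Suc)
qed simp

lemma times_differentiable_on_linear:
  assumes "open U" "bounded_linear l"
  shows "times_differentiable_on k l U"
proof (cases k)
  case (Suc k)
  show ?thesis unfolding Suc
    by (rule times_differentiable_on_SucI[OF assms(1), where D = "\<lambda>_. l"])
      (auto intro: times_differentiable_on_const assms bounded_linear_imp_has_derivative)
qed (use assms in \<open>simp add: linear_continuous_on\<close>)

lemma times_differentiable_on_add:
  assumes "open U" "times_differentiable_on k F U" "times_differentiable_on k G U"
  shows "times_differentiable_on k (\<lambda>u. F u + G u) U"
  using assms(2,3)
proof (induction k arbitrary: F G)
  case (Suc k)
  note dF = times_differentiable_on_SucD[OF Suc.prems(1)] and dG = times_differentiable_on_SucD[OF Suc.prems(2)]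
  show ?case
    by (rule times_differentiable_on_SucI[OF assms(1), where D = "\<lambda>u x. frechet_derivative F (at u) x + frechet_derivative G (at u) x"])
      (intro has_derivative_add Suc.IH dF dG; assumption)+
qed (auto intro: continuous_on_add)

lemma times_differentiable_on_scaleR:
  fixes f :: "complex \<Rightarrow> real"
  assumes "open U" "times_differentiable_on k f U" "times_differentiable_on k G U"
  shows "times_differentiable_on k (\<lambda>u. f u *\<^sub>R G u) U"
  using assms(2,3)
proof (induction k arbitrary: f G)
  case (Suc k)
  note df = times_differentiable_on_SucD[OF Suc.prems(1)] and dG = times_differentiable_on_SucD[OF Suc.prems(2)]
  show ?case
  proof (rule times_differentiable_on_SucI[OF assms(1), where D = "\<lambda>u x. f u *\<^sub>R frechet_derivative G (at u) x + frechet_derivative f (at u) x *\<^sub>R G u"])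
    show "((\<lambda>u. f u *\<^sub>R G u) has_derivative (\<lambda>x. f u *\<^sub>R frechet_derivative G (at u) x + frechet_derivative f (at u) x *\<^sub>R G u)) (at u)" if "u \<in> U" for u
      by (intro has_derivative_scaleR df dG that)
    show "times_differentiable_on k (\<lambda>u. f u *\<^sub>R frechet_derivative G (at u) v + frechet_derivative f (at u) v *\<^sub>R G u) U" for v
      by (intro times_differentiable_on_add[OF assms(1)] Suc.IH df(2) dG(2) Suc.prems[THEN times_differentiable_on_Suc_imp])
  qed
qed (auto intro: continuous_on_scaleR)

lemma times_differentiable_on_inverse:
  fixes f :: "complex \<Rightarrow> real"
  assumes "open U" "times_differentiable_on k f U" "\<And>u. u \<in> U \<Longrightarrow> f u \<noteq> 0"
  shows "times_differentiable_on k (\<lambda>u. inverse (f u)) U"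
  using assms(2)
proof (induction k)
  case (Suc k)
  note df = times_differentiable_on_SucD[OF Suc.prems(1)]
  have inv: "times_differentiable_on k (\<lambda>u. inverse (f u)) U" using Suc times_differentiable_on_Suc_imp by blast
  show ?case
  proof (rule times_differentiable_on_SucI[OF assms(1), where D = "\<lambda>u x. - (inverse (f u) * frechet_derivative f (at u) x * inverse (f u))"])
    show "((\<lambda>u. inverse (f u)) has_derivative (\<lambda>x. - (inverse (f u) * frechet_derivative f (at u) x * inverse (f u)))) (at u)" if "u \<in> U" for u
      by (intro Deriv.has_derivative_inverse df assms that)
    have "times_differentiable_on k (\<lambda>u. (-1) *\<^sub>R (inverse (f u) *\<^sub>R frechet_derivative f (at u) v) *\<^sub>R inverse (f u)) U" for v
      by (intro times_differentiable_on_scaleR[OF assms(1)] inv times_differentiable_on_const assms df(2))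
    then show "times_differentiable_on k (\<lambda>u. - (inverse (f u) * frechet_derivative f (at u) v * inverse (f u))) U" for v by simp
  qed
qed (use assms in \<open>auto intro!: continuous_on_inverse\<close>)

section \<open>Level surfaces of Hermitian forms\<close>

text \<open>The inverse of stereographic projection from the point opposite to \<open>p\<close>, for the sphere with unit normal \<open>e\<close> at
  \<open>p\<close> and equation \<open>e \<bullet> x = s (x \<bullet> x)\<close>, \<open>x = q - p\<close>. Its rational form also covers planes, with \<open>s = 0\<close>,
  and reduces smoothness to that of sums, products and inverses.\<close>

definition stereo :: "half_space \<Rightarrow> half_space \<Rightarrow> real \<Rightarrow> (complex \<Rightarrow> half_space) \<Rightarrow> complex \<Rightarrow> half_space" where
  "stereo p e s \<iota> u = p + inverse (1 + s\<^sup>2 * (u \<bullet> u)) *\<^sub>R (\<iota> u + (s * (u \<bullet> u)) *\<^sub>R e)"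

lemma stereo_denominator_pos: "1 + s\<^sup>2 * (u \<bullet> u) > (0::real)"
  by (simp add: add_pos_nonneg)

lemma smooth_stereo:
  assumes "open U" "linear \<iota>"
  shows "times_differentiable_on k (stereo p e s \<iota>) U"
proof -
  have bl: "bounded_linear \<iota>" using assms(2) by (simp add: linear_conv_bounded_linear)
  note add = times_differentiable_on_add[OF assms(1)] and scale = times_differentiable_on_scaleR[OF assms(1)]
    and const = times_differentiable_on_const[OF assms(1)] and lin = times_differentiable_on_linear[OF assms(1)]
  have sq: "times_differentiable_on k (\<lambda>u. Re u *\<^sub>R Re u + Im u *\<^sub>R Im u) U"
    by (rule add[OF scale[OF lin lin] scale[OF lin lin]]) (rule bounded_linear_Re bounded_linear_Im)+
  have "times_differentiable_on k (\<lambda>u. inverse (1 + s\<^sup>2 *\<^sub>R (Re u *\<^sub>R Re u + Im u *\<^sub>R Im u))) U"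
  proof (rule times_differentiable_on_inverse[OF assms(1) add[OF const scale[OF const sq]]])
    show "1 + s\<^sup>2 *\<^sub>R (Re u *\<^sub>R Re u + Im u *\<^sub>R Im u) \<noteq> 0" for u
      using stereo_denominator_pos[of s u] by (simp add: inner_complex_def)
  qed
  then have "times_differentiable_on k (\<lambda>u. p + inverse (1 + s\<^sup>2 *\<^sub>R (Re u *\<^sub>R Re u + Im u *\<^sub>R Im u)) *\<^sub>R (\<iota> u + (s *\<^sub>R (Re u *\<^sub>R Re u + Im u *\<^sub>R Im u)) *\<^sub>R e)) U"
    by (rule add[OF const scale[OF _ add[OF lin[OF bl] scale[OF scale[OF const sq] const]]]])
  moreover have "(\<lambda>u. p + inverse (1 + s\<^sup>2 *\<^sub>R (Re u *\<^sub>R Re u + Im u *\<^sub>R Im u)) *\<^sub>R (\<iota> u + (s *\<^sub>R (Re u *\<^sub>R Re u + Im u *\<^sub>R Im u)) *\<^sub>R e)) = stereo p e s \<iota>"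
    by (rule ext) (simp add: stereo_def inner_complex_def)
  ultimately show ?thesis by (simp only:)
qed

lemma ex_plane_isometry:
  fixes e :: half_space
  assumes "norm e = 1"
  shows "\<exists>(\<iota> :: complex \<Rightarrow> half_space) \<pi>. linear \<iota> \<and> linear \<pi> \<and> (\<forall>u. e \<bullet> \<iota> u = 0) \<and> (\<forall>u. \<iota> u \<bullet> \<iota> u = u \<bullet> u) \<and> (\<forall>u. \<pi> (\<iota> u) = u) \<and> \<pi> e = 0
     \<and> (\<forall>x. \<iota> (\<pi> x) = x - (e \<bullet> x) *\<^sub>R e)"
proof -
  define T where "T = {x. e \<bullet> x = 0}"
  have e: "e \<noteq> 0" "e \<bullet> e = 1" using assms by (auto simp: norm_eq_1)
  have T: "subspace T" "dim T = 2" unfolding T_def using dim_hyperplane[OF e(1)] by (simp_all add: subspace_hyperplane)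
  obtain f g where f: "linear f" "linear g" "f ` (UNIV :: complex set) = T" "g ` T = UNIV"
    "\<And>x. x \<in> (UNIV :: complex set) \<Longrightarrow> norm (f x) = norm x" "\<And>x. x \<in> T \<Longrightarrow> norm (g x) = norm x"
    "\<And>x. x \<in> UNIV \<Longrightarrow> g (f x) = x" "\<And>x. x \<in> T \<Longrightarrow> f (g x) = x"
    using isometries_subspaces[OF subspace_UNIV T(1)] T(2) by (metis DIM_complex dim_UNIV)
  define \<pi> where "\<pi> = (\<lambda>x. g (x - (e \<bullet> x) *\<^sub>R e))"
  have lin: "linear \<pi>"
  proof (rule linearI)
    show "\<pi> (x + y) = \<pi> x + \<pi> y" for x y
      unfolding \<pi>_def linear_add[OF f(2), symmetric] by (simp add: inner_add_right algebra_simps)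
    show "\<pi> (c *\<^sub>R x) = c *\<^sub>R \<pi> x" for c x
      unfolding \<pi>_def linear_scale[OF f(2), symmetric] by (simp add: scaleR_diff_right)
  qed
  have ef: "e \<bullet> f u = 0" for u using f(3) by (auto simp: T_def)
  have "\<pi> (f u) = u" for u using f(7) by (simp add: \<pi>_def ef)
  moreover have "\<pi> e = 0" by (simp add: \<pi>_def e linear_0[OF f(2)])
  moreover have "f (\<pi> x) = x - (e \<bullet> x) *\<^sub>R e" for x
    unfolding \<pi>_def by (rule f(8)) (simp add: T_def inner_diff_right e)
  moreover have "f u \<bullet> f u = u \<bullet> u" for u using f(5)[of u] by (simp add: norm_eq)
  ultimately show ?thesis using f(1) lin ef by blast
qed

definition quadric :: "herm \<Rightarrow> real \<Rightarrow> half_space set" where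
  "quadric A c = {p \<in> H3. Phi A p = c}"

text \<open>The equation of a level surface is quadratic with leading part a multiple of the Euclidean norm, so its
  Taylor expansion at a point ends with that term: level surfaces are parts of Euclidean spheres and planes.\<close>

lemma quadric_expansion:
  assumes p: "p \<in> quadric A c" and x: "p + x \<in> H3"
  shows "p + x \<in> quadric A c \<longleftrightarrow> fst p * (hgrad A p \<bullet> x) + fst A * (x \<bullet> x) = 0"
proof -
  obtain a d b where A: "A = (a, d, b)" by (cases A)
  have t: "fst p > 0" "fst (p + x) > 0" using p x by (auto simp: quadric_def H3_def)
  have P: "Phi A q = c \<longleftrightarrow> a * (q \<bullet> q) + 2 * Re (b * snd q) + d - c * fst q = 0" if "fst q > 0" for q
    using that by (auto simp: Phi_def A field_simps)
  have 0: "a * (p \<bullet> p) + 2 * Re (b * snd p) + d - c * fst p = 0" "Phi A p = c" using p P[OF t(1)] by (auto simp: quadric_def)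
  have "hgrad A p \<bullet> x = (1 / fst p) * (2 * a * (p \<bullet> x) + 2 * Re (b * snd x)) - (c / fst p) * fst x"
    unfolding hgrad_def A prod.case 0(2)[unfolded A] inner_diff_left inner_add_left inner_scaleR_left
    by (cases x) (simp add: inner_complex_def)
  moreover have "fst p * ((1 / fst p) * X - (c / fst p) * y) = X - c * y" for X y
    using t(1) by (simp add: right_diff_distrib)
  ultimately have "fst p * (hgrad A p \<bullet> x) = 2 * a * (p \<bullet> x) + 2 * Re (b * snd x) - c * fst x"
    by (simp only:)
  then have "a * ((p + x) \<bullet> (p + x)) + 2 * Re (b * snd (p + x)) + d - c * fst (p + x) = fst p * (hgrad A p \<bullet> x) + a * (x \<bullet> x)"
    using 0(1) by (simp add: inner_add_left inner_add_right inner_commute algebra_simps)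
  then show ?thesis using P[OF t(2)] x by (simp add: quadric_def A)
qed

text \<open>The unit normal field of the level surface \<open>Phi A = c\<close>; its normalisation comes from \<open>norm_hgrad\<close>.\<close>

definition unit_grad :: "herm \<Rightarrow> real \<Rightarrow> half_space \<Rightarrow> half_space" where
  "unit_grad A c p = ((fst p)\<^sup>2 / sqrt (c\<^sup>2 - 4 * hdet A)) *\<^sub>R hgrad A p"

lemma stereo_inverse:
  fixes p e q :: half_space and s :: real and \<iota> :: "complex \<Rightarrow> half_space"
  assumes \<iota>: "linear \<iota>" "linear \<pi>" "\<And>u. e \<bullet> \<iota> u = 0" "\<And>u. \<iota> u \<bullet> \<iota> u = u \<bullet> u" "\<And>u. \<pi> (\<iota> u) = u" "\<pi> e = 0"
    "\<And>x. \<iota> (\<pi> x) = x - (e \<bullet> x) *\<^sub>R e" and e: "norm e = 1"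
  defines "\<kappa> \<equiv> \<lambda>q. inverse (1 - s * (e \<bullet> (q - p))) *\<^sub>R \<pi> (q - p)"
  shows stereo_left_inverse: "\<kappa> (stereo p e s \<iota> u) = u" "s * (e \<bullet> (stereo p e s \<iota> u - p)) \<noteq> 1"
    and stereo_equation: "e \<bullet> (stereo p e s \<iota> u - p) = s * ((stereo p e s \<iota> u - p) \<bullet> (stereo p e s \<iota> u - p))"
    and stereo_right_inverse: "e \<bullet> (q - p) = s * ((q - p) \<bullet> (q - p)) \<Longrightarrow> s * (e \<bullet> (q - p)) \<noteq> 1 \<Longrightarrow> stereo p e s \<iota> (\<kappa> q) = q"
proof -
  define n where "n = u \<bullet> u"
  define N where "N = 1 + s\<^sup>2 * n"
  have N: "N > 0" using stereo_denominator_pos[of s u] by (simp add: N_def n_def)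
  have ee: "e \<bullet> e = 1" using e by (simp add: norm_eq_1)
  have x: "stereo p e s \<iota> u - p = inverse N *\<^sub>R (\<iota> u + (s * n) *\<^sub>R e)" by (simp add: stereo_def N_def n_def)
  have ex: "e \<bullet> (stereo p e s \<iota> u - p) = s * n / N" unfolding x by (simp add: inner_add_right \<iota>(3) ee divide_inverse)
  have den: "1 - s * (s * n / N) = inverse N" using N by (simp add: N_def field_simps power2_eq_square)
  have "\<pi> (stereo p e s \<iota> u - p) = inverse N *\<^sub>R u"
    unfolding x by (simp add: linear_add[OF \<iota>(2)] linear_scale[OF \<iota>(2)] \<iota>(5,6))
  then show "\<kappa> (stereo p e s \<iota> u) = u" using N unfolding \<kappa>_def ex den by simp
  show "s * (e \<bullet> (stereo p e s \<iota> u - p)) \<noteq> 1"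
  proof
    assume "s * (e \<bullet> (stereo p e s \<iota> u - p)) = 1"
    then have "inverse N = 0" using den unfolding ex by linarith
    then show False using N by simp
  qed
  have ie: "\<iota> w \<bullet> e = 0" for w using \<iota>(3)[of w] by (metis inner_commute)
  have "(\<iota> u + (s * n) *\<^sub>R e) \<bullet> (\<iota> u + (s * n) *\<^sub>R e) = n + (s * n) * (s * n)"
    by (simp add: inner_add_left inner_add_right \<iota>(3,4) ie ee n_def[symmetric])
  also have "\<dots> = n * N" by (simp add: N_def power2_eq_square algebra_simps)
  finally have key: "(\<iota> u + (s * n) *\<^sub>R e) \<bullet> (\<iota> u + (s * n) *\<^sub>R e) = n * N" .
  show "e \<bullet> (stereo p e s \<iota> u - p) = s * ((stereo p e s \<iota> u - p) \<bullet> (stereo p e s \<iota> u - p))"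
    unfolding ex unfolding x inner_scaleR_left inner_scaleR_right key using N by (simp add: field_simps)
  show "stereo p e s \<iota> (\<kappa> q) = q" if q: "e \<bullet> (q - p) = s * ((q - p) \<bullet> (q - p))" "s * (e \<bullet> (q - p)) \<noteq> 1"
  proof -
    define y where "y = q - p"
    define h where "h = e \<bullet> y"
    define w where "w = \<pi> y"
    have y: "y = \<iota> w + h *\<^sub>R e" using \<iota>(7)[of y] by (simp add: w_def h_def)
    have "(\<iota> w + h *\<^sub>R e) \<bullet> (\<iota> w + h *\<^sub>R e) = w \<bullet> w + h * h"
      by (simp add: inner_add_left inner_add_right \<iota>(3,4) ie ee)
    then have yy: "y \<bullet> y = w \<bullet> w + h * h" unfolding y[symmetric] .
    have eq: "h = s * (w \<bullet> w + h * h)" using q(1) unfolding y_def[symmetric] h_def[symmetric] yy .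
    define k where "k = 1 - s * h"
    have k: "k \<noteq> 0" using q(2) by (simp add: k_def y_def h_def)
    have hk: "s * (w \<bullet> w) = h * k" using eq by (simp add: k_def algebra_simps)
    define v where "v = inverse k *\<^sub>R w"
    have vv: "v \<bullet> v = (w \<bullet> w) / (k * k)" by (simp add: v_def divide_inverse)
    have sv: "s * (v \<bullet> v) = h / k" unfolding vv times_divide_eq_right hk using k by simp
    have "1 + s\<^sup>2 * (v \<bullet> v) = 1 + s * (s * (v \<bullet> v))" by (simp add: power2_eq_square)
    also have "\<dots> = inverse k" unfolding sv using k by (simp add: k_def field_simps)
    finally have nv: "inverse (1 + s\<^sup>2 * (v \<bullet> v)) = k" by simp
    have "stereo p e s \<iota> v = p + k *\<^sub>R (inverse k *\<^sub>R \<iota> w + (h / k) *\<^sub>R e)"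
      unfolding stereo_def nv sv by (simp add: v_def linear_scale[OF \<iota>(1)])
    also have "\<dots> = p + y" using k unfolding y by (simp add: scaleR_add_right)
    finally have "stereo p e s \<iota> v = q" by (simp add: y_def)
    moreover have "\<kappa> q = v" unfolding \<kappa>_def v_def k_def h_def w_def y_def ..
    ultimately show ?thesis by simp
  qed
qed

text \<open>Stereographic projection parametrises all of the sphere except one point, which is not \<open>p\<close>. The condition
  on \<open>c\<close> makes the gradient nonzero, so that the level surface is a sphere or plane and not a point.\<close>

lemma quadric_patch:
  assumes S: "openin (top_of_set (quadric A c)) S" and c: "c\<^sup>2 > 4 * hdet A" and p: "p \<in> S"
  shows "\<exists>U \<phi>. H3_patch S U \<phi> \<and> p \<in> \<phi> ` U"
proof -
  have SQ: "S \<subseteq> quadric A c" using S openin_imp_subset by blast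
  have pQ: "p \<in> quadric A c" "p \<in> H3" "Phi A p = c" using p SQ by (auto simp: quadric_def)
  have t: "fst p > 0" using pQ by (simp add: H3_def)
  define g where "g = fst p * norm (hgrad A p)"
  have "g\<^sup>2 = c\<^sup>2 - 4 * hdet A"
    using norm_hgrad[OF pQ(2), of A] pQ(3) by (simp add: g_def power_mult_distrib power2_norm_eq_inner)
  then have g0: "g \<noteq> 0" using c by auto
  then have h0: "norm (hgrad A p) \<noteq> 0" by (auto simp: g_def)
  have g: "g > 0" using t h0 by (simp add: g_def)
  define e where "e = (1 / norm (hgrad A p)) *\<^sub>R hgrad A p"
  have e: "norm e = 1" using h0 by (simp add: e_def)
  have he: "fst p *\<^sub>R hgrad A p = g *\<^sub>R e" using h0 by (simp add: e_def g_def)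
  \<comment> \<open>half the curvature of the sphere at \<open>p\<close>, towards \<open>e\<close>\<close>
  define s where "s = - fst A / g"
  obtain \<iota> :: "complex \<Rightarrow> half_space" and \<pi> where i: "linear \<iota>" "linear \<pi>" "\<And>u. e \<bullet> \<iota> u = 0" "\<And>u. \<iota> u \<bullet> \<iota> u = u \<bullet> u" "\<And>u. \<pi> (\<iota> u) = u" "\<pi> e = 0"
    "\<And>x. \<iota> (\<pi> x) = x - (e \<bullet> x) *\<^sub>R e"
    using ex_plane_isometry[OF e] by blast
  define \<kappa> where "\<kappa> = (\<lambda>q. inverse (1 - s * (e \<bullet> (q - p))) *\<^sub>R \<pi> (q - p))"
  define \<phi> where "\<phi> = stereo p e s \<iota>"
  have li: "\<kappa> (\<phi> u) = u" "s * (e \<bullet> (\<phi> u - p)) \<noteq> 1" and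
    eqn: "e \<bullet> (\<phi> u - p) = s * ((\<phi> u - p) \<bullet> (\<phi> u - p))" for u
    using stereo_left_inverse[OF i e, where s = s and p = p and u = u] stereo_equation[OF i e, where s = s and p = p and u = u]
    unfolding \<phi>_def \<kappa>_def by auto
  have ri: "\<phi> (\<kappa> q) = q" if "e \<bullet> (q - p) = s * ((q - p) \<bullet> (q - p))" "s * (e \<bullet> (q - p)) \<noteq> 1" for q
    using stereo_right_inverse[OF i e, where s = s and p = p and q = q] that unfolding \<phi>_def \<kappa>_def by blast
  have Qeq: "q \<in> quadric A c \<longleftrightarrow> e \<bullet> (q - p) = s * ((q - p) \<bullet> (q - p))" if "q \<in> H3" for q
  proof -
    have "q \<in> quadric A c \<longleftrightarrow> fst p * (hgrad A p \<bullet> (q - p)) + fst A * ((q - p) \<bullet> (q - p)) = 0"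
      using quadric_expansion[OF pQ(1), of "q - p"] that by simp
    also have "fst p * (hgrad A p \<bullet> (q - p)) = g * (e \<bullet> (q - p))"
      using he by (metis inner_scaleR_left)
    also have "g * (e \<bullet> (q - p)) + fst A * ((q - p) \<bullet> (q - p)) = 0 \<longleftrightarrow> e \<bullet> (q - p) = s * ((q - p) \<bullet> (q - p))"
      using g by (auto simp: s_def field_simps)
    finally show ?thesis .
  qed
  obtain T where T: "open T" "S = quadric A c \<inter> T" using S by (auto simp: openin_open)
  have H3o: "open H3" unfolding H3_def by (intro open_Collect_less continuous_intros)
  have smooth: "times_differentiable_on k \<phi> U" if "open U" for k U
    unfolding \<phi>_def by (rule smooth_stereo[OF that i(1)])
  have c\<phi>: "continuous_on U \<phi>" if "open U" for U using smooth[OF that, of 0] by simp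
  define U where "U = \<phi> -` (H3 \<inter> T)"
  have oU: "open U" unfolding U_def using c\<phi>[OF open_UNIV] H3o T(1) by (metis continuous_open_vimage continuous_on_eq_continuous_at open_Int open_UNIV UNIV_I)
  have \<phi>S: "\<phi> u \<in> S \<longleftrightarrow> u \<in> U" for u
  proof -
    have "\<phi> u \<in> quadric A c \<longleftrightarrow> \<phi> u \<in> H3" using Qeq[of "\<phi> u"] eqn[of u] by (auto simp: quadric_def)
    then show ?thesis by (auto simp: T(2) U_def)
  qed
  have im: "\<phi> ` U = S \<inter> {q. s * (e \<bullet> (q - p)) \<noteq> 1}"
  proof (intro equalityI subsetI)
    fix q assume q: "q \<in> S \<inter> {q. s * (e \<bullet> (q - p)) \<noteq> 1}"
    then have "\<phi> (\<kappa> q) = q" using SQ Qeq[of q] by (intro ri) (auto simp: quadric_def)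
    then show "q \<in> \<phi> ` U" using q \<phi>S by (metis IntD1 imageI)
  qed (use li \<phi>S in auto)
  have lp: "local_param S U \<phi>"
    unfolding local_param_def
  proof (intro conjI exI)
    show "open U" by (rule oU)
    have "open {q. s * (e \<bullet> (q - p)) \<noteq> 1}" by (intro open_Collect_neq continuous_intros)
    then show "openin (top_of_set S) (\<phi> ` U)" unfolding im by (rule openin_open_Int)
    have bl: "bounded_linear \<pi>" using i(2) by (simp add: linear_conv_bounded_linear)
    have "continuous_on (\<phi> ` U) \<kappa>"
      unfolding \<kappa>_def by (intro continuous_intros bounded_linear.continuous_on[OF bl]) (auto simp: im)
    then show "homeomorphism U (\<phi> ` U) \<phi> \<kappa>"
      using c\<phi>[OF oU] li(1) by (auto simp: homeomorphism_def image_image)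
  qed
  have injd: "inj (frechet_derivative \<phi> (at u))" if "u \<in> U" for u
  proof -
    have d\<phi>: "(\<phi> has_derivative frechet_derivative \<phi> (at u)) (at u)"
      using smooth[OF oU, of "Suc 0"] that by (auto simp: frechet_derivative_works)
    have bl: "bounded_linear \<pi>" using i(2) by (simp add: linear_conv_bounded_linear)
    have d1: "((\<lambda>q. \<pi> (q - p)) has_derivative \<pi>) (at (\<phi> u))"
      by (rule bounded_linear.has_derivative[OF bl]) (auto intro!: derivative_eq_intros)
    have d2: "((\<lambda>q. 1 - s * (e \<bullet> (q - p))) has_derivative (\<lambda>x. - (s * (e \<bullet> x)))) (at (\<phi> u))"
      by (auto intro!: derivative_eq_intros)
    have ne: "1 - s * (e \<bullet> (\<phi> u - p)) \<noteq> 0" using li(2)[of u] by simp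
    obtain D where D: "(\<kappa> has_derivative D) (at (\<phi> u))"
      unfolding \<kappa>_def using has_derivative_scaleR[OF Deriv.has_derivative_inverse[OF ne d2] d1] by blast
    have "((\<lambda>u. \<kappa> (\<phi> u)) has_derivative (\<lambda>x. D (frechet_derivative \<phi> (at u) x))) (at u)"
      by (rule has_derivative_compose[OF d\<phi> D])
    then have "(\<lambda>x. D (frechet_derivative \<phi> (at u) x)) = (\<lambda>x. x)"
      unfolding li(1) by (rule has_derivative_unique) (rule has_derivative_ident)
    then show ?thesis by (metis injI)
  qed
  have "\<phi> 0 = p" using linear_0[OF i(1)] by (simp add: \<phi>_def stereo_def)
  then have "p \<in> \<phi> ` U" using \<phi>S[of 0] p by (metis imageI)
  then show ?thesis using lp smooth[OF oU] injd unfolding H3_patch_def smooth_immersion_on_def by blast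
qed

lemma tangent_plane_quadric:
  assumes "S \<subseteq> quadric A c" "v \<in> tangent_plane S p"
  shows "hgrad A p \<bullet> v = 0"
proof -
  obtain U \<phi> u x where U: "H3_patch S U \<phi>" "u \<in> U" "\<phi> u = p" "v = frechet_derivative \<phi> (at u) x"
    using assms(2) unfolding tangent_plane_def by blast
  have oU: "open U" and d\<phi>: "(\<phi> has_derivative frechet_derivative \<phi> (at u)) (at u)"
    using U(1,2) unfolding H3_patch_def smooth_immersion_on_def local_param_def
    by (auto dest!: spec[of _ "Suc 0"] simp: frechet_derivative_works)
  have im: "\<phi> w \<in> quadric A c" if "w \<in> U" for w
    using U(1) that assms(1) openin_imp_subset unfolding H3_patch_def local_param_def by blast
  have "((\<lambda>w. Phi A (\<phi> w) - c) has_derivative (\<lambda>x. hgrad A (\<phi> u) \<bullet> frechet_derivative \<phi> (at u) x - 0)) (at u)"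
    using im[OF U(2)] by (intro has_derivative_diff has_derivative_const has_derivative_compose[OF d\<phi> Phi_has_derivative]) (auto simp: quadric_def)
  from has_derivative_zero_on_open[OF oU U(2) _ this, of x] im show ?thesis
    by (simp add: quadric_def U)
qed

lemma continuous_on_unit_grad: "continuous_on H3 (unit_grad A c)"
proof -
  obtain a d b where A: "A = (a, d, b)" by (cases A)
  have "continuous_on H3 (\<lambda>p. ((fst p)\<^sup>2 / sqrt (c\<^sup>2 - 4 * hdet A)) *\<^sub>R
     ((1 / fst p) *\<^sub>R ((2 * a) *\<^sub>R p + (0, 2 * cnj b)) - ((a * (p \<bullet> p) + 2 * Re (b * snd p) + d) / fst p / fst p) *\<^sub>R (1, 0 :: complex)))"
    unfolding divide_inverse[of _ "sqrt _"] by (intro continuous_intros) (auto simp: H3_def)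
  then show ?thesis by (simp add: unit_grad_def[abs_def] hgrad_def Phi_def A)
qed

lemma unit_grad_inner_self:
  assumes "p \<in> quadric A c" "c\<^sup>2 > 4 * hdet A"
  shows "unit_grad A c p \<bullet> unit_grad A c p = (fst p)\<^sup>2"
proof -
  have p: "p \<in> H3" "Phi A p = c" using assms(1) by (auto simp: quadric_def)
  define K where "K = c\<^sup>2 - 4 * hdet A"
  have K: "K > 0" using assms(2) by (simp add: K_def)
  have "unit_grad A c p \<bullet> unit_grad A c p = (fst p)\<^sup>2 * ((fst p)\<^sup>2 * (hgrad A p \<bullet> hgrad A p)) / (sqrt K * sqrt K)"
    by (simp add: unit_grad_def K_def)
  also have "\<dots> = (fst p)\<^sup>2" unfolding norm_hgrad[OF p(1)] p(2) K_def[symmetric] using K by simp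
  finally show ?thesis .
qed

lemma oriented_surface_quadric:
  assumes S: "openin (top_of_set (quadric A c)) S" and c: "c\<^sup>2 > 4 * hdet A" and ne: "S \<noteq> {}" and con: "connected S"
  shows "oriented_surface S (unit_grad A c)"
proof -
  have SQ: "S \<subseteq> quadric A c" using S openin_imp_subset by blast
  have SH: "S \<subseteq> H3" using SQ by (auto simp: quadric_def)
  have "hyp_inner p (unit_grad A c p) (unit_grad A c p) = 1" if "p \<in> S" for p
    using unit_grad_inner_self[OF _ c, of p] SQ SH that by (auto simp: hyp_inner_def H3_def)
  moreover have "hyp_inner p (unit_grad A c p) v = 0" if "v \<in> tangent_plane S p" for p v
    using tangent_plane_quadric[OF SQ that] by (simp add: hyp_inner_def unit_grad_def)
  ultimately show ?thesis
    unfolding oriented_surface_def using ne con SH quadric_patch[OF S c] continuous_on_subset[OF continuous_on_unit_grad SH] by blast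
qed

text \<open>Equality in the Cauchy-Schwarz inequality, with the sign fixed by the last hypothesis.\<close>

lemma velocity_eq_unit_grad:
  assumes g: "\<gamma> \<in> LH3" "incident A \<gamma>" and c: "c\<^sup>2 > 4 * hdet A" "Phi A (geodesic \<gamma> r) = c" and pos: "hgrad A (geodesic \<gamma> r) \<bullet> velocity \<gamma> r > 0"
  shows "velocity \<gamma> r = unit_grad A c (geodesic \<gamma> r)"
    and "hgrad A (geodesic \<gamma> r) \<bullet> velocity \<gamma> r = sqrt (c\<^sup>2 - 4 * hdet A)"
proof -
  define h where "h = hgrad A (geodesic \<gamma> r)"
  define v where "v = velocity \<gamma> r"
  define t where "t = fst (geodesic \<gamma> r)"
  define K where "K = c\<^sup>2 - 4 * hdet A"
  have t: "t > 0" using geodesic_in_H3[OF g(1), of r] by (simp add: H3_def t_def)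
  have K: "K > 0" using c by (simp add: K_def)
  have vv: "v \<bullet> v = t\<^sup>2" unfolding v_def t_def by (rule velocity_unit[OF g(1)])
  have hh: "t\<^sup>2 * (h \<bullet> h) = K" using norm_hgrad[OF geodesic_in_H3[OF g(1), of r], of A] c(2) by (simp add: t_def h_def K_def)
  have sq: "(h \<bullet> v)\<^sup>2 = K"
    using incident_iff_hgrad[OF g(1), of A r] g(2) hh vv unfolding h_def v_def by (simp add: mult.commute)
  have hv: "h \<bullet> v > 0" using pos by (simp add: h_def v_def)
  then have hvK: "h \<bullet> v = sqrt K" using sq by (metis abs_of_pos real_sqrt_abs)
  then show "hgrad A (geodesic \<gamma> r) \<bullet> velocity \<gamma> r = sqrt (c\<^sup>2 - 4 * hdet A)" by (simp add: h_def v_def K_def)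
  have nv: "norm v = t" using vv t by (simp add: norm_eq_sqrt_inner)
  have nh: "norm h = sqrt K / t"
  proof -
    have "(norm h * t)\<^sup>2 = K" using hh by (simp add: power_mult_distrib power2_norm_eq_inner mult.commute)
    then have "norm h * t = sqrt K" using t by (metis abs_of_nonneg mult_nonneg_nonneg norm_ge_zero less_imp_le real_sqrt_abs)
    then show ?thesis using t by (simp add: field_simps)
  qed
  have "h \<bullet> v = norm h * norm v" using hvK nv nh t by simp
  then have "norm h *\<^sub>R v = norm v *\<^sub>R h" by (simp add: norm_cauchy_schwarz_eq)
  then have "(sqrt K / t) *\<^sub>R v = t *\<^sub>R h" by (simp add: nv nh)
  then have "(t / sqrt K) *\<^sub>R ((sqrt K / t) *\<^sub>R v) = (t / sqrt K) *\<^sub>R (t *\<^sub>R h)" by simp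
  then have "v = (t\<^sup>2 / sqrt K) *\<^sub>R h" using t K by (simp add: power2_eq_square)
  then show "velocity \<gamma> r = unit_grad A c (geodesic \<gamma> r)" by (simp add: unit_grad_def v_def h_def t_def K_def)
qed

lemma incident_of_parallel:
  assumes "\<gamma> \<in> LH3" "velocity \<gamma> r = k *\<^sub>R hgrad A (geodesic \<gamma> r)"
  shows "incident A \<gamma>"
  unfolding incident_iff_hgrad[OF assms(1), of A r] assms(2) by (simp add: power2_eq_square)

section \<open>One Hermitian form for a whole surface\<close>

lemma LH3_patch_regular:
  assumes P: "LH3_patch M f i j U \<phi>" and f: "f ` M \<subseteq> LH3"
  defines "F \<equiv> chart i j \<circ> f \<circ> \<phi>"
  shows patch_open: "open U" "openin (top_of_set M) (\<phi> ` U)"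
    and patch_homeomorphism: "\<exists>\<psi>. homeomorphism U (\<phi> ` U) \<phi> \<psi>"
    and patch_in: "u \<in> U \<Longrightarrow> \<phi> u \<in> M"
    and patch_derivative: "u \<in> U \<Longrightarrow> (F has_derivative frechet_derivative F (at u)) (at u)"
    and patch_derivative_continuous: "continuous_on U (\<lambda>u. frechet_derivative F (at u) x)"
    and patch_continuous: "continuous_on U F"
    and patch_inj: "u \<in> U \<Longrightarrow> inj (frechet_derivative F (at u))"
    and patch_start: "u \<in> U \<Longrightarrow> is_start (start_lift i (fst (F u))) (fst (f (\<phi> u)))"
    and patch_end: "u \<in> U \<Longrightarrow> is_end (end_lift j (snd (F u))) (snd (f (\<phi> u)))"
    and patch_det2: "u \<in> U \<Longrightarrow> det2 (start_lift i (fst (F u))) (end_lift j (snd (F u))) \<noteq> 0"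
proof -
  have tdo: "times_differentiable_on k F U" and inj: "\<And>u. u \<in> U \<Longrightarrow> inj (frechet_derivative F (at u))" for k
    using P by (auto simp: LH3_patch_def smooth_immersion_on_def F_def)
  show oU: "open U" "openin (top_of_set M) (\<phi> ` U)" "\<exists>\<psi>. homeomorphism U (\<phi> ` U) \<phi> \<psi>"
    using P by (auto simp: LH3_patch_def local_param_def)
  show "u \<in> U \<Longrightarrow> (F has_derivative frechet_derivative F (at u)) (at u)" by (rule times_differentiable_on_SucD(1)[OF tdo[of "Suc 0"]])
  show "continuous_on U (\<lambda>u. frechet_derivative F (at u) x)" using times_differentiable_on_SucD(2)[OF tdo[of "Suc 0"], of x] by simp
  show "continuous_on U F" using tdo[of 0] by simp
  show "u \<in> U \<Longrightarrow> inj (frechet_derivative F (at u))" by (rule inj)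
  show phiM: "u \<in> U \<Longrightarrow> \<phi> u \<in> M" for u using oU(2) openin_imp_subset by blast
  have dom: "f (\<phi> u) \<in> coord_domain i \<times> coord_domain j" if "u \<in> U" for u
    using P that by (auto simp: LH3_patch_def)
  have F: "F u = (coord i (fst (f (\<phi> u))), coord j (snd (f (\<phi> u))))" for u
    by (cases "f (\<phi> u)") (simp add: F_def)
  show st: "u \<in> U \<Longrightarrow> is_start (start_lift i (fst (F u))) (fst (f (\<phi> u)))"
    using dom[of u] by (auto simp: is_start_start_lift_iff F mem_Times_iff)
  show en: "u \<in> U \<Longrightarrow> is_end (end_lift j (snd (F u))) (snd (f (\<phi> u)))"
    using dom[of u] by (auto simp: is_end_end_lift_iff F mem_Times_iff)
  show "det2 (start_lift i (fst (F u))) (end_lift j (snd (F u))) \<noteq> 0" if u: "u \<in> U"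
    using LH3_iff_det2[OF st[OF u] en[OF u]] f phiM[OF u] by auto
qed

lemma incident_scaleR: "incident A \<gamma> \<Longrightarrow> incident (c *\<^sub>R A) \<gamma>"
  using hform_linear[of c A 0 A] by (simp add: incident_def)

lemma openin_patch_image:
  assumes "homeomorphism U (\<phi> ` U) \<phi> \<psi>" "open U" "openin (top_of_set M) (\<phi> ` U)" "open V" "V \<subseteq> U"
  shows "openin (top_of_set M) (\<phi> ` V)"
proof -
  have "openin (top_of_set U) V" using assms(4,5) by (simp add: open_subset)
  then have "openin (top_of_set (\<phi> ` U)) (\<phi> ` V)" using homeomorphism_imp_open_map[OF assms(1)] by blast
  then show ?thesis using assms(3) openin_trans by blast
qed

text \<open>Near every point the forms incident with all nearby geodesics form a real line, by local existence and
  uniqueness. This line is locally constant, and the surface is connected.\<close>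

lemma alpha_surface_imp_incident:
  assumes al: "alpha_surface M f"
  shows "\<exists>A. A \<noteq> 0 \<and> (\<forall>m\<in>M. incident A (f m))"
proof -
  have im: "M \<noteq> {}" "connected M" "f ` M \<subseteq> LH3" "\<And>m. m \<in> M \<Longrightarrow> \<exists>i j U \<phi>. LH3_patch M f i j U \<phi> \<and> m \<in> \<phi> ` U"
    and pl: "\<And>i j U \<phi> u. LH3_patch M f i j U \<phi> \<Longrightarrow> u \<in> U \<Longrightarrow> alpha_plane i j (chart i j (f (\<phi> u)))
           (range (frechet_derivative (chart i j \<circ> f \<circ> \<phi>) (at u)))"
    using al by (auto simp: alpha_surface_def immersed_surface_def)
  \<comment> \<open>the germs of incident forms at \<open>m\<close>\<close>
  define Ls where "Ls = (\<lambda>m. {A. \<exists>V. openin (top_of_set M) V \<and> m \<in> V \<and> (\<forall>m'\<in>V. incident A (f m'))})"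
  have loc: "\<exists>A V. A \<noteq> 0 \<and> openin (top_of_set M) V \<and> m0 \<in> V \<and> (\<forall>m\<in>V. Ls m = range (\<lambda>c. c *\<^sub>R A))" if m0: "m0 \<in> M" for m0
  proof -
    obtain i j U \<phi> where P: "LH3_patch M f i j U \<phi>" and "m0 \<in> \<phi> ` U" using im(4)[OF m0] by blast
    then obtain u0 where u0: "u0 \<in> U" "m0 = \<phi> u0" by blast
    define F where "F = chart i j \<circ> f \<circ> \<phi>"
    define L where "L u = frechet_derivative F (at u)" for u
    note pf = LH3_patch_regular[OF P im(3), folded F_def, folded L_def]
    have "\<exists>A V. A \<noteq> 0 \<and> open V \<and> u0 \<in> V \<and> V \<subseteq> U \<and> (\<forall>u\<in>V. hform A (start_lift i (fst (F u))) (end_lift j (snd (F u))) = 0)"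
    proof (rule alpha_patch_incident[OF pf(1) u0(1) pf(5,6) pf(8)[OF u0(1)] _ pf(11)])
      show "alpha_plane i j (F u) (range (L u))" if "u \<in> U" for u
        using pl[OF P that] by (simp add: F_def L_def)
    qed
    then obtain A V where A: "A \<noteq> 0" and V: "open V" "u0 \<in> V" "V \<subseteq> U"
      and E: "\<And>u. u \<in> V \<Longrightarrow> hform A (start_lift i (fst (F u))) (end_lift j (snd (F u))) = 0" by blast
    obtain \<psi> where hom: "homeomorphism U (\<phi> ` U) \<phi> \<psi>" using pf(3) by blast
    have oV: "openin (top_of_set M) (\<phi> ` V)" by (rule openin_patch_image[OF hom pf(1,2) V(1,3)])
    have inc: "incident A (f m)" if m: "m \<in> \<phi> ` V" for m
    proof -
      obtain u where u: "u \<in> V" "m = \<phi> u" using m by blast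
      have uU: "u \<in> U" using u(1) V(3) by blast
      show ?thesis unfolding u(2) incident_iff_hform[OF pf(9)[OF uU] pf(10)[OF uU]] by (rule E[OF u(1)])
    qed
    have "Ls m = range (\<lambda>c. c *\<^sub>R A)" if m: "m \<in> \<phi> ` V" for m
    proof
      show "range (\<lambda>c. c *\<^sub>R A) \<subseteq> Ls m" using oV m inc incident_scaleR unfolding Ls_def by blast
      show "Ls m \<subseteq> range (\<lambda>c. c *\<^sub>R A)"
      proof
        fix B assume "B \<in> Ls m"
        then obtain T where T: "openin (top_of_set M) T" "m \<in> T" "\<And>m'. m' \<in> T \<Longrightarrow> incident B (f m')" unfolding Ls_def by blast
        obtain T' where T': "open T'" "T = M \<inter> T'" using T(1) by (auto simp: openin_open)
        obtain u where u: "u \<in> V" "m = \<phi> u" using m by blast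
        define V2 where "V2 = V \<inter> \<phi> -` T'"
        have "continuous_on V \<phi>" using hom V(3) continuous_on_subset by (auto simp: homeomorphism_def)
        then have oV2: "open V2" unfolding V2_def by (rule continuous_open_preimage) (use V T' in auto)
        have uV2: "u \<in> V2" using u T T' by (auto simp: V2_def)
        have uU: "u \<in> U" using u V by blast
        have EB: "hform B (start_lift i (fst (F x))) (end_lift j (snd (F x))) = 0" if x: "x \<in> V2" for x
        proof -
          have xU: "x \<in> U" using x V(3) by (auto simp: V2_def)
          have "\<phi> x \<in> T" using x T' pf(4)[OF xU] by (auto simp: V2_def)
          then show ?thesis using T(3) incident_iff_hform[OF pf(9)[OF xU] pf(10)[OF xU]] by blast
        qed
        have EA: "hform A (start_lift i (fst (F x))) (end_lift j (snd (F x))) = 0" if "x \<in> V2" for x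
          using E that by (simp add: V2_def)
        have lin: "linear (L u)" using pf(5)[OF uU] has_derivative_bounded_linear bounded_linear.linear by blast
        have "L u 1 \<noteq> L u 0" using pf(8)[OF uU] by (simp add: inj_eq)
        then have nz: "(fst (L u 1), snd (L u 1)) \<noteq> (0, 0)" by (simp add: linear_0[OF lin] prod_eq_iff)
        have "\<exists>c. B = c *\<^sub>R A"
          by (rule incidence_unique[OF pf(11)[OF uU] nz A EA[OF uV2] EB[OF uV2]
                has_derivative_zero_on_open[OF oV2 uV2 EA hform_lifts_has_derivative[OF pf(5)[OF uU]]]
                has_derivative_zero_on_open[OF oV2 uV2 EB hform_lifts_has_derivative[OF pf(5)[OF uU]]]])
        then show "B \<in> range (\<lambda>c. c *\<^sub>R A)" by blast
      qed
    qed
    then show ?thesis using A oV u0 V by blast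
  qed
  obtain m0 where m0: "m0 \<in> M" using im(1) by blast
  obtain A V where A: "A \<noteq> 0" "m0 \<in> V" "\<And>m. m \<in> V \<Longrightarrow> Ls m = range (\<lambda>c. c *\<^sub>R A)" using loc[OF m0] by blast
  have "Ls m0 = Ls m" if "m \<in> M" for m
  proof (rule connected_equivalence_relation[OF im(2) m0 that, of "\<lambda>x y. Ls x = Ls y"])
    fix a assume "a \<in> M"
    from loc[OF this] obtain B V where "openin (top_of_set M) V" "a \<in> V" "\<forall>m\<in>V. Ls m = range (\<lambda>c. c *\<^sub>R B)" by blast
    then show "\<exists>T. openin (top_of_set M) T \<and> a \<in> T \<and> (\<forall>x\<in>T. Ls a = Ls x)" by metis
  qed auto
  moreover have "A \<in> Ls m0" using A(3)[OF A(2)] by (metis rangeI scaleR_one)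
  ultimately have "incident A (f m)" if "m \<in> M" for m using that unfolding Ls_def by blast
  then show ?thesis using A(1) by blast
qed

lemma alpha_surface_of_incident:
  assumes im: "immersed_surface M f" and A: "A \<noteq> 0" and inc: "\<And>m. m \<in> M \<Longrightarrow> incident A (f m)"
  shows "alpha_surface M f"
  unfolding alpha_surface_def
proof (intro conjI im allI impI ballI)
  fix i j U \<phi> u assume P: "LH3_patch M f i j U \<phi>" and u: "u \<in> U"
  have fM: "f ` M \<subseteq> LH3" using im by (simp add: immersed_surface_def)
  define F where "F = chart i j \<circ> f \<circ> \<phi>"
  define L where "L u = frechet_derivative F (at u)" for u
  note pf = LH3_patch_regular[OF P fM, folded F_def, folded L_def]
  have E: "hform A (start_lift i (fst (F x))) (end_lift j (snd (F x))) = 0" if "x \<in> U" for x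
    using inc[OF pf(4)[OF that]] incident_iff_hform[OF pf(9)[OF that] pf(10)[OF that]] by simp
  have lin: "linear (L u)" using pf(5)[OF u] has_derivative_bounded_linear bounded_linear.linear by blast
  have "alpha_plane i j (fst (F u), snd (F u)) (range (L u))"
    by (rule alpha_plane_of_incidence[OF pf(11)[OF u] A E[OF u] lin pf(8)[OF u]
          has_derivative_zero_on_open[OF pf(1) u E hform_lifts_has_derivative[OF pf(5)[OF u]]]])
  then show "alpha_plane i j (chart i j (f (\<phi> u))) (range (frechet_derivative (chart i j \<circ> f \<circ> \<phi>) (at u)))"
    by (simp add: F_def L_def)
qed

section \<open>The surface orthogonal to a congruence\<close>

text \<open>The geodesic passes through the level surface \<open>Phi A = c\<close> in the direction of growing \<open>Phi A\<close>.\<close>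

definition crosses_at :: "herm \<Rightarrow> real \<Rightarrow> sphere \<times> sphere \<Rightarrow> real \<Rightarrow> bool" where
  "crosses_at A c \<gamma> r \<longleftrightarrow> Phi A (geodesic \<gamma> r) = c \<and> hgrad A (geodesic \<gamma> r) \<bullet> velocity \<gamma> r > 0"

text \<open>At a crossing, \<open>2 e hquad A w\<close> and \<open>2 hquad A v / e\<close> equal \<open>(c + k) |det2 v w|\<close> and \<open>(c - k) |det2 v w|\<close>. As
  \<open>k\<close> is not zero, one of these equations can be solved for \<open>e\<close>, and the choice depends only on \<open>c\<close> and \<open>A\<close>.
  The crossing point is therefore unique and depends continuously on the geodesic.\<close>

definition cross_param :: "herm \<Rightarrow> real \<Rightarrow> complex \<times> complex \<Rightarrow> complex \<times> complex \<Rightarrow> real" where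
  "cross_param A c v w = (let k = sqrt (c\<^sup>2 - 4 * hdet A) in
     if c + k \<noteq> 0 then (c + k) * cmod (det2 v w) / (2 * hquad A w) else 2 * hquad A v / ((c - k) * cmod (det2 v w)))"

lemma crosses_at_geo_point:
  assumes g: "\<gamma> \<in> LH3" "incident A \<gamma>" and vw: "is_start v (fst \<gamma>)" "is_end w (snd \<gamma>)"
    and c: "c\<^sup>2 > 4 * hdet A" and cr: "crosses_at A c \<gamma> r"
  shows "geodesic \<gamma> r = geo_point v w (cross_param A c v w)" "cross_param A c v w > 0"
    "c + sqrt (c\<^sup>2 - 4 * hdet A) \<noteq> 0 \<Longrightarrow> hquad A w \<noteq> 0"
proof -
  define k where "k = sqrt (c\<^sup>2 - 4 * hdet A)"
  have k: "k > 0" using c by (simp add: k_def)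
  have D: "cmod (det2 v w) > 0" using LH3_iff_det2[OF vw] g by simp
  obtain \<kappa> where \<kappa>: "\<kappa> > 0" "geodesic \<gamma> r = geo_point v w (\<kappa> * exp r)"
    "Phi A (geodesic \<gamma> r) = (\<kappa> * exp r * hquad A w + hquad A v / (\<kappa> * exp r)) / cmod (det2 v w)"
    "hgrad A (geodesic \<gamma> r) \<bullet> velocity \<gamma> r = (\<kappa> * exp r * hquad A w - hquad A v / (\<kappa> * exp r)) / cmod (det2 v w)"
    using Phi_along_geodesic[OF g(1) vw] by blast
  define e where "e = \<kappa> * exp r"
  have e: "e > 0" using \<kappa> by (simp add: e_def)
  have "(e * hquad A w + hquad A v / e) / cmod (det2 v w) = c" using cr \<kappa>(3) by (simp add: crosses_at_def e_def)
  then have 1: "e * hquad A w + hquad A v / e = c * cmod (det2 v w)" using D by (simp add: field_simps)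
  have "hgrad A (geodesic \<gamma> r) \<bullet> velocity \<gamma> r = k"
    unfolding k_def using cr by (intro velocity_eq_unit_grad(2)[OF g c]) (auto simp: crosses_at_def)
  then have "(e * hquad A w - hquad A v / e) / cmod (det2 v w) = k" using \<kappa>(4) by (simp add: e_def)
  then have 2: "e * hquad A w - hquad A v / e = k * cmod (det2 v w)" using D by (simp add: field_simps)
  have 3: "2 * (e * hquad A w) = (c + k) * cmod (det2 v w)" using 1 2 by (simp add: algebra_simps)
  have 4: "2 * (hquad A v / e) = (c - k) * cmod (det2 v w)" using 1 2 by (simp add: algebra_simps)
  show hw: "hquad A w \<noteq> 0" if "c + sqrt (c\<^sup>2 - 4 * hdet A) \<noteq> 0" using 3 that D by (auto simp: k_def)
  have "cross_param A c v w = e"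
  proof (cases "c + k = 0")
    case False
    have "hquad A w \<noteq> 0" using hw False by (simp add: k_def)
    then have "e = (c + k) * cmod (det2 v w) / (2 * hquad A w)" using 3 by (simp add: field_simps)
    then show ?thesis using False by (simp add: cross_param_def Let_def k_def[symmetric])
  next
    case True
    then have ne: "(c - k) * cmod (det2 v w) \<noteq> 0" using k D by auto
    then have "hquad A v \<noteq> 0" using 4 by auto
    have "2 * hquad A v = (c - k) * cmod (det2 v w) * e" unfolding 4[symmetric] using e by simp
    then have "e = 2 * hquad A v / ((c - k) * cmod (det2 v w))" using ne by simp
    then show ?thesis using True by (simp add: cross_param_def Let_def k_def[symmetric])
  qed
  then show "geodesic \<gamma> r = geo_point v w (cross_param A c v w)" "cross_param A c v w > 0" using \<kappa>(2) e by (simp_all add: e_def)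
qed

lemma continuous_on_geo_point:
  assumes "continuous_on U v" "continuous_on U w" "continuous_on U e" "\<And>u. u \<in> U \<Longrightarrow> det2 (v u) (w u) \<noteq> 0" "\<And>u. u \<in> U \<Longrightarrow> e u > 0"
  shows "continuous_on U (\<lambda>u. geo_point (v u) (w u) (e u))"
proof -
  have W: "e u * (cmod (snd (w u)))\<^sup>2 + (cmod (snd (v u)))\<^sup>2 / e u \<noteq> 0" if "u \<in> U" for u
    using det2_snd_nz[OF assms(4)[OF that] assms(5)[OF that]] by simp
  have e0: "e u \<noteq> 0" if "u \<in> U" for u using assms(5)[OF that] by simp
  have W': "complex_of_real (e u * (cmod (snd (w u)))\<^sup>2 + (cmod (snd (v u)))\<^sup>2 / e u) \<noteq> 0" if "u \<in> U" for u
    using W[OF that] by (simp only: of_real_eq_0_iff not_False_eq_True)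
  show ?thesis
    unfolding geo_point_def Let_def det2_def
    by (intro continuous_intros assms(1-3)) (auto simp only: W W' e0 of_real_eq_0_iff)
qed

lemma continuous_on_lifts: "continuous_on UNIV (start_lift i)" "continuous_on UNIV (end_lift j)"
  by (cases i; cases j; auto simp: start_lift_def[abs_def] end_lift_def[abs_def] intro!: continuous_intros)+

lemma continuous_on_hquad: "continuous_on UNIV (hquad A)"
  by (cases A) (auto simp: hquad_def[abs_def] hform_def intro!: continuous_intros)

text \<open>The chart coordinate of the start of a geodesic as a continuous function of the matrix of a ray.\<close>

definition ray_start_coord :: "bool \<Rightarrow> real \<times> complex \<times> real \<Rightarrow> complex" where
  "ray_start_coord i R = (if i then - cnj (fst (snd R)) / of_real (fst R) else - fst (snd R) / of_real (snd (snd R)))"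

definition ray_end_coord :: "bool \<Rightarrow> real \<times> complex \<times> real \<Rightarrow> complex" where
  "ray_end_coord j R = (if j then cnj (fst (snd R)) / of_real (snd (snd R)) else fst (snd R) / of_real (fst R))"

lemma ray_start_coord:
  assumes "is_start v s" "l > 0" "R = l *\<^sub>R outer v"
  shows "(if i then fst R else snd (snd R)) \<noteq> 0 \<longleftrightarrow> s \<in> coord_domain i"
    and "s \<in> coord_domain i \<Longrightarrow> coord i s = ray_start_coord i R"
proof -
  show "(if i then fst R else snd (snd R)) \<noteq> 0 \<longleftrightarrow> s \<in> coord_domain i"
    using assms by (cases i; cases s) (auto simp: is_start_def outer_def)
  assume s: "s \<in> coord_domain i"
  have n: "complex_of_real ((cmod z)\<^sup>2) = z * cnj z" for z by (rule complex_norm_square)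
  obtain v1 v2 where v: "v = (v1, v2)" by (cases v)
  have R: "fst R = l * (cmod v1)\<^sup>2" "fst (snd R) = of_real l * (v1 * cnj v2)" "snd (snd R) = l * (cmod v2)\<^sup>2"
    using assms(3) by (auto simp: outer_def v scaleR_conv_of_real)
  show "coord i s = ray_start_coord i R"
  proof (cases i)
    case True
    then have "v1 \<noteq> 0" using s assms(1) by (cases s) (auto simp: is_start_def v)
    then have "ray_start_coord i R = - v2 / v1" using True assms(2) unfolding ray_start_coord_def R of_real_mult n by simp
    then show ?thesis using assms(1) s True by (cases s) (auto simp: is_start_def v)
  next
    case False
    then have "v2 \<noteq> 0" using s assms(1) by (cases s) (auto simp: is_start_def v)
    then have "ray_start_coord i R = - v1 / v2" using False assms(2) unfolding ray_start_coord_def R of_real_mult n by simp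
    then show ?thesis using assms(1) s False by (cases s) (auto simp: is_start_def v)
  qed
qed

lemma ray_end_coord:
  assumes "is_end w s" "l > 0" "R = l *\<^sub>R outer w"
  shows "(if j then snd (snd R) else fst R) \<noteq> 0 \<longleftrightarrow> s \<in> coord_domain j"
    and "s \<in> coord_domain j \<Longrightarrow> coord j s = ray_end_coord j R"
proof -
  show "(if j then snd (snd R) else fst R) \<noteq> 0 \<longleftrightarrow> s \<in> coord_domain j"
    using assms by (cases j; cases s) (auto simp: is_end_def outer_def)
  assume s: "s \<in> coord_domain j"
  have n: "complex_of_real ((cmod z)\<^sup>2) = z * cnj z" for z by (rule complex_norm_square)
  obtain w1 w2 where w: "w = (w1, w2)" by (cases w)
  have R: "fst R = l * (cmod w1)\<^sup>2" "fst (snd R) = of_real l * (w1 * cnj w2)" "snd (snd R) = l * (cmod w2)\<^sup>2"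
    using assms(3) by (auto simp: outer_def w scaleR_conv_of_real)
  show "coord j s = ray_end_coord j R"
  proof (cases j)
    case True
    then have "w2 \<noteq> 0" using s assms(1) by (cases s) (auto simp: is_end_def w)
    then have "ray_end_coord j R = cnj w1 / cnj w2" using True assms(2) unfolding ray_end_coord_def R of_real_mult n by simp
    then show ?thesis using assms(1) s True by (cases s) (auto simp: is_end_def w)
  next
    case False
    then have "w1 \<noteq> 0" using s assms(1) by (cases s) (auto simp: is_end_def w)
    then have "ray_end_coord j R = cnj w2 / cnj w1" using False assms(2) unfolding ray_end_coord_def R of_real_mult n by simp
    then show ?thesis using assms(1) s False by (cases s) (auto simp: is_end_def w)
  qed
qed

lemma coord_inj: "s \<in> coord_domain i \<Longrightarrow> s' \<in> coord_domain i \<Longrightarrow> coord i s = coord i s' \<Longrightarrow> s = s'"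
  by (cases i; cases s; cases s') auto

text \<open>The crossing points of the congruence with a level surface form a connected set, being a continuous image
  of \<open>M\<close>, and its normals are the given geodesics. It is open in the level surface because the normal at a
  nearby point is incident and close to a geodesic of the congruence, hence belongs to it: an immersed surface
  fills the incidence curve locally.\<close>

lemma section_surface:
  assumes im: "immersed_surface M f" and A: "A \<noteq> 0" and inc: "\<And>m. m \<in> M \<Longrightarrow> incident A (f m)"
    and c: "c\<^sup>2 > 4 * hdet A" and cr: "\<And>m. m \<in> M \<Longrightarrow> \<exists>r. crosses_at A c (f m) r"
  defines "S \<equiv> {geodesic (f m) r | m r. m \<in> M \<and> crosses_at A c (f m) r}"
  shows "openin (top_of_set (quadric A c)) S" "connected S" "S \<noteq> {}" "f ` M = normal_congruence S (unit_grad A c)"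
proof -
  have M: "M \<noteq> {}" "connected M" "f ` M \<subseteq> LH3" "\<And>m. m \<in> M \<Longrightarrow> \<exists>i j U \<phi>. LH3_patch M f i j U \<phi> \<and> m \<in> \<phi> ` U"
    using im by (auto simp: immersed_surface_def)
  have L: "f m \<in> LH3" if "m \<in> M" for m using M(3) that by blast
  show ne: "S \<noteq> {}" using M(1) cr unfolding S_def by blast
  have vel: "velocity (f m) r = unit_grad A c (geodesic (f m) r)" if "m \<in> M" "crosses_at A c (f m) r" for m r
    using that by (intro velocity_eq_unit_grad(1)[OF L inc c]) (auto simp: crosses_at_def)
  define k where "k = sqrt (c\<^sup>2 - 4 * hdet A)"
  have k: "k > 0" using c by (simp add: k_def)
  show "f ` M = normal_congruence S (unit_grad A c)"
  proof (intro equalityI subsetI)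
    fix \<gamma> assume "\<gamma> \<in> f ` M"
    then obtain m r where m: "m \<in> M" "\<gamma> = f m" "crosses_at A c (f m) r" using cr by blast
    then have "geodesic \<gamma> r \<in> S" unfolding S_def by blast
    then show "\<gamma> \<in> normal_congruence S (unit_grad A c)"
      using m L vel[OF m(1,3)] unfolding normal_congruence_def by blast
  next
    fix \<gamma> assume "\<gamma> \<in> normal_congruence S (unit_grad A c)"
    then obtain r where g: "\<gamma> \<in> LH3" "geodesic \<gamma> r \<in> S" "velocity \<gamma> r = unit_grad A c (geodesic \<gamma> r)"
      unfolding normal_congruence_def by blast
    then obtain m r' where m: "m \<in> M" "crosses_at A c (f m) r'" "geodesic \<gamma> r = geodesic (f m) r'"
      unfolding S_def by blast
    have "\<gamma> = f m" by (rule geodesic_unique[OF g(1) L[OF m(1)] m(3)]) (simp add: g(3) m(3) vel[OF m(1,2)])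
    then show "\<gamma> \<in> f ` M" using m(1) by blast
  qed
  \<comment> \<open>the crossing point, independent of the choice of \<open>r\<close>\<close>
  define \<sigma> where "\<sigma> = (\<lambda>m. geodesic (f m) (SOME r. crosses_at A c (f m) r))"
  have someI: "crosses_at A c (f m) (SOME r. crosses_at A c (f m) r)" if "m \<in> M" for m
    using cr[OF that] by (rule someI_ex)
  have \<sigma>: "geodesic (f m) r = \<sigma> m" if m: "m \<in> M" "crosses_at A c (f m) r" for m r
  proof -
    obtain v w where vw: "is_start v (fst (f m))" "is_end w (snd (f m))" by (rule obtain_lifts)
    show ?thesis unfolding \<sigma>_def
      using crosses_at_geo_point(1)[OF L[OF m(1)] inc[OF m(1)] vw c m(2)] crosses_at_geo_point(1)[OF L[OF m(1)] inc[OF m(1)] vw c someI[OF m(1)]]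
      by simp
  qed
  have S\<sigma>: "S = \<sigma> ` M"
  proof
    show "S \<subseteq> \<sigma> ` M" using \<sigma> unfolding S_def by blast
    show "\<sigma> ` M \<subseteq> S" using someI unfolding S_def \<sigma>_def by blast
  qed
  have patch_\<sigma>: "continuous_on U (\<lambda>u. \<sigma> (\<phi> u))" if P: "LH3_patch M f i j U \<phi>" for i j U \<phi>
  proof -
    define F where "F = chart i j \<circ> f \<circ> \<phi>"
    note pf = LH3_patch_regular[OF P M(3), folded F_def]
    define v where "v u = start_lift i (fst (F u))" for u
    define w where "w u = end_lift j (snd (F u))" for u
    note cg = crosses_at_geo_point[OF L[OF pf(4)] inc[OF pf(4)] pf(9,10) c someI[OF pf(4)], folded v_def w_def]
    have D: "det2 (v u) (w u) \<noteq> 0" if "u \<in> U" for u using pf(11)[OF that] by (simp add: v_def w_def)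
    have cv: "continuous_on U v" unfolding v_def[abs_def]
      by (rule continuous_on_compose2[OF continuous_on_lifts(1)]) (auto intro!: continuous_intros pf(7))
    have cw: "continuous_on U w" unfolding w_def[abs_def]
      by (rule continuous_on_compose2[OF continuous_on_lifts(2)]) (auto intro!: continuous_intros pf(7))
    have cD: "continuous_on U (\<lambda>u. cmod (det2 (v u) (w u)))"
      unfolding det2_def by (intro continuous_intros cv cw)
    have cq: "continuous_on U (\<lambda>u. hquad A (v u))" "continuous_on U (\<lambda>u. hquad A (w u))"
      by (auto intro: continuous_on_compose2[OF continuous_on_hquad] cv cw)
    have "continuous_on U (\<lambda>u. cross_param A c (v u) (w u))"
    proof (cases "c + k = 0")
      case True
      then have "c - k \<noteq> 0" using k by auto
      then show ?thesis using True D unfolding cross_param_def Let_def k_def[symmetric]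
        by (auto intro!: continuous_intros cD cq)
    next
      case False
      then have "hquad A (w u) \<noteq> 0" if "u \<in> U" for u using cg(3)[OF that that that that that] that by (simp add: k_def)
      then show ?thesis using False unfolding cross_param_def Let_def k_def[symmetric]
        by (auto intro!: continuous_intros cD cq)
    qed
    then have "continuous_on U (\<lambda>u. geo_point (v u) (w u) (cross_param A c (v u) (w u)))"
      using cg(2) D by (intro continuous_on_geo_point cv cw) auto
    moreover have "\<sigma> (\<phi> u) = geo_point (v u) (w u) (cross_param A c (v u) (w u))" if "u \<in> U" for u
      using cg(1)[OF that that that that that] unfolding \<sigma>_def .
    ultimately show ?thesis by (simp cong: continuous_on_cong)
  qed
  have "continuous_on M \<sigma>"
    unfolding continuous_openin_preimage_eq
  proof (intro allI impI)
    fix T :: "half_space set" assume T: "open T"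
    show "openin (top_of_set M) (M \<inter> \<sigma> -` T)"
    proof (subst openin_subopen, intro ballI)
      fix m assume m: "m \<in> M \<inter> \<sigma> -` T"
      then obtain i j U \<phi> where P: "LH3_patch M f i j U \<phi>" and "m \<in> \<phi> ` U" using M(4) by blast
      then obtain u where u: "u \<in> U" "m = \<phi> u" by blast
      note pf = LH3_patch_regular[OF P M(3)]
      obtain \<psi> where hom: "homeomorphism U (\<phi> ` U) \<phi> \<psi>" using pf(3) by blast
      define V where "V = U \<inter> (\<lambda>u. \<sigma> (\<phi> u)) -` T"
      have "open V" unfolding V_def by (rule continuous_open_preimage[OF patch_\<sigma>[OF P] pf(1) T])
      then have "openin (top_of_set M) (\<phi> ` V)" by (intro openin_patch_image[OF hom pf(1,2)]) (auto simp: V_def)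
      moreover have "\<phi> ` V \<subseteq> M \<inter> \<sigma> -` T" using pf(4) by (auto simp: V_def)
      moreover have "m \<in> \<phi> ` V" using u m by (auto simp: V_def)
      ultimately show "\<exists>T'. openin (top_of_set M) T' \<and> m \<in> T' \<and> T' \<subseteq> M \<inter> \<sigma> -` T" by blast
    qed
  qed
  then show "connected S" unfolding S\<sigma> using M(2) by (rule connected_continuous_image)
  have SQ: "S \<subseteq> quadric A c"
    using geodesic_in_H3[OF L] by (auto simp: S_def quadric_def crosses_at_def)
  show "openin (top_of_set (quadric A c)) S"
  proof (subst openin_subopen, intro ballI)
    fix q0 assume q0: "q0 \<in> S"
    then obtain m0 r0 where m0: "m0 \<in> M" "crosses_at A c (f m0) r0" "q0 = geodesic (f m0) r0" unfolding S_def by blast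
    obtain i j U \<phi> where P: "LH3_patch M f i j U \<phi>" and "m0 \<in> \<phi> ` U" using M(4)[OF m0(1)] by blast
    then obtain u0 where u0: "u0 \<in> U" "m0 = \<phi> u0" by blast
    define F where "F = chart i j \<circ> f \<circ> \<phi>"
    define L' where "L' u = frechet_derivative F (at u)" for u
    note pf = LH3_patch_regular[OF P M(3), folded F_def, folded L'_def]
    have E: "hform A (start_lift i (fst (F x))) (end_lift j (snd (F x))) = 0" if "x \<in> U" for x
      using inc[OF pf(4)[OF that]] incident_iff_hform[OF pf(9)[OF that] pf(10)[OF that]] by simp
    obtain e where e: "e > 0" and sur: "\<And>z \<zeta>. dist z (fst (F u0)) < e \<Longrightarrow> dist \<zeta> (snd (F u0)) < e \<Longrightarrow>
        hform A (start_lift i z) (end_lift j \<zeta>) = 0 \<Longrightarrow> \<exists>u\<in>U. F u = (z, \<zeta>)"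
      using incidence_curve_locally_surjective[OF pf(1) u0(1) pf(5) pf(8)[OF u0(1)] A E pf(11)[OF u0(1)]] by blast
    \<comment> \<open>the start and the end of the normal at a point, as rays\<close>
    define R1 where "R1 = (\<lambda>q. ray q (- unit_grad A c q))"
    define R2 where "R2 = (\<lambda>q. ray q (unit_grad A c q))"
    have rays: "\<exists>l>0. R2 (geodesic \<gamma> r) = l *\<^sub>R outer w" "\<exists>l>0. R1 (geodesic \<gamma> r) = l *\<^sub>R outer v"
      if "\<gamma> \<in> LH3" "velocity \<gamma> r = unit_grad A c (geodesic \<gamma> r)" "is_start v (fst \<gamma>)" "is_end w (snd \<gamma>)" for \<gamma> r v w
      using ray_velocity[OF that(1,4), of r] ray_minus_velocity[OF that(1,3), of r] by (auto simp: R1_def R2_def that(2))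
    have H3o: "open H3" unfolding H3_def by (intro open_Collect_less continuous_intros)
    have q0H: "q0 \<in> H3" using q0 SQ by (auto simp: quadric_def)
    have "continuous_on H3 R1" "continuous_on H3 R2"
      unfolding R1_def R2_def ray_def by (intro continuous_intros continuous_on_unit_grad)+
    then have t: "(R1 \<longlongrightarrow> R1 q0) (nhds q0)" "(R2 \<longlongrightarrow> R2 q0) (nhds q0)"
      using q0H H3o by (auto simp: continuous_on_eq_continuous_at isCont_def tendsto_at_iff_tendsto_nhds)
    have st0: "is_start (start_lift i (fst (F u0))) (fst (f m0))" and en0: "is_end (end_lift j (snd (F u0))) (snd (f m0))"
      using pf(9,10)[OF u0(1)] u0(2) by simp_all
    obtain l1 l2 where l: "l2 > 0" "R2 q0 = l2 *\<^sub>R outer (end_lift j (snd (F u0)))" "l1 > 0" "R1 q0 = l1 *\<^sub>R outer (start_lift i (fst (F u0)))"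
      using rays[OF L[OF m0(1)] vel[OF m0(1,2)] st0 en0] m0(3) by auto
    have dom0: "fst (f m0) \<in> coord_domain i" "coord i (fst (f m0)) = fst (F u0)" "snd (f m0) \<in> coord_domain j" "coord j (snd (f m0)) = snd (F u0)"
      using st0 en0 by (simp_all add: is_start_start_lift_iff is_end_end_lift_iff)
    have nz1: "(if i then fst (R1 q0) else snd (snd (R1 q0))) \<noteq> 0" and co1: "ray_start_coord i (R1 q0) = fst (F u0)"
      using ray_start_coord[OF st0 l(3,4)] dom0 by auto
    have nz2: "(if j then snd (snd (R2 q0)) else fst (R2 q0)) \<noteq> 0" and co2: "ray_end_coord j (R2 q0) = snd (F u0)"
      using ray_end_coord[OF en0 l(1,2)] dom0 by auto
    have tc1: "((\<lambda>q. ray_start_coord i (R1 q)) \<longlongrightarrow> ray_start_coord i (R1 q0)) (nhds q0)"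
      using nz1 unfolding ray_start_coord_def by (cases i) (auto intro!: tendsto_intros t)
    have tc2: "((\<lambda>q. ray_end_coord j (R2 q)) \<longlongrightarrow> ray_end_coord j (R2 q0)) (nhds q0)"
      using nz2 unfolding ray_end_coord_def by (cases j) (auto intro!: tendsto_intros t)
    have tn1: "((\<lambda>q. if i then fst (R1 q) else snd (snd (R1 q))) \<longlongrightarrow> (if i then fst (R1 q0) else snd (snd (R1 q0)))) (nhds q0)"
      by (cases i) (auto intro!: tendsto_intros t)
    have tn2: "((\<lambda>q. if j then snd (snd (R2 q)) else fst (R2 q)) \<longlongrightarrow> (if j then snd (snd (R2 q0)) else fst (R2 q0))) (nhds q0)"
      by (cases j) (auto intro!: tendsto_intros t)
    have "eventually (\<lambda>q. dist (ray_start_coord i (R1 q)) (fst (F u0)) < e \<and> dist (ray_end_coord j (R2 q)) (snd (F u0)) < e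
        \<and> (if i then fst (R1 q) else snd (snd (R1 q))) \<noteq> 0 \<and> (if j then snd (snd (R2 q)) else fst (R2 q)) \<noteq> 0) (nhds q0)"
      by (intro eventually_conj tendstoD[OF tc1[unfolded co1] e] tendstoD[OF tc2[unfolded co2] e]
          tendsto_imp_eventually_ne[OF tn1 nz1] tendsto_imp_eventually_ne[OF tn2 nz2])
    then obtain T where T: "open T" "q0 \<in> T" and TT: "\<And>q. q \<in> T \<Longrightarrow> dist (ray_start_coord i (R1 q)) (fst (F u0)) < e \<and> dist (ray_end_coord j (R2 q)) (snd (F u0)) < e
        \<and> (if i then fst (R1 q) else snd (snd (R1 q))) \<noteq> 0 \<and> (if j then snd (snd (R2 q)) else fst (R2 q)) \<noteq> 0"
      unfolding eventually_nhds by blast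
    have "quadric A c \<inter> T \<subseteq> S"
    proof
      fix q assume q: "q \<in> quadric A c \<inter> T"
      then have qH: "q \<in> H3" "Phi A q = c" by (auto simp: quadric_def)
      \<comment> \<open>the normal of the level surface at the nearby point \<open>q\<close>\<close>
      obtain \<gamma> r where g: "\<gamma> \<in> LH3" "geodesic \<gamma> r = q" "velocity \<gamma> r = unit_grad A c q"
        using geodesic_exists[OF qH(1) unit_grad_inner_self[of q A c]] q c by blast
      have inc\<gamma>: "incident A \<gamma>"
        by (rule incident_of_parallel[OF g(1), of r "(fst q)\<^sup>2 / sqrt (c\<^sup>2 - 4 * hdet A)"]) (use g(2,3) in \<open>simp add: unit_grad_def\<close>)
      obtain v w where vw: "is_start v (fst \<gamma>)" "is_end w (snd \<gamma>)" by (rule obtain_lifts)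
      obtain l1 l2 where l: "l2 > 0" "R2 q = l2 *\<^sub>R outer w" "l1 > 0" "R1 q = l1 *\<^sub>R outer v"
        using rays[OF g(1) _ vw, of r] g(2,3) by auto
      have d: "fst \<gamma> \<in> coord_domain i" "snd \<gamma> \<in> coord_domain j"
        using TT[of q] q ray_start_coord(1)[OF vw(1) l(3,4)] ray_end_coord(1)[OF vw(2) l(1,2)] by auto
      have co: "coord i (fst \<gamma>) = ray_start_coord i (R1 q)" "coord j (snd \<gamma>) = ray_end_coord j (R2 q)"
        using ray_start_coord(2)[OF vw(1) l(3,4) d(1)] ray_end_coord(2)[OF vw(2) l(1,2) d(2)] .
      have "hform A (start_lift i (coord i (fst \<gamma>))) (end_lift j (coord j (snd \<gamma>))) = 0"
      proof (rule iffD1[OF incident_iff_hform inc\<gamma>])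
        show "is_start (start_lift i (coord i (fst \<gamma>))) (fst \<gamma>)" "is_end (end_lift j (coord j (snd \<gamma>))) (snd \<gamma>)"
          using d by (simp_all add: is_start_start_lift_iff is_end_end_lift_iff)
      qed
      then obtain u where u: "u \<in> U" "F u = (coord i (fst \<gamma>), coord j (snd \<gamma>))"
        using sur[of "coord i (fst \<gamma>)" "coord j (snd \<gamma>)"] TT[of q] q co by auto
      have "fst (f (\<phi> u)) = fst \<gamma>" "snd (f (\<phi> u)) = snd \<gamma>"
        using pf(9,10)[OF u(1)] d u(2) by (auto simp: is_start_start_lift_iff is_end_end_lift_iff intro: coord_inj)
      then have f\<gamma>: "f (\<phi> u) = \<gamma>" by (simp add: prod_eq_iff)
      have "hgrad A q \<bullet> unit_grad A c q > 0"
      proof -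
        have t: "fst q > 0" using qH by (simp add: H3_def)
        have "(fst q)\<^sup>2 * (hgrad A q \<bullet> hgrad A q) > 0" unfolding norm_hgrad[OF qH(1)] qH(2) using c by simp
        then have "(fst q)\<^sup>2 * (hgrad A q \<bullet> hgrad A q) / k > 0" using k by simp
        then show ?thesis by (simp add: unit_grad_def k_def)
      qed
      then have "crosses_at A c (f (\<phi> u)) r" by (simp add: crosses_at_def f\<gamma> g(2,3) qH)
      then have "geodesic (f (\<phi> u)) r \<in> S" using pf(4)[OF u(1)] unfolding S_def by blast
      then show "q \<in> S" by (simp add: f\<gamma> g)
    qed
    moreover have "openin (top_of_set (quadric A c)) (quadric A c \<inter> T)" using T by (rule_tac openin_open_Int)
    moreover have "q0 \<in> quadric A c \<inter> T" using q0 SQ T by blast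
    ultimately show "\<exists>T. openin (top_of_set (quadric A c)) T \<and> q0 \<in> T \<and> T \<subseteq> S" by blast
  qed
qed

section \<open>End points and horospheres\<close>

definition start_point :: "sphere \<Rightarrow> sphere" where
  "start_point s = (case s of None \<Rightarrow> None | Some \<mu> \<Rightarrow> Some (- \<mu>))"

definition end_point :: "sphere \<Rightarrow> sphere" where
  "end_point s = (case s of None \<Rightarrow> Some 0 | Some \<mu> \<Rightarrow> if \<mu> = 0 then None else Some (1 / cnj \<mu>))"

lemma start_point_inj: "start_point s = start_point s' \<Longrightarrow> s = s'"
  by (cases s; cases s') (auto simp: start_point_def)

lemma end_point_inj: "end_point s = end_point s' \<Longrightarrow> s = s'"
  by (cases s; cases s') (auto simp: end_point_def split: if_splits)

lemma inverse_cosh_tendsto_0: "((\<lambda>r. k / (l * cosh r)) \<longlongrightarrow> 0) at_top" "((\<lambda>r. k / (l * cosh r)) \<longlongrightarrow> 0) at_bot" for k l :: real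
proof -
  have 1: "((\<lambda>r :: real. inverse (cosh r)) \<longlongrightarrow> 0) at_top" "((\<lambda>r :: real. inverse (cosh r)) \<longlongrightarrow> 0) at_bot"
    by (auto intro: tendsto_inverse_0_at_top cosh_real_at_top cosh_real_at_bot)
  have "k / (l * cosh r) = k / l * inverse (cosh r)" for r by (simp add: divide_inverse)
  then show "((\<lambda>r. k / (l * cosh r)) \<longlongrightarrow> 0) at_top" "((\<lambda>r. k / (l * cosh r)) \<longlongrightarrow> 0) at_bot"
    using tendsto_mult_right_zero[OF 1(1), of "k / l"] tendsto_mult_right_zero[OF 1(2), of "k / l"] by simp_all
qed

lemma exp_line_at_infinity:
  "filterlim (\<lambda>r :: real. (exp r, z :: complex)) at_infinity at_top" "filterlim (\<lambda>r :: real. (exp (- r), z :: complex)) at_infinity at_bot"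
proof -
  have n: "exp r \<le> norm (exp r, z)" for r :: real by (simp add: norm_Pair real_le_rsqrt)
  have 1: "filterlim (\<lambda>r :: real. exp r) at_top at_top" by (rule exp_at_top)
  have 2: "filterlim (\<lambda>r :: real. exp (- r)) at_top at_bot"
    by (rule filterlim_compose[OF exp_at_top filterlim_uminus_at_top_at_bot])
  show "filterlim (\<lambda>r :: real. (exp r, z)) at_infinity at_top"
  proof (rule filterlim_norm_at_top_imp_at_infinity)
    show "filterlim (\<lambda>r :: real. norm (exp r, z)) at_top at_top"
      by (rule filterlim_at_top_mono[OF 1]) (rule always_eventually, rule allI, rule n)
  qed
  show "filterlim (\<lambda>r :: real. (exp (- r), z)) at_infinity at_bot"
  proof (rule filterlim_norm_at_top_imp_at_infinity)
    show "filterlim (\<lambda>r :: real. norm (exp (- r), z)) at_top at_bot"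
      by (rule filterlim_at_top_mono[OF 2]) (rule always_eventually, rule allI, rule n)
  qed
qed

lemma exp_minus_tendsto: "((\<lambda>r. exp (- r)) \<longlongrightarrow> (0::real)) at_top" "((\<lambda>r. exp r) \<longlongrightarrow> (0::real)) at_bot"
  using filterlim_compose[OF exp_at_bot filterlim_uminus_at_bot_at_top] exp_at_bot by (auto simp: filterlim_at)

text \<open>This connects the homogeneous coordinates of the end points with the limits in the half space.\<close>

lemma geodesic_tends_to_end_point:
  assumes "\<gamma> \<in> LH3"
  shows "tends_to_boundary (geodesic \<gamma>) (end_point (snd \<gamma>)) at_top"
    and "tends_to_boundary (geodesic \<gamma>) (start_point (fst \<gamma>)) at_bot"
proof -
  obtain s1 s2 where g: "\<gamma> = (s1, s2)" by (cases \<gamma>)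
  have tt: "((\<lambda>r. X + Y * of_real (tanh r)) \<longlongrightarrow> X + Y) at_top" "((\<lambda>r. X + Y * of_real (tanh r)) \<longlongrightarrow> X - Y) at_bot" for X Y :: complex
    using tendsto_add[OF tendsto_const tendsto_mult[OF tendsto_const tendsto_of_real[OF tanh_real_at_top]], of X Y]
      tendsto_add[OF tendsto_const tendsto_mult[OF tendsto_const tendsto_of_real[OF tanh_real_at_bot]], of X Y] by simp_all
  have "tends_to_boundary (geodesic (s1, s2)) (end_point s2) at_top \<and> tends_to_boundary (geodesic (s1, s2)) (start_point s1) at_bot"
  proof (cases s1; cases s2)
    fix \<mu>1 \<mu>2 assume s: "s1 = Some \<mu>1" "s2 = Some \<mu>2"
    show ?thesis
    proof (cases "\<mu>2 = 0")
      case True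
      have "geodesic (s1, s2) = (\<lambda>r. (exp r, - \<mu>1))" by (rule ext) (simp add: s True)
      then show ?thesis using exp_line_at_infinity(1)[of "- \<mu>1"] tendsto_Pair[OF exp_minus_tendsto(2) tendsto_const, of "- \<mu>1"]
        by (simp add: s True end_point_def start_point_def)
    next
      case False
      have eq: "geodesic (s1, s2) = (\<lambda>r. (cmod (1 + cnj \<mu>1 * \<mu>2) / (2 * cmod \<mu>2 * cosh r),
            (1 - \<mu>1 * cnj \<mu>2) / (2 * cnj \<mu>2) + (1 + \<mu>1 * cnj \<mu>2) / (2 * cnj \<mu>2) * of_real (tanh r)))"
        by (rule ext) (simp add: s False)
      have "(1 - \<mu>1 * cnj \<mu>2) / (2 * cnj \<mu>2) + (1 + \<mu>1 * cnj \<mu>2) / (2 * cnj \<mu>2) = 1 / cnj \<mu>2"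
        "(1 - \<mu>1 * cnj \<mu>2) / (2 * cnj \<mu>2) - (1 + \<mu>1 * cnj \<mu>2) / (2 * cnj \<mu>2) = - \<mu>1"
        using False by (simp_all add: field_simps)
      then have l: "((\<lambda>r. (1 - \<mu>1 * cnj \<mu>2) / (2 * cnj \<mu>2) + (1 + \<mu>1 * cnj \<mu>2) / (2 * cnj \<mu>2) * of_real (tanh r)) \<longlongrightarrow> 1 / cnj \<mu>2) at_top"
        "((\<lambda>r. (1 - \<mu>1 * cnj \<mu>2) / (2 * cnj \<mu>2) + (1 + \<mu>1 * cnj \<mu>2) / (2 * cnj \<mu>2) * of_real (tanh r)) \<longlongrightarrow> - \<mu>1) at_bot"
        using tt[of "(1 - \<mu>1 * cnj \<mu>2) / (2 * cnj \<mu>2)" "(1 + \<mu>1 * cnj \<mu>2) / (2 * cnj \<mu>2)"] by (simp_all only:)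
      have "(geodesic (s1, s2) \<longlongrightarrow> (0, 1 / cnj \<mu>2)) at_top" unfolding eq by (rule tendsto_Pair[OF inverse_cosh_tendsto_0(1) l(1)])
      moreover have "(geodesic (s1, s2) \<longlongrightarrow> (0, - \<mu>1)) at_bot" unfolding eq by (rule tendsto_Pair[OF inverse_cosh_tendsto_0(2) l(2)])
      ultimately show ?thesis using False by (simp add: s end_point_def start_point_def)
    qed
  next
    fix \<mu>1 assume s: "s1 = Some \<mu>1" "s2 = None"
    have eq: "geodesic (s1, s2) = (\<lambda>r. (cmod \<mu>1 / (2 * cosh r), - \<mu>1 / 2 + \<mu>1 / 2 * of_real (tanh r)))"
      by (rule ext) (simp add: s)
    have l: "((\<lambda>r. - \<mu>1 / 2 + \<mu>1 / 2 * of_real (tanh r)) \<longlongrightarrow> 0) at_top" "((\<lambda>r. - \<mu>1 / 2 + \<mu>1 / 2 * of_real (tanh r)) \<longlongrightarrow> - \<mu>1) at_bot"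
      using tt[of "- \<mu>1 / 2" "\<mu>1 / 2"] by (simp_all add: field_simps)
    have "(geodesic (s1, s2) \<longlongrightarrow> (0, 0)) at_top" unfolding eq by (rule tendsto_Pair[OF inverse_cosh_tendsto_0(1) l(1)])
    moreover have "(geodesic (s1, s2) \<longlongrightarrow> (0, - \<mu>1)) at_bot" unfolding eq by (rule tendsto_Pair[OF inverse_cosh_tendsto_0(2) l(2)])
    ultimately show ?thesis by (simp add: s end_point_def start_point_def)
  next
    fix \<mu>2 assume s: "s1 = None" "s2 = Some \<mu>2"
    have nz: "\<mu>2 \<noteq> 0" using assms by (auto simp: g s LH3_def antidiagonal_def)
    have eq: "geodesic (s1, s2) = (\<lambda>r. (exp (- r), 1 / cnj \<mu>2))" by (rule ext) (simp add: s)
    show ?thesis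
      using exp_line_at_infinity(2)[of "1 / cnj \<mu>2"] tendsto_Pair[OF exp_minus_tendsto(1) tendsto_const, of "1 / cnj \<mu>2"] nz
      unfolding eq by (simp add: s end_point_def start_point_def)
  next
    assume s: "s1 = None" "s2 = None"
    have eq: "geodesic (s1, s2) = (\<lambda>r. (exp (- r), 0))" by (rule ext) (simp add: s)
    show ?thesis
      using exp_line_at_infinity(2)[of 0] tendsto_Pair[OF exp_minus_tendsto(1) tendsto_const, of 0]
      unfolding eq by (simp add: s end_point_def start_point_def)
  qed
  then show "tends_to_boundary (geodesic \<gamma>) (end_point (snd \<gamma>)) at_top" "tends_to_boundary (geodesic \<gamma>) (start_point (fst \<gamma>)) at_bot"
    by (simp_all add: g)
qed

lemma tends_to_boundary_unique:
  assumes "F \<noteq> bot" "tends_to_boundary c b F" "tends_to_boundary c b' F"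
  shows "b = b'"
  using assms by (cases b; cases b') (auto dest: tendsto_unique not_tendsto_and_filterlim_at_infinity)

text \<open>A common end point \<open>[w]\<close> is in the kernel of \<^term>\<open>point_form w\<close>. The empty congruence, which is possible in
  the definition of a horosphere, is incident with everything.\<close>

lemma horosphere_normals_incident:
  assumes h: "horosphere S N"
  shows "\<exists>A. A \<noteq> 0 \<and> (\<forall>\<gamma>\<in>normal_congruence S N. incident A \<gamma>)"
proof (cases "normal_congruence S N = {}")
  case True
  then show ?thesis by (intro exI[of _ "(1, 0, 0)"]) (simp add: zero_prod_def)
next
  case False
  then obtain \<gamma>0 where g0: "\<gamma>0 \<in> normal_congruence S N" by blast
  obtain v w where vw: "is_start v (fst \<gamma>0)" "is_end w (snd \<gamma>0)" by (rule obtain_lifts)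
  have L: "\<gamma> \<in> LH3" if "\<gamma> \<in> normal_congruence S N" for \<gamma> using that by (simp add: normal_congruence_def)
  have nz: "v \<noteq> 0" "w \<noteq> 0" using vw by (auto simp: is_start_def is_end_def split: option.splits)
  obtain b where "(\<forall>\<gamma>\<in>normal_congruence S N. tends_to_boundary (geodesic \<gamma>) b at_top) \<or>
          (\<forall>\<gamma>\<in>normal_congruence S N. tends_to_boundary (geodesic \<gamma>) b at_bot)"
    using h by (auto simp: horosphere_def)
  then show ?thesis
  proof
    assume b: "\<forall>\<gamma>\<in>normal_congruence S N. tends_to_boundary (geodesic \<gamma>) b at_top"
    have "incident (point_form w) \<gamma>" if g: "\<gamma> \<in> normal_congruence S N" for \<gamma>
    proof -
      have "end_point (snd \<gamma>) = b" "end_point (snd \<gamma>0) = b"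
        using tends_to_boundary_unique[OF trivial_limit_at_top_linorder] geodesic_tends_to_end_point(1) L g g0 b by blast+
      then have w: "is_end w (snd \<gamma>)" using end_point_inj vw by metis
      obtain v' w' where v': "is_start v' (fst \<gamma>)" "is_end w' (snd \<gamma>)" by (rule obtain_lifts)
      show ?thesis unfolding incident_iff_hform[OF v'(1) w] hform_point_form by (simp add: det2_def)
    qed
    then show ?thesis using point_form_nonzero[OF nz(2)] by blast
  next
    assume b: "\<forall>\<gamma>\<in>normal_congruence S N. tends_to_boundary (geodesic \<gamma>) b at_bot"
    have "incident (point_form v) \<gamma>" if g: "\<gamma> \<in> normal_congruence S N" for \<gamma>
    proof -
      have "start_point (fst \<gamma>) = b" "start_point (fst \<gamma>0) = b"
        using tends_to_boundary_unique[OF trivial_limit_at_bot_linorder] geodesic_tends_to_end_point(2) L g g0 b by blast+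
      then have v: "is_start v (fst \<gamma>)" using start_point_inj vw by metis
      obtain v' w' where v': "is_start v' (fst \<gamma>)" "is_end w' (snd \<gamma>)" by (rule obtain_lifts)
      show ?thesis unfolding incident_iff_hform[OF v v'(2)] hform_point_form by (simp add: det2_def)
    qed
    then show ?thesis using point_form_nonzero[OF nz(1)] by blast
  qed
qed

section \<open>Spheres and planes among the level surfaces\<close>

lemma crosses_atI:
  assumes g: "\<gamma> \<in> LH3" and vw: "is_start v (fst \<gamma>)" "is_end w (snd \<gamma>)" and e: "e > 0"
    and 1: "e * hquad A w + hquad A v / e = c * cmod (det2 v w)" and 2: "e * hquad A w - hquad A v / e > 0"
  shows "\<exists>r. crosses_at A c \<gamma> r"
proof -
  have D: "cmod (det2 v w) > 0" using LH3_iff_det2[OF vw] g by simp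
  obtain \<kappa> where \<kappa>: "\<kappa> > 0" "\<And>r. Phi A (geodesic \<gamma> r) = (\<kappa> * exp r * hquad A w + hquad A v / (\<kappa> * exp r)) / cmod (det2 v w)"
    "\<And>r. hgrad A (geodesic \<gamma> r) \<bullet> velocity \<gamma> r = (\<kappa> * exp r * hquad A w - hquad A v / (\<kappa> * exp r)) / cmod (det2 v w)"
    using Phi_along_geodesic[OF g vw] by blast
  have "\<kappa> * exp (ln (e / \<kappa>)) = e" using \<kappa> e by simp
  then have "crosses_at A c \<gamma> (ln (e / \<kappa>))" unfolding crosses_at_def \<kappa>(2,3) using D 1 2 by simp
  then show ?thesis by blast
qed

text \<open>Completing the square shows that for a positive definite form \<open>Phi\<close> attains its minimum at exactly one point.\<close>

lemma sphere_center:
  assumes a: "a > 0" and D: "hdet (a, d, b) > 0"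
  defines "p \<equiv> (sqrt (hdet (a, d, b)) / a, - cnj b / of_real a)"
  shows "p \<in> H3" and "q \<in> H3 \<Longrightarrow> Phi (a, d, b) q > 0"
    and "q \<in> H3 \<Longrightarrow> Phi (a, d, b) q = 2 * sqrt (hdet (a, d, b)) \<Longrightarrow> q = p"
proof -
  define s where "s = sqrt (hdet (a, d, b))"
  have s: "s > 0" "s * s = a * d - (cmod b)\<^sup>2" using D by (simp_all add: s_def) (simp add: hdet_def)
  show "p \<in> H3" using a s by (simp add: p_def H3_def s_def[symmetric])
  \<comment> \<open>completing the square\<close>
  have key: "a * (fst q * Phi (a, d, b) q) = (cmod (of_real a * snd q + cnj b))\<^sup>2 + (a * fst q)\<^sup>2 + s * s" if "q \<in> H3" for q
  proof -
    have E: "fst q * Phi (a, d, b) q = a * (fst q * fst q + snd q \<bullet> snd q) + 2 * Re (b * snd q) + d"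
      using that by (cases q) (simp add: Phi_def H3_def)
    show ?thesis unfolding E s(2) cmod_power2 by (simp add: inner_complex_def power2_eq_square algebra_simps)
  qed
  show "Phi (a, d, b) q > 0" if q: "q \<in> H3"
  proof -
    have "a * (fst q * Phi (a, d, b) q) > 0" unfolding key[OF q] using s(1) by (simp add: add_nonneg_pos)
    then show ?thesis using a q by (simp add: H3_def zero_less_mult_iff)
  qed
  show "q = p" if q: "q \<in> H3" "Phi (a, d, b) q = 2 * sqrt (hdet (a, d, b))"
  proof -
    have "(cmod (of_real a * snd q + cnj b))\<^sup>2 + (a * fst q - s)\<^sup>2 = 0"
      using key[OF q(1)] unfolding q(2) s_def[symmetric] by (simp add: power2_eq_square algebra_simps)
    then have "of_real a * snd q + cnj b = 0" "a * fst q = s" by (simp_all add: sum_power2_eq_zero_iff)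
    then show ?thesis using a by (simp add: p_def prod_eq_iff s_def[symmetric] field_simps add_eq_0_iff)
  qed
qed

text \<open>Along an incident geodesic \<open>Phi\<close> is \<open>2 sqrt (hdet A)\<close> times the hyperbolic cosine of the arc length measured
  from its minimum, and this minimum is the minimum on the whole space.\<close>

lemma sphere_normals_pass_center:
  assumes a: "a > 0" and D: "hdet (a, d, b) > 0" and g: "\<gamma> \<in> LH3" "incident (a, d, b) \<gamma>"
    and cr: "crosses_at (a, d, b) (2 * sqrt (hdet (a, d, b)) * cosh 1) \<gamma> r"
  shows "geodesic \<gamma> (r - 1) = (sqrt (hdet (a, d, b)) / a, - cnj b / of_real a)"
proof -
  define A where "A = (a, d, b)"
  define s where "s = sqrt (hdet A)"
  have s: "s > 0" "s * s = hdet A" using D by (simp_all add: s_def A_def)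
  obtain v w where vw: "is_start v (fst \<gamma>)" "is_end w (snd \<gamma>)" by (rule obtain_lifts)
  have Dt: "cmod (det2 v w) > 0" using LH3_iff_det2[OF vw] g by simp
  obtain \<kappa> where \<kappa>: "\<kappa> > 0" "\<And>r. Phi A (geodesic \<gamma> r) = (\<kappa> * exp r * hquad A w + hquad A v / (\<kappa> * exp r)) / cmod (det2 v w)"
    "\<And>r. hgrad A (geodesic \<gamma> r) \<bullet> velocity \<gamma> r = (\<kappa> * exp r * hquad A w - hquad A v / (\<kappa> * exp r)) / cmod (det2 v w)"
    using Phi_along_geodesic[OF g(1) vw] by blast
  define e where "e = \<kappa> * exp r"
  have e: "e > 0" using \<kappa> by (simp add: e_def)
  define X where "X = e * hquad A w / cmod (det2 v w)"
  define Y where "Y = hquad A v / e / cmod (det2 v w)"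
  have 1: "X + Y = 2 * s * cosh 1" using cr \<kappa>(2)[of r] by (simp add: crosses_at_def X_def Y_def e_def s_def A_def add_divide_distrib)
  have 2: "X - Y > 0" using cr \<kappa>(3)[of r] by (simp add: crosses_at_def X_def Y_def e_def A_def diff_divide_distrib)
  have "hquad A v * hquad A w = s * s * (cmod (det2 v w))\<^sup>2"
    using hform_gram[of A v w] g(2) incident_iff_hform[OF vw] by (simp add: s A_def)
  then have 3: "X * Y = s * s" using e Dt by (simp add: X_def Y_def power2_eq_square field_simps)
  have "(X - Y)\<^sup>2 = (X + Y)\<^sup>2 - 4 * (X * Y)" by (simp add: power2_eq_square algebra_simps)
  also have "\<dots> = (2 * s * sinh 1)\<^sup>2" unfolding 1 3 power_mult_distrib cosh_square_eq by (simp add: power2_eq_square algebra_simps)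
  finally have 4: "X - Y = 2 * s * sinh 1" using 2 s(1) by (simp add: power2_eq_iff_nonneg)
  have XY: "X = s * exp 1" "Y = s * exp (- 1)"
  proof -
    have "X + Y + (X - Y) = 2 * s * cosh 1 + 2 * s * sinh 1" "X + Y - (X - Y) = 2 * s * cosh 1 - 2 * s * sinh 1" unfolding 1 4 by simp_all
    then have "2 * X = 2 * (s * (cosh 1 + sinh 1))" "2 * Y = 2 * (s * (cosh 1 - sinh 1))" by (simp_all add: distrib_left right_diff_distrib)
    then show "X = s * exp 1" "Y = s * exp (- 1)" unfolding cosh_plus_sinh cosh_minus_sinh by simp_all
  qed
  have er: "\<kappa> * exp (r - 1) = e * exp (- 1)" by (simp add: e_def exp_diff exp_minus divide_inverse)
  have "Phi A (geodesic \<gamma> (r - 1)) = X * exp (- 1) + Y * exp 1"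
    unfolding \<kappa>(2) er X_def Y_def using e by (simp add: add_divide_distrib exp_minus divide_inverse algebra_simps)
  also have "\<dots> = 2 * s" unfolding XY by (simp add: mult.assoc exp_minus)
  finally show ?thesis
    using sphere_center(3)[OF a D geodesic_in_H3[OF g(1)]] by (simp add: s_def A_def)
qed

text \<open>Along a geodesic \<open>Phi A\<close> is a combination of \<open>exp r\<close> and \<open>exp (- r)\<close>; if it vanishes to first order, it vanishes.\<close>

lemma totally_geodesic_plane:
  assumes A: "hdet A < 0" and S: "openin (top_of_set (quadric A 0)) S"
  shows "totally_geodesic S"
  unfolding totally_geodesic_def
proof (intro ballI allI impI)
  fix \<gamma> r assume g: "\<gamma> \<in> LH3" and r: "geodesic \<gamma> r \<in> S \<and> velocity \<gamma> r \<in> tangent_plane S (geodesic \<gamma> r)"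
  have SQ: "S \<subseteq> quadric A 0" using S openin_imp_subset by blast
  obtain T where T: "open T" "S = quadric A 0 \<inter> T" using S by (auto simp: openin_open)
  obtain v w where vw: "is_start v (fst \<gamma>)" "is_end w (snd \<gamma>)" by (rule obtain_lifts)
  have D: "cmod (det2 v w) > 0" using LH3_iff_det2[OF vw] g by simp
  obtain \<kappa> where \<kappa>: "\<kappa> > 0" "\<And>r. Phi A (geodesic \<gamma> r) = (\<kappa> * exp r * hquad A w + hquad A v / (\<kappa> * exp r)) / cmod (det2 v w)"
    "\<And>r. hgrad A (geodesic \<gamma> r) \<bullet> velocity \<gamma> r = (\<kappa> * exp r * hquad A w - hquad A v / (\<kappa> * exp r)) / cmod (det2 v w)"
    using Phi_along_geodesic[OF g vw] by blast
  have "hgrad A (geodesic \<gamma> r) \<bullet> velocity \<gamma> r = 0" by (rule tangent_plane_quadric[OF SQ]) (use r in blast)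
  moreover have "Phi A (geodesic \<gamma> r) = 0" using r SQ by (auto simp: quadric_def)
  ultimately have "\<kappa> * exp r * hquad A w - hquad A v / (\<kappa> * exp r) = 0" "\<kappa> * exp r * hquad A w + hquad A v / (\<kappa> * exp r) = 0"
    unfolding \<kappa>(2,3) using D by simp_all
  then have "\<kappa> * exp r * hquad A w = 0" "hquad A v / (\<kappa> * exp r) = 0" by linarith+
  then have "hquad A w = 0" "hquad A v = 0" using \<kappa>(1) by simp_all
  then have "geodesic \<gamma> s \<in> quadric A 0" for s using geodesic_in_H3[OF g] by (simp add: quadric_def \<kappa>(2))
  moreover have "\<forall>\<^sub>F s in nhds r. geodesic \<gamma> s \<in> T"
  proof -
    have "isCont (geodesic \<gamma>) r" using geodesic_has_velocity[OF g] has_vector_derivative_continuous by blast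
    then have "(geodesic \<gamma> \<longlongrightarrow> geodesic \<gamma> r) (nhds r)" by (simp add: isCont_def tendsto_at_iff_tendsto_nhds)
    then show ?thesis using T r by (auto dest: topological_tendstoD)
  qed
  ultimately show "\<forall>\<^sub>F s in nhds r. geodesic \<gamma> s \<in> S" by (simp add: T(2))
qed

text \<open>The sign of the form is chosen so that all geodesics run in the direction of growing \<open>Phi\<close> where they meet the
  level surface used later. For an indefinite or degenerate form, either \<open>hquad A v \<le> 0 \<le> hquad A w\<close> or the
  reverse holds for each geodesic, since the product is not positive and not both numbers are zero; the
  alternative is locally constant on the connected surface.\<close>

lemma normalized_incidence_form:
  assumes im: "immersed_surface M f" and A: "A \<noteq> 0" and inc: "\<And>m. m \<in> M \<Longrightarrow> incident A (f m)"
  shows "\<exists>B. B \<noteq> 0 \<and> (\<forall>m\<in>M. incident B (f m)) \<and> (hdet B > 0 \<longrightarrow> fst B > 0) \<and>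
    (hdet B \<le> 0 \<longrightarrow> (\<forall>m\<in>M. \<forall>v w. is_start v (fst (f m)) \<longrightarrow> is_end w (snd (f m)) \<longrightarrow> hquad B v \<le> 0 \<and> hquad B w \<ge> 0))"
proof -
  have M: "M \<noteq> {}" "connected M" "f ` M \<subseteq> LH3" "\<And>m. m \<in> M \<Longrightarrow> \<exists>i j U \<phi>. LH3_patch M f i j U \<phi> \<and> m \<in> \<phi> ` U"
    using im by (auto simp: immersed_surface_def)
  define C where "C = - A"
  have C: "C \<noteq> 0" "C = (-1) *\<^sub>R A" using A by (simp_all add: C_def)
  have hC: "hquad C x = - hquad A x" for x using hquad_linear[of "-1" A 0 A x] by (simp add: C_def)
  have dC: "hdet C = hdet A" "fst C = - fst A" by (cases A; simp add: C_def hdet_def)+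
  have iC: "incident C (f m)" if "m \<in> M" for m unfolding C(2) by (rule incident_scaleR[OF inc[OF that]])
  show ?thesis
  proof (cases "hdet A > 0")
    case True
    obtain a d b where Ae: "A = (a, d, b)" by (cases A)
    have "a \<noteq> 0" using True by (auto simp: Ae hdet_def)
    then have "fst A > 0 \<or> fst C > 0" by (auto simp: dC Ae)
    then show ?thesis using True A C inc iC dC by (metis not_less)
  next
    case False
    \<comment> \<open>\<open>P\<close> and \<open>Q\<close> say that the geodesic crosses against and along the growth of \<open>Phi A\<close>\<close>
    define P where "P = (\<lambda>m. \<exists>v w. is_start v (fst (f m)) \<and> is_end w (snd (f m)) \<and> (hquad A v > 0 \<or> hquad A w < 0))"
    define Q where "Q = (\<lambda>m. \<exists>v w. is_start v (fst (f m)) \<and> is_end w (snd (f m)) \<and> (hquad A v < 0 \<or> hquad A w > 0))"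
    have sgn: "\<not> (P m \<and> Q m)" "P m \<or> Q m" if m: "m \<in> M" for m
    proof -
      obtain v w where vw: "is_start v (fst (f m))" "is_end w (snd (f m))" by (rule obtain_lifts)
      have D: "det2 v w \<noteq> 0" using LH3_iff_det2[OF vw] M(3) m by auto
      have E: "hform A v w = 0" using incident_iff_hform[OF vw] inc[OF m] by simp
      have prod: "hquad A v * hquad A w \<le> 0"
        using hform_gram[of A v w] False E by (simp add: mult_nonpos_nonneg)
      have nz: "hquad A v \<noteq> 0 \<or> hquad A w \<noteq> 0" using herm_eq_0[OF D _ _ E] A by blast
      have sc: "sgn (hquad A v') = sgn (hquad A v)" if st: "is_start v' (fst (f m))" for v'
      proof -
        obtain l where "l \<noteq> 0" "v' = (l * fst v, l * snd v)" using is_start_scale[OF vw(1) st] by blast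
        then show ?thesis using hquad_scale[of A l "fst v" "snd v"] by (simp add: sgn_mult)
      qed
      have sc': "sgn (hquad A w') = sgn (hquad A w)" if st: "is_end w' (snd (f m))" for w'
      proof -
        obtain l where "l \<noteq> 0" "w' = (l * fst w, l * snd w)" using is_end_scale[OF vw(2) st] by blast
        then show ?thesis using hquad_scale[of A l "fst w" "snd w"] by (simp add: sgn_mult)
      qed
      have Pe: "P m \<longleftrightarrow> hquad A v > 0 \<or> hquad A w < 0"
        unfolding P_def using sc sc' vw by (metis sgn_greater sgn_less)
      have Qe: "Q m \<longleftrightarrow> hquad A v < 0 \<or> hquad A w > 0"
        unfolding Q_def using sc sc' vw by (metis sgn_greater sgn_less)
      show "\<not> (P m \<and> Q m)" unfolding Pe Qe using prod by (auto simp: mult_le_0_iff)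
      show "P m \<or> Q m" unfolding Pe Qe using nz by auto
    qed
    have op: "\<exists>T. openin (top_of_set M) T \<and> m \<in> T \<and> (\<forall>x\<in>T. P m = P x)" if m: "m \<in> M" for m
    proof -
      obtain i j U \<phi> where Pt: "LH3_patch M f i j U \<phi>" and "m \<in> \<phi> ` U" using M(4)[OF m] by blast
      then obtain u where u: "u \<in> U" "m = \<phi> u" by blast
      define F where "F = chart i j \<circ> f \<circ> \<phi>"
      note pf = LH3_patch_regular[OF Pt M(3), folded F_def]
      obtain \<psi> where hom: "homeomorphism U (\<phi> ` U) \<phi> \<psi>" using pf(3) by blast
      define v where "v = (\<lambda>u. start_lift i (fst (F u)))"
      define w where "w = (\<lambda>u. end_lift j (snd (F u)))"
      have cv: "continuous_on U (\<lambda>u. hquad A (v u))" "continuous_on U (\<lambda>u. hquad A (w u))"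
        unfolding v_def w_def
        by (auto intro!: continuous_on_compose2[OF continuous_on_hquad] continuous_on_compose2[OF continuous_on_lifts(1)] continuous_on_compose2[OF continuous_on_lifts(2)] continuous_intros pf(7))
      have PU: "hquad A (v x) > 0 \<or> hquad A (w x) < 0 \<Longrightarrow> P (\<phi> x)" "hquad A (v x) < 0 \<or> hquad A (w x) > 0 \<Longrightarrow> Q (\<phi> x)" if "x \<in> U" for x
        unfolding P_def Q_def using pf(9,10)[OF that] unfolding v_def w_def by blast+
      have nb: "\<exists>T. openin (top_of_set M) T \<and> m \<in> T \<and> (\<forall>x\<in>T. P m = P x)"
        if G: "continuous_on U G" "G u > 0" "\<And>x. x \<in> U \<Longrightarrow> G x > 0 \<Longrightarrow> R (\<phi> x)" "\<And>x y. R x \<Longrightarrow> R y \<Longrightarrow> x \<in> M \<Longrightarrow> y \<in> M \<Longrightarrow> P x = P y" for G :: "complex \<Rightarrow> real" and R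
      proof (intro exI conjI)
        define V where "V = U \<inter> G -` {0<..}"
        have "open V" unfolding V_def by (rule continuous_open_preimage[OF G(1) pf(1)]) simp
        then show "openin (top_of_set M) (\<phi> ` V)" by (intro openin_patch_image[OF hom pf(1,2)]) (auto simp: V_def)
        show "m \<in> \<phi> ` V" using u G(2) by (auto simp: V_def)
        show "\<forall>x\<in>\<phi> ` V. P m = P x"
        proof
          fix x assume "x \<in> \<phi> ` V"
          then obtain y where y: "y \<in> U" "G y > 0" "x = \<phi> y" by (auto simp: V_def)
          show "P m = P x" unfolding u(2) y(3) by (rule G(4)[OF G(3)[OF u(1) G(2)] G(3)[OF y(1,2)] pf(4)[OF u(1)] pf(4)[OF y(1)]])
        qed
      qed
      have PP: "P x = P y" if "P x" "P y" "x \<in> M" "y \<in> M" for x y using that by simp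
      have QQ: "P x = P y" if "Q x" "Q y" "x \<in> M" "y \<in> M" for x y using sgn(1) that by blast
      have D: "det2 (v u) (w u) \<noteq> 0" using pf(11)[OF u(1)] by (simp add: v_def w_def)
      have "hform A (v u) (w u) = 0" using incident_iff_hform[OF pf(9,10)[OF u(1)]] inc[OF m] u(2) by (simp add: v_def w_def)
      then have "hquad A (v u) \<noteq> 0 \<or> hquad A (w u) \<noteq> 0" using herm_eq_0[OF D] A by blast
      then consider "hquad A (v u) > 0" | "- hquad A (v u) > 0" | "hquad A (w u) > 0" | "- hquad A (w u) > 0" by linarith
      then show ?thesis
      proof cases
        case 1 show ?thesis by (rule nb[OF cv(1) _ _ PP]) (use 1 PU in auto)
      next
        case 2 show ?thesis by (rule nb[OF continuous_on_minus[OF cv(1)] _ _ QQ]) (use 2 PU in auto)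
      next
        case 3 show ?thesis by (rule nb[OF cv(2) _ _ QQ]) (use 3 PU in auto)
      next
        case 4 show ?thesis by (rule nb[OF continuous_on_minus[OF cv(2)] _ _ PP]) (use 4 PU in auto)
      qed
    qed
    have const: "P x = P y" if "x \<in> M" "y \<in> M" for x y
      by (rule connected_equivalence_relation[OF M(2) that, of "\<lambda>x y. P x = P y"]) (use op in auto)
    show ?thesis
    proof (cases "\<forall>m\<in>M. P m")
      case True
      then have nQ: "\<not> Q m" if "m \<in> M" for m using sgn(1) that by blast
      have "hquad C v \<le> 0 \<and> hquad C w \<ge> 0" if "m \<in> M" "is_start v (fst (f m))" "is_end w (snd (f m))" for m v w
      proof -
        have "\<not> (hquad A v < 0 \<or> hquad A w > 0)" using nQ[OF that(1)] that(2,3) unfolding Q_def by blast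
        then show ?thesis by (simp add: hC)
      qed
      then show ?thesis using C(1) iC False dC by (intro exI[of _ C]) auto
    next
      case nP: False
      then have nP': "\<not> P m" if "m \<in> M" for m using const that by blast
      have "hquad A v \<le> 0 \<and> hquad A w \<ge> 0" if "m \<in> M" "is_start v (fst (f m))" "is_end w (snd (f m))" for m v w
      proof -
        have "\<not> (hquad A v > 0 \<or> hquad A w < 0)" using nP'[OF that(1)] that(2,3) unfolding P_def by blast
        then show ?thesis by simp
      qed
      then show ?thesis using A inc False by (intro exI[of _ A]) auto
    qed
  qed
qed

section \<open>Second derivatives and curves in a patch\<close>

text \<open>The mean value theorem, applied first in the direction \<open>v\<close> and then in the direction \<open>w\<close>.\<close>

lemma second_difference:
  fixes g :: "complex \<Rightarrow> real"
  assumes U: "ball u r \<subseteq> U" and h: "h > 0" "h * (norm v + norm w) < r"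
    and d1: "\<And>x. x \<in> U \<Longrightarrow> (g has_derivative D x) (at x)"
    and d2: "\<And>x. x \<in> U \<Longrightarrow> ((\<lambda>x. D x v) has_derivative H x) (at x)"
  shows "\<exists>p. dist u p \<le> h * (norm v + norm w) \<and>
    g (u + h *\<^sub>R v + h *\<^sub>R w) - g (u + h *\<^sub>R v) - g (u + h *\<^sub>R w) + g u = h\<^sup>2 * H p w"
proof -
  have d: "dist u (u + x *\<^sub>R v + y *\<^sub>R w) \<le> h * (norm v + norm w)" if "0 \<le> x" "x \<le> h" "0 \<le> y" "y \<le> h" for x y
  proof -
    have "u - (u + x *\<^sub>R v + y *\<^sub>R w) = - (x *\<^sub>R v + y *\<^sub>R w)" by (simp only: add.assoc diff_add_eq_diff_diff_swap) simp
    then have "dist u (u + x *\<^sub>R v + y *\<^sub>R w) \<le> norm (x *\<^sub>R v) + norm (y *\<^sub>R w)"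
      unfolding dist_norm by (simp only: norm_minus_cancel norm_triangle_ineq)
    also have "\<dots> \<le> h * norm v + h * norm w" using that by (auto intro!: add_mono mult_right_mono)
    finally show ?thesis by (simp add: distrib_left)
  qed
  have inU: "u + x *\<^sub>R v + y *\<^sub>R w \<in> U" if "0 \<le> x" "x \<le> h" "0 \<le> y" "y \<le> h" for x y
    using d[OF that] h(2) U by (auto simp: subset_iff)
  have e1: "((\<lambda>x. g (u + x *\<^sub>R v + y *\<^sub>R w)) has_real_derivative D (u + x *\<^sub>R v + y *\<^sub>R w) v) (at x)"
    if "0 \<le> x" "x \<le> h" "0 \<le> y" "y \<le> h" for x y
  proof -
    have "((\<lambda>x. u + x *\<^sub>R v + y *\<^sub>R w) has_derivative (\<lambda>k. k *\<^sub>R v)) (at x)" by (auto intro!: derivative_eq_intros)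
    from has_derivative_compose[OF this d1[OF inU[OF that]]]
    show ?thesis
      using linear_scale[OF bounded_linear.linear[OF has_derivative_bounded_linear[OF d1[OF inU[OF that]]]]]
      by (simp add: has_field_derivative_def mult_commute_abs)
  qed
  have e2: "((\<lambda>y. D (u + x *\<^sub>R v + y *\<^sub>R w) v) has_real_derivative H (u + x *\<^sub>R v + y *\<^sub>R w) w) (at y)"
    if "0 \<le> x" "x \<le> h" "0 \<le> y" "y \<le> h" for x y
  proof -
    have "((\<lambda>y. u + x *\<^sub>R v + y *\<^sub>R w) has_derivative (\<lambda>k. k *\<^sub>R w)) (at y)" by (auto intro!: derivative_eq_intros)
    from has_derivative_compose[OF this d2[OF inU[OF that]]]
    show ?thesis
      using linear_scale[OF bounded_linear.linear[OF has_derivative_bounded_linear[OF d2[OF inU[OF that]]]]]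
      by (simp add: has_field_derivative_def mult_commute_abs)
  qed
  define \<theta> where "\<theta> = (\<lambda>x. g (u + x *\<^sub>R v + h *\<^sub>R w) - g (u + x *\<^sub>R v + 0 *\<^sub>R w))"
  have "\<exists>x. 0 < x \<and> x < h \<and> \<theta> h - \<theta> 0 = (h - 0) * (D (u + x *\<^sub>R v + h *\<^sub>R w) v - D (u + x *\<^sub>R v + 0 *\<^sub>R w) v)"
    unfolding \<theta>_def by (rule MVT2[OF h(1)]) (intro DERIV_diff e1; use h(1) in simp)
  then obtain x where x: "0 < x" "x < h" "\<theta> h - \<theta> 0 = h * (D (u + x *\<^sub>R v + h *\<^sub>R w) v - D (u + x *\<^sub>R v + 0 *\<^sub>R w) v)" by auto
  have "\<exists>y. 0 < y \<and> y < h \<and> D (u + x *\<^sub>R v + h *\<^sub>R w) v - D (u + x *\<^sub>R v + 0 *\<^sub>R w) v = (h - 0) * H (u + x *\<^sub>R v + y *\<^sub>R w) w"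
    by (rule MVT2[OF h(1)]) (intro e2; use x in simp)
  then obtain y where y: "0 < y" "y < h" "D (u + x *\<^sub>R v + h *\<^sub>R w) v - D (u + x *\<^sub>R v + 0 *\<^sub>R w) v = h * H (u + x *\<^sub>R v + y *\<^sub>R w) w" by auto
  have "g (u + h *\<^sub>R v + h *\<^sub>R w) - g (u + h *\<^sub>R v) - g (u + h *\<^sub>R w) + g u = \<theta> h - \<theta> 0" by (simp add: \<theta>_def)
  also have "\<dots> = h\<^sup>2 * H (u + x *\<^sub>R v + y *\<^sub>R w) w" unfolding x(3) y(3) by (simp add: power2_eq_square)
  finally show ?thesis using d[of x y] x y by (intro exI[of _ "u + x *\<^sub>R v + y *\<^sub>R w"]) auto
qed

text \<open>The second difference quotient is symmetric in the two directions and converges to both second derivatives.\<close>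

lemma second_derivative_symmetric_real:
  fixes g :: "complex \<Rightarrow> real"
  assumes U: "open U" "u \<in> U"
    and d1: "\<And>x. x \<in> U \<Longrightarrow> (g has_derivative D x) (at x)"
    and d2: "\<And>v x. x \<in> U \<Longrightarrow> ((\<lambda>x. D x v) has_derivative H v x) (at x)"
    and c: "\<And>v w. continuous_on U (\<lambda>x. H v x w)"
  shows "H v u w = H w u v"
proof (rule ccontr)
  assume ne: "H v u w \<noteq> H w u v"
  define e where "e = \<bar>H v u w - H w u v\<bar> / 2"
  have e: "e > 0" using ne by (simp add: e_def)
  obtain r where r: "r > 0" "ball u r \<subseteq> U" using U open_contains_ball by blast
  obtain r1 where r1: "r1 > 0" "\<And>x. x \<in> U \<Longrightarrow> dist x u < r1 \<Longrightarrow> dist (H v x w) (H v u w) < e"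
    using c[of v w] U(2) e unfolding continuous_on_iff by blast
  obtain r2 where r2: "r2 > 0" "\<And>x. x \<in> U \<Longrightarrow> dist x u < r2 \<Longrightarrow> dist (H w x v) (H w u v) < e"
    using c[of w v] U(2) e unfolding continuous_on_iff by blast
  define R where "R = Min {r, r1, r2}"
  have R: "R > 0" "R \<le> r" "R \<le> r1" "R \<le> r2" using r r1 r2 by (auto simp: R_def)
  define h where "h = R / (2 * (norm v + norm w + 1))"
  have pos: "norm v + norm w + 1 > 0" by (smt (verit) norm_ge_zero)
  have h: "h > 0" using R pos by (simp add: h_def)
  have "h * (norm v + norm w) \<le> h * (norm v + norm w + 1)" using h by (intro mult_left_mono) auto
  also have "\<dots> = R / 2" using pos by (simp add: h_def field_simps)
  finally have hR: "h * (norm v + norm w) < R" using R by linarith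
  obtain p where p: "dist u p \<le> h * (norm v + norm w)"
    "g (u + h *\<^sub>R v + h *\<^sub>R w) - g (u + h *\<^sub>R v) - g (u + h *\<^sub>R w) + g u = h\<^sup>2 * H v p w"
    using second_difference[of u r U h v w g D "H v", OF r(2) h _ d1 d2] hR R by auto
  obtain q where q: "dist u q \<le> h * (norm w + norm v)"
    "g (u + h *\<^sub>R w + h *\<^sub>R v) - g (u + h *\<^sub>R w) - g (u + h *\<^sub>R v) + g u = h\<^sup>2 * H w q v"
    using second_difference[of u r U h w v g D "H w", OF r(2) h _ d1 d2] hR R by (auto simp: add.commute)
  have "h\<^sup>2 * H v p w = h\<^sup>2 * H w q v"
    unfolding p(2)[symmetric] q(2)[symmetric] by (simp add: add.commute add.left_commute)
  then have eq: "H v p w = H w q v" using h by simp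
  have "dist p u < R" "dist q u < R" using p(1) q(1) hR by (auto simp: dist_commute add.commute)
  then have "dist (H v p w) (H v u w) < e" "dist (H w q v) (H w u v) < e"
    using r1(2)[of p] r2(2)[of q] R r(2) by (auto simp: subset_iff dist_commute)
  then have "\<bar>H v p w - H v u w\<bar> < e" "\<bar>H v p w - H w u v\<bar> < e" unfolding dist_real_def eq by simp_all
  then have "\<bar>H v u w - H w u v\<bar> < 2 * e" by arith
  then show False by (simp add: e_def)
qed

lemma second_derivative_symmetric:
  fixes \<phi> :: "complex \<Rightarrow> half_space"
  assumes U: "open U" "u \<in> U" and t: "\<And>k. times_differentiable_on k \<phi> U"
  shows "frechet_derivative (\<lambda>x. frechet_derivative \<phi> (at x) v) (at u) w = frechet_derivative (\<lambda>x. frechet_derivative \<phi> (at x) w) (at u) v"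
proof -
  define D where "D x v = frechet_derivative \<phi> (at x) v" for x v
  define H where "H v x w = frechet_derivative (\<lambda>x. D x v) (at x) w" for v x w
  have d1: "(\<phi> has_derivative D x) (at x)" if "x \<in> U" for x
    using times_differentiable_on_SucD(1)[OF t[of "Suc 0"] that] unfolding D_def .
  have t2: "times_differentiable_on (Suc 0) (\<lambda>x. D x v) U" for v
    using times_differentiable_on_SucD(2)[OF t[of "Suc (Suc 0)"], of v] unfolding D_def .
  have d2: "((\<lambda>x. D x v) has_derivative H v x) (at x)" if "x \<in> U" for x v
    using times_differentiable_on_SucD(1)[OF t2 that, of v] unfolding H_def[abs_def] .
  have c: "continuous_on U (\<lambda>x. H v x w)" for v w
    using times_differentiable_on_SucD(2)[OF t2, of v w] unfolding H_def by simp
  have "H v u w \<bullet> e = H w u v \<bullet> e" for e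
  proof (rule second_derivative_symmetric_real[OF U, where g = "\<lambda>x. \<phi> x \<bullet> e" and D = "\<lambda>x v. D x v \<bullet> e" and H = "\<lambda>v x w. H v x w \<bullet> e"])
    show "((\<lambda>x. \<phi> x \<bullet> e) has_derivative (\<lambda>v. D x v \<bullet> e)) (at x)" if "x \<in> U" for x
      by (rule has_derivative_inner_left[OF d1[OF that]])
    show "((\<lambda>x. D x v \<bullet> e) has_derivative (\<lambda>w. H v x w \<bullet> e)) (at x)" if "x \<in> U" for x v
      by (rule has_derivative_inner_left[OF d2[OF that]])
    show "continuous_on U (\<lambda>x. H v x w \<bullet> e)" for v w by (intro continuous_intros c)
  qed
  then have "H v u w = H w u v" by (metis inner_eq_zero_iff inner_diff_left right_minus_eq)
  then show ?thesis unfolding H_def D_def .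
qed

text \<open>The cross product of three-dimensional vectors, written for pairs of a real and a complex number.\<close>

definition cross :: "half_space \<Rightarrow> half_space \<Rightarrow> half_space" where
  "cross x y = (Im (cnj (snd x) * snd y), \<i> * (of_real (fst x) * snd y - of_real (fst y) * snd x))"

lemma cross_cross: "cross (cross x y) z = (x \<bullet> z) *\<^sub>R y - (y \<bullet> z) *\<^sub>R x"
  by (cases x; cases y; cases z) (simp add: cross_def inner_complex_def complex_eq_iff algebra_simps)

lemma cross_zero_left: "cross 0 x = 0"
  by (simp add: cross_def zero_prod_def)

text \<open>A normal field is given as continuous only. Being parallel to the cross product of two tangent fields and of
  given length, it is differentiable.\<close>

lemma cross_differentiable:
  assumes "x differentiable (at u)" "y differentiable (at u)"
  shows "(\<lambda>u. cross (x u) (y u)) differentiable (at (u :: complex))"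
proof -
  obtain X Y where d: "(x has_derivative X) (at u)" "(y has_derivative Y) (at u)" using assms by (auto simp: differentiable_def)
  note dd = has_derivative_fst[OF d(1)] has_derivative_snd[OF d(1)] has_derivative_fst[OF d(2)] has_derivative_snd[OF d(2)]
  have c: "((\<lambda>u. cnj (snd (x u)) * snd (y u)) has_derivative (\<lambda>h. cnj (snd (x u)) * snd (Y h) + cnj (snd (X h)) * snd (y u))) (at u)"
    by (rule has_derivative_mult[OF bounded_linear.has_derivative[OF bounded_linear_cnj dd(2)] dd(4)])
  have "(\<lambda>u. Im (cnj (snd (x u)) * snd (y u))) differentiable (at u)"
    using bounded_linear.has_derivative[OF bounded_linear_Im c] unfolding differentiable_def by blast
  moreover have "(\<lambda>u. \<i> * (of_real (fst (x u)) * snd (y u) - of_real (fst (y u)) * snd (x u))) differentiable (at u)"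
    by (rule differentiableI[OF has_derivative_mult_right[OF has_derivative_diff[OF
            has_derivative_mult[OF has_derivative_of_real[OF dd(1)] dd(4)] has_derivative_mult[OF has_derivative_of_real[OF dd(3)] dd(2)]]]])
  ultimately obtain D1 D2 where "((\<lambda>u. Im (cnj (snd (x u)) * snd (y u))) has_derivative D1) (at u)"
    "((\<lambda>u. \<i> * (of_real (fst (x u)) * snd (y u) - of_real (fst (y u)) * snd (x u))) has_derivative D2) (at u)"
    unfolding differentiable_def by blast
  from has_derivative_Pair[OF this] show ?thesis unfolding cross_def differentiable_def by blast
qed

lemma normal_parallel_cross:
  assumes "n \<bullet> x = 0" "n \<bullet> y = 0"
  shows "(cross x y \<bullet> cross x y) *\<^sub>R n = (n \<bullet> cross x y) *\<^sub>R cross x y"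
proof -
  have "cross (cross x y) n = 0" using assms by (simp add: cross_cross inner_commute[of _ n])
  then have "cross (cross (cross x y) n) (cross x y) = 0" by (simp only: cross_zero_left)
  then have "(cross x y \<bullet> cross x y) *\<^sub>R n - (n \<bullet> cross x y) *\<^sub>R cross x y = 0" by (simp only: cross_cross[of "cross x y"])
  then show ?thesis by simp
qed

lemma cross_nonzero:
  assumes L: "linear L" "inj L"
  shows "cross (L (1 :: complex)) (L \<i>) \<noteq> 0"
proof
  assume "cross (L 1) (L \<i>) = 0"
  then have "(L 1 \<bullet> L 1) *\<^sub>R L \<i> = (L \<i> \<bullet> L 1) *\<^sub>R L 1" using cross_cross[of "L 1" "L \<i>" "L 1"] by (simp add: cross_zero_left)
  then have "L ((L 1 \<bullet> L 1) *\<^sub>R \<i>) = L ((L \<i> \<bullet> L 1) *\<^sub>R 1)" by (simp only: linear_scale[OF L(1)])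
  then have "(L 1 \<bullet> L 1) *\<^sub>R \<i> = (L \<i> \<bullet> L 1) *\<^sub>R 1" using L(2) by (simp add: inj_eq)
  then have "L 1 \<bullet> L 1 = 0" by (simp add: complex_eq_iff)
  then have "L 1 = L 0" by (simp add: linear_0[OF L(1)])
  then show False using L(2) by (simp add: inj_eq)
qed

text \<open>The parametrisation is only known to be a homeomorphism with injective differential, so the inverse is first
  known to be continuous along the curve. Composing the patch with a left inverse of its differential gives a map with
  derivative the identity, and this map compares the lift with the curve to first order.\<close>

lemma curve_lift:
  assumes P: "H3_patch S U \<phi>" and hom: "homeomorphism U (\<phi> ` U) \<phi> \<psi>"
    and c: "(c has_vector_derivative c') (at s0)" and ev: "\<forall>\<^sub>F s in nhds s0. c s \<in> \<phi> ` U"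
  shows "\<exists>w. ((\<lambda>s. \<psi> (c s)) has_vector_derivative w) (at s0) \<and> c' = frechet_derivative \<phi> (at (\<psi> (c s0))) w"
proof -
  obtain N where N: "open N" "s0 \<in> N" "\<And>s. s \<in> N \<Longrightarrow> c s \<in> \<phi> ` U" using ev unfolding eventually_nhds by blast
  define u where "u = (\<lambda>s. \<psi> (c s))"
  have u: "u s \<in> U" "\<phi> (u s) = c s" if "s \<in> N" for s
    using N(3)[OF that] hom by (auto simp: u_def homeomorphism_def)
  define L where "L = frechet_derivative \<phi> (at (u s0))"
  have d\<phi>: "(\<phi> has_derivative L) (at (u s0))" and inj: "inj L"
    using P u(1)[OF N(2)] times_differentiable_on_SucD(1)[of 0 \<phi> U] unfolding H3_patch_def smooth_immersion_on_def L_def by blast+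
  have linL: "linear L" using d\<phi> has_derivative_bounded_linear bounded_linear.linear by blast
  obtain M where M: "linear M" "M \<circ> L = id" using linear_injective_left_inverse[OF linL inj] by blast
  have blM: "bounded_linear M" using M(1) by (simp add: linear_conv_bounded_linear)
  define w where "w = M c'"
  define k where "k = (\<lambda>x. M (\<phi> x))"
  have dk: "(k has_derivative (\<lambda>x. x)) (at (u s0))"
    using bounded_linear.has_derivative[OF blM d\<phi>] M(2) by (simp add: k_def fun_eq_iff)
  have dm: "((\<lambda>s. M (c s)) has_derivative (\<lambda>h. h *\<^sub>R w)) (at s0)"
    using bounded_linear.has_derivative[OF blM c[unfolded has_vector_derivative_def]] by (simp add: w_def linear_scale[OF M(1)])
  have tu: "(u \<longlongrightarrow> u s0) (nhds s0)"
    unfolding tendsto_iff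
  proof (intro allI impI)
    fix e :: real assume e: "e > 0"
    have "continuous_on (\<phi> ` U) \<psi>" using hom by (simp add: homeomorphism_def)
    then obtain d where d: "d > 0" "\<And>y. y \<in> \<phi> ` U \<Longrightarrow> dist y (c s0) < d \<Longrightarrow> dist (\<psi> y) (\<psi> (c s0)) < e"
      using N(3)[OF N(2)] e unfolding continuous_on_iff by blast
    have "(c \<longlongrightarrow> c s0) (nhds s0)"
      using has_vector_derivative_continuous[OF c] by (simp add: isCont_def tendsto_at_iff_tendsto_nhds)
    then have "\<forall>\<^sub>F s in nhds s0. dist (c s) (c s0) < d" using d(1) by (rule tendstoD)
    with ev show "\<forall>\<^sub>F s in nhds s0. dist (u s) (u s0) < e"
      by eventually_elim (use d in \<open>simp add: u_def\<close>)
  qed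
  have du: "(u has_derivative (\<lambda>h. h *\<^sub>R w)) (at s0)"
    unfolding has_derivative_within_alt2
  proof (intro conjI allI impI)
    show "bounded_linear (\<lambda>h. h *\<^sub>R w)" by (rule bounded_linear_scaleR_left)
    fix e :: real assume e: "e > 0"
    define W where "W = norm w + 1"
    have W: "W > 0" by (simp add: W_def add_nonneg_pos)
    define \<eta> where "\<eta> = min (1 / 2) (e / (4 * W))"
    have \<eta>: "\<eta> > 0" "\<eta> \<le> 1 / 2" "\<eta> \<le> e / (4 * W)" using e W by (auto simp: \<eta>_def)
    have "\<forall>\<^sub>F x in at (u s0). norm (k x - k (u s0) - (x - u s0)) \<le> \<eta> * norm (x - u s0)"
      using dk \<eta>(1) unfolding has_derivative_within_alt2 by blast
    then have "\<forall>\<^sub>F x in nhds (u s0). norm (k x - k (u s0) - (x - u s0)) \<le> \<eta> * norm (x - u s0)"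
      unfolding eventually_at_filter by eventually_elim auto
    then have E1: "\<forall>\<^sub>F s in nhds s0. norm (k (u s) - k (u s0) - (u s - u s0)) \<le> \<eta> * norm (u s - u s0)"
      using tu by (rule eventually_compose_filterlim)
    have E2: "\<forall>\<^sub>F s in at s0. norm (M (c s) - M (c s0) - (s - s0) *\<^sub>R w) \<le> min 1 (e / 2) * norm (s - s0)"
      using dm e unfolding has_derivative_within_alt2 by auto
    have E3: "\<forall>\<^sub>F s in nhds s0. s \<in> N" using N(1,2) by (rule eventually_nhds_in_open)
    have at: "\<forall>\<^sub>F s in at s0. P s" if "\<forall>\<^sub>F s in nhds s0. P s" for P
      using that by (simp add: eventually_at_filter eventually_mono)
    from at[OF E1] E2 at[OF E3] show "\<forall>\<^sub>F s in at s0. norm (u s - u s0 - (s - s0) *\<^sub>R w) \<le> e * norm (s - s0)"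
    proof eventually_elim
      case (elim s)
      define a where "a = u s - u s0"
      define b where "b = M (c s) - M (c s0)"
      define h where "h = norm (s - s0)"
      have h: "h \<ge> 0" by (simp add: h_def)
      have ku: "k (u s) = M (c s)" "k (u s0) = M (c s0)" using u(2)[OF elim(3)] u(2)[OF N(2)] by (simp_all add: k_def)
      have 1: "norm (b - a) \<le> \<eta> * norm a" using elim(1) by (simp add: ku a_def b_def)
      have 2: "norm (b - (s - s0) *\<^sub>R w) \<le> min 1 (e / 2) * h" using elim(2) by (simp add: b_def h_def)
      have "\<eta> * norm a \<le> 1 / 2 * norm a" using \<eta>(2) by (intro mult_right_mono) auto
      moreover have "norm a \<le> norm b + norm (b - a)" using norm_triangle_ineq4[of b "b - a"] by simp
      ultimately have 3: "norm a \<le> 2 * norm b" using 1 by linarith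
      have "norm b \<le> norm (b - (s - s0) *\<^sub>R w) + norm ((s - s0) *\<^sub>R w)" using norm_triangle_ineq[of "b - (s - s0) *\<^sub>R w" "(s - s0) *\<^sub>R w"] by simp
      also have "\<dots> \<le> 1 * h + h * norm w"
        using 2 mult_right_mono[of "min 1 (e / 2)" 1 h] h by (simp add: h_def)
      also have "\<dots> = W * h" by (simp add: W_def algebra_simps)
      finally have 4: "norm a \<le> 2 * (W * h)" using 3 by linarith
      have "\<eta> * norm a \<le> e / (4 * W) * (2 * (W * h))" using \<eta> 4 W h e by (intro mult_mono) auto
      also have "\<dots> = e / 2 * h" using W by simp
      finally have 5: "norm (b - a) \<le> e / 2 * h" using 1 by linarith
      have "min 1 (e / 2) * h \<le> e / 2 * h" using h by (intro mult_right_mono) auto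
      then have 6: "norm (b - (s - s0) *\<^sub>R w) \<le> e / 2 * h" using 2 by linarith
      have "norm (a - (s - s0) *\<^sub>R w) \<le> norm (b - (s - s0) *\<^sub>R w) + norm (b - a)"
        using norm_triangle_ineq4[of "b - (s - s0) *\<^sub>R w" "b - a"] by simp
      then show ?case using 5 6 by (simp add: a_def h_def)
    qed
  qed
  have "((\<lambda>s. \<phi> (u s)) has_derivative (\<lambda>h. L (h *\<^sub>R w))) (at s0)"
    by (rule has_derivative_compose[OF du d\<phi>])
  then have "(c has_derivative (\<lambda>h. L (h *\<^sub>R w))) (at s0)"
    by (rule has_derivative_transform_within_open[OF _ N(1,2)]) (simp add: u(2))
  then have "(\<lambda>h. L (h *\<^sub>R w)) = (\<lambda>h. h *\<^sub>R c')"
    using c unfolding has_vector_derivative_def by (rule has_derivative_unique)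
  then have "c' = L w" by (metis scaleR_one)
  then show ?thesis using du unfolding has_vector_derivative_def u_def L_def by blast
qed

text \<open>The functions \<open>Phi A\<close> and their derivatives along a geodesic are combinations of \<open>exp r\<close> and \<open>exp (- r)\<close>, and
  with three forms \<open>A\<close> the velocity is a rational expression in them.\<close>

lemma velocity_differentiable:
  assumes g: "\<gamma> \<in> LH3"
  shows "velocity \<gamma> differentiable (at r)"
proof -
  obtain v w where vw: "is_start v (fst \<gamma>)" "is_end w (snd \<gamma>)" by (rule obtain_lifts)
  obtain \<kappa> where \<kappa>: "\<kappa> > 0"
    "\<And>A r. hgrad A (geodesic \<gamma> r) \<bullet> velocity \<gamma> r = (\<kappa> * exp r * hquad A w - hquad A v / (\<kappa> * exp r)) / cmod (det2 v w)"
    using Phi_along_geodesic[OF g vw] by blast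
  define h where "h = (\<lambda>A r. hgrad A (geodesic \<gamma> r) \<bullet> velocity \<gamma> r)"
  have D: "cmod (det2 v w) \<noteq> 0" using LH3_iff_det2[OF vw] g by simp
  have dh: "h A differentiable (at r)" for A
  proof -
    have "h A = (\<lambda>r. (\<kappa> * exp r * hquad A w - hquad A v * (inverse \<kappa> * exp (- r))) / cmod (det2 v w))"
      unfolding h_def \<kappa>(2) by (rule ext) (simp add: exp_minus divide_inverse)
    moreover have "((\<lambda>r. (\<kappa> * exp r * hquad A w - hquad A v * (inverse \<kappa> * exp (- r))) / cmod (det2 v w)) has_real_derivative
        (\<kappa> * exp r * hquad A w - hquad A v * (inverse \<kappa> * (- exp (- r)))) / cmod (det2 v w)) (at r)"
      using D by (auto intro!: derivative_eq_intros)
    ultimately show ?thesis unfolding has_field_derivative_def differentiable_def by metis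
  qed
  define t where "t = (\<lambda>r. fst (geodesic \<gamma> r))"
  define x where "x = (\<lambda>r. Re (snd (geodesic \<gamma> r)))"
  define y where "y = (\<lambda>r. Im (snd (geodesic \<gamma> r)))"
  have dg: "(geodesic \<gamma> has_derivative (\<lambda>h. h *\<^sub>R velocity \<gamma> r)) (at r)" using geodesic_has_velocity[OF g] by (simp add: has_vector_derivative_def)
  have dt: "t differentiable (at r)" unfolding t_def differentiable_def using has_derivative_fst[OF dg] by blast
  have dx: "x differentiable (at r)" unfolding x_def differentiable_def using bounded_linear.has_derivative[OF bounded_linear_Re has_derivative_snd[OF dg]] by blast
  have dy: "y differentiable (at r)" unfolding y_def differentiable_def using bounded_linear.has_derivative[OF bounded_linear_Im has_derivative_snd[OF dg]] by blast
  have t0: "t s > 0" for s using geodesic_in_H3[OF g, of s] by (simp add: t_def H3_def)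
  define T where "T = (\<lambda>s. - (t s * t s * h (0, 1, 0) s))"
  have vt: "fst (velocity \<gamma> s) = T s" for s
    using t0[of s] unfolding T_def h_def t_def by (simp add: hgrad_def Phi_def inner_prod_def)
  have hb: "h (0, 0, b) s = 2 * Re (b * snd (velocity \<gamma> s)) / t s - 2 * Re (b * snd (geodesic \<gamma> s)) * T s / (t s * t s)" for b s
    unfolding vt[symmetric] h_def t_def by (simp add: hgrad_def Phi_def inner_prod_def inner_complex_def algebra_simps add_divide_distrib diff_divide_distrib)
  have vx: "Re (snd (velocity \<gamma> s)) = t s * h (0, 0, 1) s / 2 + x s * T s / t s" for s
    using t0[of s] hb[of 1 s] by (simp add: x_def field_simps)
  have vy: "Im (snd (velocity \<gamma> s)) = t s * h (0, 0, - \<i>) s / 2 + y s * T s / t s" for s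
    using t0[of s] hb[of "- \<i>" s] by (simp add: y_def field_simps)
  have dT: "T differentiable (at r)" unfolding T_def by (intro differentiable_minus differentiable_mult dt dh)
  have ti: "(\<lambda>s. inverse (t s)) differentiable (at r)" using t0[of r] by (intro differentiable_inverse dt) auto
  have dX: "(\<lambda>s. t s * h (0, 0, b) s * (1 / 2) + z s * T s * inverse (t s)) differentiable (at r)" if "z differentiable (at r)" for b z
    by (intro differentiable_add differentiable_mult differentiable_const dt dh dT ti that)
  obtain D1 D2 D3 where d: "(T has_derivative D1) (at r)" "((\<lambda>s. t s * h (0, 0, 1) s * (1 / 2) + x s * T s * inverse (t s)) has_derivative D2) (at r)"
    "((\<lambda>s. t s * h (0, 0, - \<i>) s * (1 / 2) + y s * T s * inverse (t s)) has_derivative D3) (at r)"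
    using dT dX[OF dx] dX[OF dy] unfolding differentiable_def by blast
  have "velocity \<gamma> = (\<lambda>s. (T s, of_real (t s * h (0, 0, 1) s * (1 / 2) + x s * T s * inverse (t s)) + \<i> * of_real (t s * h (0, 0, - \<i>) s * (1 / 2) + y s * T s * inverse (t s))))"
  proof (rule ext)
    fix s
    have re: "Re (snd (velocity \<gamma> s)) = t s * h (0, 0, 1) s * (1 / 2) + x s * T s * inverse (t s)"
      unfolding vx by (simp add: inverse_eq_divide)
    have im: "Im (snd (velocity \<gamma> s)) = t s * h (0, 0, - \<i>) s * (1 / 2) + y s * T s * inverse (t s)"
      unfolding vy by (simp add: inverse_eq_divide)
    have "snd (velocity \<gamma> s) = of_real (t s * h (0, 0, 1) s * (1 / 2) + x s * T s * inverse (t s)) + \<i> * of_real (t s * h (0, 0, - \<i>) s * (1 / 2) + y s * T s * inverse (t s))"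
      using complex_eq[of "snd (velocity \<gamma> s)"] unfolding re im .
    then show "velocity \<gamma> s = (T s, of_real (t s * h (0, 0, 1) s * (1 / 2) + x s * T s * inverse (t s)) + \<i> * of_real (t s * h (0, 0, - \<i>) s * (1 / 2) + y s * T s * inverse (t s)))"
      using vt[of s] by (intro prod_eqI) (simp_all only: fst_conv snd_conv)
  qed
  moreover have "(\<lambda>s. (T s, of_real (t s * h (0, 0, 1) s * (1 / 2) + x s * T s * inverse (t s)) + \<i> * of_real (t s * h (0, 0, - \<i>) s * (1 / 2) + y s * T s * inverse (t s)))) differentiable (at r)"
    by (rule differentiableI[OF has_derivative_Pair[OF d(1) has_derivative_add[OF has_derivative_of_real[OF d(2)] has_derivative_mult_right[OF has_derivative_of_real[OF d(3)]]]]])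
  ultimately show ?thesis by simp
qed

section \<open>Totally geodesic surfaces\<close>

text \<open>The form whose zero level is the hyperbolic plane through \<open>p\<close> orthogonal to \<open>n\<close>.\<close>

definition plane_form :: "half_space \<Rightarrow> half_space \<Rightarrow> herm" where
  "plane_form p n = (let a = fst n / (2 * fst p); b = cnj (snd n) / 2 - of_real a * cnj (snd p)
     in (a, - a * (p \<bullet> p) - 2 * Re (b * snd p), b))"

text \<open>The gradient of the numerator of \<^term>\<open>Phi\<close>; on the zero level it agrees with \<open>hgrad\<close> up to the factor \<open>fst p\<close>.\<close>

definition affine_grad :: "herm \<Rightarrow> half_space \<Rightarrow> half_space" where
  "affine_grad A p = (case A of (a, d, b) \<Rightarrow> (2 * a) *\<^sub>R p + (0, 2 * cnj b))"

lemma plane_form_touches: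
  assumes "p \<in> H3"
  shows "Phi (plane_form p n) p = 0" "affine_grad (plane_form p n) p = n" "hgrad (plane_form p n) p = (1 / fst p) *\<^sub>R n"
proof -
  have t: "fst p > 0" using assms by (simp add: H3_def)
  show 1: "Phi (plane_form p n) p = 0" by (simp add: Phi_def plane_form_def Let_def)
  show 2: "affine_grad (plane_form p n) p = n"
    using t by (cases n; cases p) (simp add: affine_grad_def plane_form_def Let_def scaleR_conv_of_real algebra_simps)
  have "hgrad A p = (1 / fst p) *\<^sub>R affine_grad A p" if "Phi A p = 0" for A
    using that by (cases A) (simp add: hgrad_def affine_grad_def zero_prod_def[symmetric])
  then show "hgrad (plane_form p n) p = (1 / fst p) *\<^sub>R n" using 1 2 by metis
qed

text \<open>The tangent plane at each point, extended to a hyperbolic plane, is described by the form \<^term>\<open>plane_form p n\<close>,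
  where \<open>n\<close> is the Euclidean unit normal. All normals are incident with one form if this plane does not move
  along the surface. Its derivative is measured by the difference of the derivatives of \<open>n\<close> and of the gradient of
  the fixed form, a symmetric bilinear form \<open>B\<close> on the tangent plane. A geodesic that
  is tangent at \<open>p\<close> stays both in \<open>S\<close> and in the plane at \<open>p\<close>, so \<open>B\<close> vanishes on the diagonal, hence everywhere.\<close>

lemma totally_geodesic_normals_incident:
  assumes S: "oriented_surface S N" and tg: "totally_geodesic S"
  shows "\<exists>A. A \<noteq> 0 \<and> (\<forall>\<gamma>\<in>normal_congruence S N. incident A \<gamma>)"
proof -
  have S0: "S \<noteq> {}" "connected S" "S \<subseteq> H3" "\<And>p. p \<in> S \<Longrightarrow> \<exists>U \<phi>. H3_patch S U \<phi> \<and> p \<in> \<phi> ` U" "continuous_on S N"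
    and Nn: "\<And>p. p \<in> S \<Longrightarrow> hyp_inner p (N p) (N p) = 1" "\<And>p v. p \<in> S \<Longrightarrow> v \<in> tangent_plane S p \<Longrightarrow> hyp_inner p (N p) v = 0"
    using S unfolding oriented_surface_def by auto
  have tpos: "fst p > 0" if "p \<in> S" for p using S0(3) that by (auto simp: H3_def)
  define n where "n = (\<lambda>p. (1 / fst p) *\<^sub>R N p)"
  have nn: "n p \<bullet> n p = 1" if "p \<in> S" for p
  proof -
    have "n p \<bullet> n p = hyp_inner p (N p) (N p)" by (simp add: n_def hyp_inner_def power2_eq_square)
    then show ?thesis using Nn(1)[OF that] by simp
  qed
  have nv: "n p \<bullet> v = 0" if "p \<in> S" "v \<in> tangent_plane S p" for p v
    using Nn(2)[OF that] tpos[OF that(1)] by (simp add: n_def hyp_inner_def)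
  have tne: "fst p \<noteq> 0" if "p \<in> S" for p using tpos[OF that] by simp
  have cn: "continuous_on S n" unfolding n_def
    by (intro continuous_intros S0(5)) (blast dest: tne)
  define G where "G = (\<lambda>p. plane_form p (n p))"
  have loc: "\<exists>T. openin (top_of_set S) T \<and> p0 \<in> T \<and> (\<forall>p\<in>T. G p0 = G p)" if p0: "p0 \<in> S" for p0
  proof -
    obtain U \<phi> where P: "H3_patch S U \<phi>" and "p0 \<in> \<phi> ` U" using S0(4)[OF p0] by blast
    then obtain u0 where u0: "u0 \<in> U" "p0 = \<phi> u0" by blast
    have lp: "open U" "openin (top_of_set S) (\<phi> ` U)" and tdo: "\<And>k. times_differentiable_on k \<phi> U"
      and inj: "\<And>u. u \<in> U \<Longrightarrow> inj (frechet_derivative \<phi> (at u))"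
      using P by (auto simp: H3_patch_def local_param_def smooth_immersion_on_def)
    obtain \<psi> where hom: "homeomorphism U (\<phi> ` U) \<phi> \<psi>" using P by (auto simp: H3_patch_def local_param_def)
    have \<phi>S: "\<phi> u \<in> S" if "u \<in> U" for u using lp(2) that openin_imp_subset by blast
    define X where "X u v = frechet_derivative \<phi> (at u) v" for u v
    have d\<phi>: "(\<phi> has_derivative X u) (at u)" if "u \<in> U" for u
      using times_differentiable_on_SucD(1)[OF tdo[of "Suc 0"] that] unfolding X_def .
    have linX: "linear (X u)" if "u \<in> U" for u using d\<phi>[OF that] has_derivative_bounded_linear bounded_linear.linear by blast
    have injX: "inj (X u)" if "u \<in> U" for u using inj[OF that] unfolding X_def .
    define H where "H v u w = frechet_derivative (\<lambda>x. X x v) (at u) w" for v u w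
    have dX: "((\<lambda>x. X x v) has_derivative H v u) (at u)" if "u \<in> U" for u v
      using times_differentiable_on_SucD(1)[OF times_differentiable_on_SucD(2)[OF tdo[of "Suc (Suc 0)"]] that, of v]
      unfolding X_def[symmetric] H_def[abs_def] .
    have Hsym: "H v u w = H w u v" if "u \<in> U" for u v w
      using second_derivative_symmetric[OF lp(1) that tdo, of v w] unfolding H_def X_def .
    have Xtan: "X u v \<in> tangent_plane S (\<phi> u)" if "u \<in> U" for u v
      unfolding tangent_plane_def X_def using P that by blast
    define m where "m = (\<lambda>u. n (\<phi> u))"
    have mX: "m u \<bullet> X u v = 0" if "u \<in> U" for u v unfolding m_def by (rule nv[OF \<phi>S[OF that] Xtan[OF that]])
    have mm: "m u \<bullet> m u = 1" if "u \<in> U" for u unfolding m_def by (rule nn[OF \<phi>S[OF that]])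
    have c\<phi>: "continuous_on U \<phi>" using tdo[of 0] by simp
    have cm: "continuous_on U m" unfolding m_def
      by (rule continuous_on_compose2[OF cn c\<phi>]) (use \<phi>S in auto)
    define k where "k = (\<lambda>u. cross (X u 1) (X u \<i>))"
    have k0: "k u \<noteq> 0" if "u \<in> U" for u unfolding k_def by (rule cross_nonzero[OF linX[OF that] injX[OF that]])
    have dk: "k differentiable (at u)" if "u \<in> U" for u
      unfolding k_def by (rule cross_differentiable) (use dX[OF that] in \<open>auto simp: differentiable_def\<close>)
    have km: "(k u \<bullet> k u) *\<^sub>R m u = (m u \<bullet> k u) *\<^sub>R k u" if "u \<in> U" for u
      unfolding k_def by (rule normal_parallel_cross[OF mX[OF that] mX[OF that]])
    have main: "((\<lambda>u. G (\<phi> u)) has_derivative (\<lambda>_. 0)) (at u1)" if u1: "u1 \<in> U" for u1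
    proof -
      have sq: "(m u \<bullet> k u)\<^sup>2 = k u \<bullet> k u" if u: "u \<in> U" for u
      proof -
        have "(k u \<bullet> k u) * (m u \<bullet> m u) = (m u \<bullet> k u) * (m u \<bullet> k u)"
          using arg_cong[OF km[OF u], of "\<lambda>x. x \<bullet> m u"] by (simp add: inner_commute)
        then show ?thesis using mm[OF u] by (simp add: power2_eq_square)
      qed
      have mk0: "m u \<bullet> k u \<noteq> 0" if "u \<in> U" for u using sq[OF that] k0[OF that] by auto
      have ck: "continuous_on U k" using dk lp(1) by (meson differentiable_imp_continuous_within continuous_at_imp_continuous_on)
      define \<sigma> where "\<sigma> = sgn (m u1 \<bullet> k u1)"
      \<comment> \<open>by continuity the normal stays on one side, which fixes the sign in front of the cross product\<close>
      define V where "V = U \<inter> (\<lambda>u. \<sigma> * (m u \<bullet> k u)) -` {0<..}"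
      have oV: "open V" unfolding V_def by (intro continuous_open_preimage lp(1) continuous_intros cm ck)
      have u1V: "u1 \<in> V" using u1 mk0[OF u1] by (auto simp: V_def \<sigma>_def sgn_if)
      have mV: "m u = (\<sigma> / norm (k u)) *\<^sub>R k u" if u: "u \<in> V" for u
      proof -
        have uU: "u \<in> U" and pos: "\<sigma> * (m u \<bullet> k u) > 0" using u by (auto simp: V_def)
        have s: "\<sigma> = 1 \<or> \<sigma> = -1" using mk0[OF u1] by (auto simp: \<sigma>_def sgn_if)
        have nk: "norm (k u) > 0" using k0[OF uU] by simp
        have "\<bar>m u \<bullet> k u\<bar> = norm (k u)"
          using sq[OF uU] by (simp add: norm_eq_sqrt_inner real_sqrt_abs[symmetric])
        then have mk: "m u \<bullet> k u = \<sigma> * norm (k u)" using s pos by auto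
        have "(norm (k u) * norm (k u)) *\<^sub>R m u = (\<sigma> * norm (k u)) *\<^sub>R k u"
          using km[OF uU] unfolding mk by (simp add: dot_square_norm power2_eq_square)
        then have "(1 / (norm (k u) * norm (k u))) *\<^sub>R ((norm (k u) * norm (k u)) *\<^sub>R m u) = (1 / (norm (k u) * norm (k u))) *\<^sub>R ((\<sigma> * norm (k u)) *\<^sub>R k u)" by simp
        moreover have "1 / (x * x) * (x * x) = 1" "1 / (x * x) * (\<sigma> * x) = \<sigma> / x" if "x > 0" for x :: real
          using that by (auto simp: field_simps)
        ultimately show ?thesis unfolding scaleR_scaleR using nk by simp
      qed
      have "\<exists>m'. (m has_derivative m') (at u1)"
      proof -
        obtain k' where k': "(k has_derivative k') (at u1)" using dk[OF u1] by (auto simp: differentiable_def)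
        have "((\<lambda>u. norm (k u)) has_derivative (\<lambda>h. k' h \<bullet> sgn (k u1))) (at u1)"
          by (rule has_derivative_compose[OF k' has_derivative_norm[OF k0[OF u1]]])
        from Deriv.has_derivative_inverse[OF _ this] k0[OF u1]
        have "((\<lambda>u. inverse (norm (k u))) has_derivative (\<lambda>h. - (inverse (norm (k u1)) * (k' h \<bullet> sgn (k u1)) * inverse (norm (k u1))))) (at u1)" by simp
        from has_derivative_scaleR[OF has_derivative_mult_right[OF this, of \<sigma>] k']
        obtain D where "((\<lambda>u. (\<sigma> * inverse (norm (k u))) *\<^sub>R k u) has_derivative D) (at u1)" by blast
        then have "(m has_derivative D) (at u1)"
          by (rule has_derivative_transform_within_open[OF _ oV u1V]) (simp add: mV divide_inverse)
        then show ?thesis by blast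
      qed
      then obtain m' where m': "(m has_derivative m') (at u1)" ..
      have linm: "linear m'" using m' has_derivative_bounded_linear bounded_linear.linear by blast
      \<comment> \<open>differentiating the length of the normal\<close>
      have i: "m' w \<bullet> m u1 = 0" for w
      proof -
        have d: "((\<lambda>u. m u \<bullet> m u - 1) has_derivative (\<lambda>h. m u1 \<bullet> m' h + m' h \<bullet> m u1 - 0)) (at u1)"
          by (intro has_derivative_diff has_derivative_inner m' has_derivative_const)
        have "m u1 \<bullet> m' w + m' w \<bullet> m u1 - 0 = 0"
          by (rule has_derivative_zero_on_open[OF lp(1) u1 _ d]) (simp add: mm)
        then show ?thesis by (simp add: inner_commute)
      qed
      \<comment> \<open>differentiating the orthogonality of normal and tangent fields\<close>
      have ii: "m' w \<bullet> X u1 v = - (m u1 \<bullet> H v u1 w)" for v w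
      proof -
        have d: "((\<lambda>u. m u \<bullet> X u v) has_derivative (\<lambda>h. m u1 \<bullet> H v u1 h + m' h \<bullet> X u1 v)) (at u1)"
          by (intro has_derivative_inner m' dX[OF u1])
        have "m u1 \<bullet> H v u1 w + m' w \<bullet> X u1 v = 0"
          by (rule has_derivative_zero_on_open[OF lp(1) u1 _ d]) (simp add: mX)
        then show ?thesis by simp
      qed
      define p where "p = \<phi> u1"
      have pS: "p \<in> S" "p \<in> H3" using \<phi>S[OF u1] S0(3) by (auto simp: p_def)
      define A where "A = G p"
      define a where "a = fst A"
      have Af: "Phi A p = 0" "affine_grad A p = m u1" "hgrad A p = (1 / fst p) *\<^sub>R m u1"
        using plane_form_touches[OF pS(2), of "n p"] by (auto simp: A_def G_def m_def p_def)
      have dag: "((\<lambda>s. affine_grad A (c s)) has_vector_derivative (2 * a) *\<^sub>R c') F" if "(c has_vector_derivative c') F" for c c' F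
        unfolding affine_grad_def a_def by (cases A) (auto intro!: derivative_eq_intros bounded_linear.has_vector_derivative[OF bounded_linear_scaleR_right that])
      have unit: "(m' w - (2 * a) *\<^sub>R X u1 w) \<bullet> X u1 w = 0" if w: "X u1 w \<bullet> X u1 w = (fst p)\<^sup>2" for w
      proof -
        obtain \<gamma> r where g: "\<gamma> \<in> LH3" "geodesic \<gamma> r = p" "velocity \<gamma> r = X u1 w" using geodesic_exists[OF pS(2) w] by blast
        have "velocity \<gamma> r \<in> tangent_plane S (geodesic \<gamma> r)" using Xtan[OF u1, of w] by (simp add: g p_def)
        then have evS: "\<forall>\<^sub>F s in nhds r. geodesic \<gamma> s \<in> S"
          using tg g(1,2) pS(1) unfolding totally_geodesic_def by blast
        obtain T where T: "open T" "\<phi> ` U = S \<inter> T" using lp(2) by (auto simp: openin_open)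
        have "isCont (geodesic \<gamma>) r" using geodesic_has_velocity[OF g(1)] has_vector_derivative_continuous by blast
        then have tg': "(geodesic \<gamma> \<longlongrightarrow> geodesic \<gamma> r) (nhds r)" by (simp add: isCont_def tendsto_at_iff_tendsto_nhds)
        have "geodesic \<gamma> r \<in> T" using T(2) u1 by (auto simp: g p_def)
        with T(1) tg' have "\<forall>\<^sub>F s in nhds r. geodesic \<gamma> s \<in> T" by (auto dest: topological_tendstoD)
        with evS have evU: "\<forall>\<^sub>F s in nhds r. geodesic \<gamma> s \<in> \<phi> ` U" by eventually_elim (simp add: T(2))
        then obtain O' where O: "open O'" "r \<in> O'" "\<And>s. s \<in> O' \<Longrightarrow> geodesic \<gamma> s \<in> \<phi> ` U" unfolding eventually_nhds by blast
        define u where "u = (\<lambda>s. \<psi> (geodesic \<gamma> s))"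
        have u: "u s \<in> U" "\<phi> (u s) = geodesic \<gamma> s" if "s \<in> O'" for s
          using O(3)[OF that] hom by (auto simp: u_def homeomorphism_def)
        have ur: "u r = u1" using hom u1 by (simp add: u_def g p_def homeomorphism_def)
        have lift: "\<exists>w. (u has_vector_derivative w) (at s) \<and> velocity \<gamma> s = X (u s) w" if s: "s \<in> O'" for s
          unfolding u_def X_def
          by (rule curve_lift[OF P hom geodesic_has_velocity[OF g(1)]]) (use O s in \<open>auto simp: eventually_nhds\<close>)
        obtain w' where w': "(u has_vector_derivative w') (at r)" "velocity \<gamma> r = X u1 w'" using lift[OF O(2)] ur by auto
        have ww: "w' = w" using w'(2) g(3) injX[OF u1] by (simp add: inj_eq)
        \<comment> \<open>the geodesic stays in the plane described by the form at its initial point\<close>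
        have flat: "affine_grad A (geodesic \<gamma> s) \<bullet> velocity \<gamma> s = 0" for s
        proof -
          obtain v1 w1 where vw: "is_start v1 (fst \<gamma>)" "is_end w1 (snd \<gamma>)" by (rule obtain_lifts)
          have D: "cmod (det2 v1 w1) > 0" using LH3_iff_det2[OF vw] g by simp
          obtain \<kappa> where \<kappa>: "\<kappa> > 0" "\<And>r. Phi A (geodesic \<gamma> r) = (\<kappa> * exp r * hquad A w1 + hquad A v1 / (\<kappa> * exp r)) / cmod (det2 v1 w1)"
            "\<And>r. hgrad A (geodesic \<gamma> r) \<bullet> velocity \<gamma> r = (\<kappa> * exp r * hquad A w1 - hquad A v1 / (\<kappa> * exp r)) / cmod (det2 v1 w1)"
            using Phi_along_geodesic[OF g(1) vw] by blast
          have "hgrad A (geodesic \<gamma> r) \<bullet> velocity \<gamma> r = 0" using mX[OF u1, of w] by (simp add: g Af)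
          moreover have "Phi A (geodesic \<gamma> r) = 0" using Af(1) g by simp
          ultimately have "\<kappa> * exp r * hquad A w1 - hquad A v1 / (\<kappa> * exp r) = 0" "\<kappa> * exp r * hquad A w1 + hquad A v1 / (\<kappa> * exp r) = 0"
            unfolding \<kappa>(2,3) using D by simp_all
          then have "\<kappa> * exp r * hquad A w1 = 0" "hquad A v1 / (\<kappa> * exp r) = 0" by linarith+
          then have "hquad A w1 = 0" "hquad A v1 = 0" using \<kappa>(1) by simp_all
          then have z: "Phi A (geodesic \<gamma> s) = 0" "hgrad A (geodesic \<gamma> s) \<bullet> velocity \<gamma> s = 0" by (simp_all add: \<kappa>(2,3))
          have "fst (geodesic \<gamma> s) > 0" using geodesic_in_H3[OF g(1)] by (simp add: H3_def)
          moreover have "hgrad A q = (1 / fst q) *\<^sub>R affine_grad A q" if "Phi A q = 0" for q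
            using that by (cases A) (simp add: hgrad_def affine_grad_def zero_prod_def[symmetric])
          ultimately show ?thesis using z by simp
        qed
        \<comment> \<open>since \<open>e\<close> vanishes at \<open>r\<close> and is orthogonal to the velocity throughout, its derivative at \<open>r\<close> is orthogonal to the velocity\<close>
        define e where "e = (\<lambda>s. m (u s) - affine_grad A (geodesic \<gamma> s))"
        have e0: "e r = 0" by (simp add: e_def ur g Af)
        have de: "(e has_vector_derivative (m' w - (2 * a) *\<^sub>R X u1 w)) (at r)"
        proof -
          have "((\<lambda>s. m (u s)) has_derivative (\<lambda>h. m' (h *\<^sub>R w))) (at r)"
            using has_derivative_compose[OF w'(1)[unfolded has_vector_derivative_def ww], of m m'] m' by (simp add: ur)
          then have "((\<lambda>s. m (u s)) has_vector_derivative m' w) (at r)"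
            by (simp add: has_vector_derivative_def linear_scale[OF linm])
          then show ?thesis unfolding e_def
            using dag[OF geodesic_has_velocity[OF g(1), of r]] g(3) by (auto intro: has_vector_derivative_diff)
        qed
        obtain acc where acc: "(velocity \<gamma> has_vector_derivative acc) (at r)"
          using velocity_differentiable[OF g(1), of r] vector_derivative_works by blast
        have "((\<lambda>s. e s \<bullet> velocity \<gamma> s) has_vector_derivative (e r \<bullet> acc + (m' w - (2 * a) *\<^sub>R X u1 w) \<bullet> velocity \<gamma> r)) (at r)"
          by (rule bounded_bilinear.has_vector_derivative[OF bounded_bilinear_inner de acc])
        moreover have "e s \<bullet> velocity \<gamma> s = 0" if s: "s \<in> O'" for s
        proof -
          obtain w2 where "velocity \<gamma> s = X (u s) w2" using lift[OF s] by blast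
          then have "m (u s) \<bullet> velocity \<gamma> s = 0" using mX[OF u(1)[OF s]] by simp
          then show ?thesis using flat[of s] by (simp add: e_def inner_diff_left)
        qed
        ultimately have "1 *\<^sub>R (e r \<bullet> acc + (m' w - (2 * a) *\<^sub>R X u1 w) \<bullet> velocity \<gamma> r) = 0"
          unfolding has_vector_derivative_def using has_derivative_zero_on_open[OF O(1,2), of "\<lambda>s. e s \<bullet> velocity \<gamma> s"] by blast
        then show ?thesis by (simp add: e0 g)
      qed
      define B where "B w v = (m' w - (2 * a) *\<^sub>R X u1 w) \<bullet> X u1 v" for w v
      have Badd: "B (x + y) v = B x v + B y v" "B v (x + y) = B v x + B v y" for x y v
        unfolding B_def linear_add[OF linm] linear_add[OF linX[OF u1]] by (simp_all add: inner_add_left inner_add_right inner_diff_left algebra_simps)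
      have Bscale: "B (c *\<^sub>R w) (c *\<^sub>R w) = c * c * B w w" for c w
        unfolding B_def linear_scale[OF linm] linear_scale[OF linX[OF u1]] by (simp add: inner_diff_left algebra_simps)
      have B_eq: "B w v = - (m u1 \<bullet> H v u1 w) - 2 * a * (X u1 w \<bullet> X u1 v)" for v w
        unfolding B_def by (simp add: inner_diff_left ii)
      have Bsym: "B w v = B v w" for v w
        unfolding B_eq Hsym[OF u1, of v w] by (simp add: inner_commute)
      have Bdiag: "B w w = 0" for w
      proof (cases "w = 0")
        case True
        then show ?thesis by (simp add: B_def linear_0[OF linX[OF u1]])
      next
        case False
        define x where "x = norm (X u1 w)"
        have "X u1 w \<noteq> X u1 0" using False injX[OF u1] by (simp add: inj_eq)
        then have x: "x > 0" by (simp add: x_def linear_0[OF linX[OF u1]])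
        define c where "c = fst p / x"
        have c: "c \<noteq> 0" using x tpos[OF pS(1)] by (simp add: c_def)
        have "X u1 (c *\<^sub>R w) \<bullet> X u1 (c *\<^sub>R w) = (fst p)\<^sup>2"
          unfolding linear_scale[OF linX[OF u1]] using x by (simp add: dot_square_norm x_def[symmetric] c_def power2_eq_square)
        from unit[OF this] have "B (c *\<^sub>R w) (c *\<^sub>R w) = 0" unfolding B_def .
        then show ?thesis using c by (simp add: Bscale)
      qed
      \<comment> \<open>polarisation\<close>
      have B0: "B w v = 0" for w v
      proof -
        have "B (w + v) (w + v) = B w w + B v v + 2 * B w v" by (simp add: Badd Bsym[of v w])
        then show ?thesis by (simp add: Bdiag)
      qed
      have m'eq: "m' w = (2 * a) *\<^sub>R X u1 w" for w
      proof -
        define z where "z = m' w - (2 * a) *\<^sub>R X u1 w"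
        have z: "z \<bullet> X u1 v = 0" for v using B0[of w v] by (simp add: B_def z_def)
        have zm: "z \<bullet> m u1 = 0" using i[of w] mX[OF u1, of w] inner_commute[of "m u1" "X u1 w"] by (simp add: z_def inner_diff_left)
        have "(k u1 \<bullet> k u1) *\<^sub>R z = (z \<bullet> k u1) *\<^sub>R k u1"
          unfolding k_def by (rule normal_parallel_cross[OF z z])
        moreover have "z \<bullet> k u1 = 0"
        proof -
          have "(m u1 \<bullet> k u1) * (z \<bullet> k u1) = (k u1 \<bullet> k u1) * (z \<bullet> m u1)"
            using arg_cong[OF km[OF u1], of "\<lambda>x. z \<bullet> x"] by simp
          then show ?thesis using zm mk0[OF u1] by simp
        qed
        ultimately have "z = 0" using k0[OF u1] by simp
        then show ?thesis by (simp add: z_def)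
      qed
      define t where "t = fst p"
      have t: "t > 0" using tpos[OF pS(1)] by (simp add: t_def)
      have dft: "((\<lambda>u. fst (\<phi> u)) has_derivative (\<lambda>h. fst (X u1 h))) (at u1)" by (rule has_derivative_fst[OF d\<phi>[OF u1]])
      have dfz: "((\<lambda>u. cnj (snd (\<phi> u))) has_derivative (\<lambda>h. cnj (snd (X u1 h)))) (at u1)"
        by (rule bounded_linear.has_derivative[OF bounded_linear_cnj has_derivative_snd[OF d\<phi>[OF u1]]])
      \<comment> \<open>the three entries of the form have derivative zero at \<open>u1\<close>\<close>
      define fa where "fa = (\<lambda>u. fst (m u) / (2 * fst (\<phi> u)))"
      define fb where "fb = (\<lambda>u. cnj (snd (m u)) / 2 - of_real (fa u) * cnj (snd (\<phi> u)))"
      define fd where "fd = (\<lambda>u. - fa u * (\<phi> u \<bullet> \<phi> u) - 2 * Re (fb u * snd (\<phi> u)))"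
      have G: "G (\<phi> u) = (fa u, fd u, fb u)" for u by (simp add: G_def plane_form_def Let_def fa_def fb_def fd_def m_def)
      have fa1: "fa u1 = a" "G p = (a, fd u1, fb u1)" using G[of u1] by (simp_all add: a_def A_def p_def)
      have mt: "fst (m u1) = 2 * a * t" using fa1(1) t by (simp add: fa_def t_def p_def field_simps)
      have "(fa has_derivative (\<lambda>h. (fst (m' h) * (2 * fst (\<phi> u1)) - fst (m u1) * (2 * fst (X u1 h))) / (2 * fst (\<phi> u1) * (2 * fst (\<phi> u1))))) (at u1)"
        unfolding fa_def using t by (intro has_derivative_divide' has_derivative_fst[OF m'] has_derivative_mult_right dft) (simp add: t_def p_def)
      moreover have "(fst (m' h) * (2 * fst (\<phi> u1)) - fst (m u1) * (2 * fst (X u1 h))) = 0" for h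
        unfolding m'eq mt by (simp add: t_def p_def)
      ultimately have dfa: "(fa has_derivative (\<lambda>_. 0)) (at u1)" by simp
      have "(fb has_derivative (\<lambda>h. cnj (snd (m' h)) / 2 - (of_real (fa u1) * cnj (snd (X u1 h)) + of_real 0 * cnj (snd (\<phi> u1))))) (at u1)"
        unfolding fb_def
        by (intro has_derivative_diff has_derivative_mult has_derivative_of_real[OF dfa] dfz bounded_linear.has_derivative[OF bounded_linear_divide]
            bounded_linear.has_derivative[OF bounded_linear_cnj has_derivative_snd[OF m']])
      moreover have "cnj (snd (m' h)) / 2 - (of_real (fa u1) * cnj (snd (X u1 h)) + of_real 0 * cnj (snd (\<phi> u1))) = 0" for h
        unfolding m'eq fa1 by (simp add: scaleR_conv_of_real)
      ultimately have dfb: "(fb has_derivative (\<lambda>_. 0)) (at u1)" by simp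
      have "(fd has_derivative (\<lambda>h. (- fa u1 * (\<phi> u1 \<bullet> X u1 h + X u1 h \<bullet> \<phi> u1) + - 0 * (\<phi> u1 \<bullet> \<phi> u1)) - 2 * Re (fb u1 * snd (X u1 h) + 0 * snd (\<phi> u1)))) (at u1)"
        unfolding fd_def
        by (intro has_derivative_diff has_derivative_mult has_derivative_minus dfa dfb has_derivative_inner d\<phi>[OF u1] has_derivative_mult_right
            bounded_linear.has_derivative[OF bounded_linear_Re] has_derivative_snd)
      moreover have "(- fa u1 * (\<phi> u1 \<bullet> X u1 h + X u1 h \<bullet> \<phi> u1) + - 0 * (\<phi> u1 \<bullet> \<phi> u1)) - 2 * Re (fb u1 * snd (X u1 h) + 0 * snd (\<phi> u1)) = - (affine_grad A p \<bullet> X u1 h)" for h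
        unfolding A_def fa1(2) affine_grad_def prod.case inner_add_left
        by (simp add: fa1(1) p_def inner_commute[of "X u1 h"] inner_prod_def[of "(0, _)"] inner_complex_def algebra_simps)
      moreover have "affine_grad A p \<bullet> X u1 h = 0" for h unfolding Af(2) by (rule mX[OF u1])
      ultimately have dfd: "(fd has_derivative (\<lambda>_. 0)) (at u1)" by simp
      have "((\<lambda>u. (fa u, fd u, fb u)) has_derivative (\<lambda>_. (0, 0, 0))) (at u1)"
        by (intro has_derivative_Pair dfa dfb dfd)
      then show ?thesis by (simp add: G zero_prod_def)
    qed
    obtain r where r: "r > 0" "ball u0 r \<subseteq> U" using lp(1) u0(1) open_contains_ball by blast
    have "\<exists>c. \<forall>u\<in>ball u0 r. G (\<phi> u) = c"
    proof (rule has_derivative_zero_constant[OF convex_ball])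
      show "((\<lambda>u. G (\<phi> u)) has_derivative (\<lambda>_. 0)) (at u within ball u0 r)" if "u \<in> ball u0 r" for u
        by (rule has_derivative_at_withinI[OF main]) (use that r(2) in blast)
    qed
    then obtain c where c: "\<And>u. u \<in> ball u0 r \<Longrightarrow> G (\<phi> u) = c" by blast
    show ?thesis
    proof (intro exI conjI)
      show "openin (top_of_set S) (\<phi> ` ball u0 r)" by (rule openin_patch_image[OF hom lp(1,2) open_ball r(2)])
      show "p0 \<in> \<phi> ` ball u0 r" using u0 r(1) by auto
      show "\<forall>p\<in>\<phi> ` ball u0 r. G p0 = G p" using c u0(2) r(1) by auto
    qed
  qed
  obtain p0 where p0: "p0 \<in> S" using S0(1) by blast
  have const: "G p0 = G p" if "p \<in> S" for p
    by (rule connected_equivalence_relation[OF S0(2) p0 that, of "\<lambda>x y. G x = G y"]) (use loc in auto)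
  have "G p0 \<noteq> 0"
  proof
    assume "G p0 = 0"
    then have "affine_grad (plane_form p0 (n p0)) p0 = 0" by (simp add: G_def affine_grad_def zero_prod_def)
    moreover have "p0 \<in> H3" using p0 S0(3) by blast
    ultimately have "n p0 = 0" by (simp add: plane_form_touches(2))
    then show False using nn[OF p0] by simp
  qed
  moreover have "incident (G p0) \<gamma>" if g: "\<gamma> \<in> normal_congruence S N" for \<gamma>
  proof -
    obtain r where r: "\<gamma> \<in> LH3" "geodesic \<gamma> r \<in> S" "velocity \<gamma> r = N (geodesic \<gamma> r)"
      using g unfolding normal_congruence_def by blast
    define q where "q = geodesic \<gamma> r"
    have q: "q \<in> S" "q \<in> H3" using r(2) S0(3) by (auto simp: q_def)
    have "N q = fst q *\<^sub>R n q" using tpos[OF q(1)] by (simp add: n_def)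
    also have "\<dots> = (fst q * fst q) *\<^sub>R hgrad (G q) q"
      using plane_form_touches(3)[OF q(2), of "n q"] tpos[OF q(1)] by (simp add: G_def)
    finally have "velocity \<gamma> r = (fst q * fst q) *\<^sub>R hgrad (G p0) (geodesic \<gamma> r)"
      using r(3) const[OF q(1)] by (simp add: q_def)
    then show ?thesis by (rule incident_of_parallel[OF r(1)])
  qed
  ultimately show ?thesis by blast
qed

section \<open>Geodesic spheres\<close>

text \<open>The form with \<open>Phi A = 2 \<tau> cosh (distance to p)\<close>, where \<open>\<tau> = fst p\<close>, has the sphere as a level set, so that
  the normals of the surface are parallel to its gradient.\<close>

lemma sphere_normals_incident:
  assumes S: "oriented_surface S N" and sp: "in_geodesic_sphere S"
  shows "\<exists>A. A \<noteq> 0 \<and> (\<forall>\<gamma>\<in>normal_congruence S N. incident A \<gamma>)"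
proof -
  have S0: "S \<subseteq> H3" "\<And>p. p \<in> S \<Longrightarrow> \<exists>U \<phi>. H3_patch S U \<phi> \<and> p \<in> \<phi> ` U"
    and Nn: "\<And>p. p \<in> S \<Longrightarrow> hyp_inner p (N p) (N p) = 1" "\<And>p v. p \<in> S \<Longrightarrow> v \<in> tangent_plane S p \<Longrightarrow> hyp_inner p (N p) v = 0"
    using S unfolding oriented_surface_def by auto
  obtain p r0 where p: "p \<in> H3" "r0 > 0" "S \<subseteq> geodesic_sphere p r0" using sp by (auto simp: in_geodesic_sphere_def)
  obtain \<tau> z where pz: "p = (\<tau>, z)" by (cases p)
  have \<tau>: "\<tau> > 0" using p(1) by (simp add: pz H3_def)
  define A :: herm where "A = (1, (cmod z)\<^sup>2 + \<tau>\<^sup>2, - cnj z)"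
  have det: "hdet A = \<tau>\<^sup>2" by (simp add: A_def hdet_def)
  define c where "c = 2 * \<tau> * cosh r0"
  have c4: "c\<^sup>2 > 4 * hdet A"
  proof -
    have "sinh r0 > 0" using p(2) by simp
    then have "(2 * \<tau> * sinh r0)\<^sup>2 > 0" using \<tau> by simp
    then show ?thesis unfolding det c_def power_mult_distrib cosh_square_eq by (simp add: algebra_simps)
  qed
  have Phip: "Phi A p = 2 * \<tau>"
    using \<tau> by (simp add: Phi_def A_def pz dot_square_norm[of z] complex_norm_square[symmetric] mult.commute[of "cnj z"] field_simps)
      (simp add: power2_eq_square inner_complex_def cmod_power2[unfolded power2_eq_square] algebra_simps)
  have hp: "hgrad A p = 0"
  proof -
    have "(fst p)\<^sup>2 * (hgrad A p \<bullet> hgrad A p) = 0" unfolding norm_hgrad[OF p(1)] Phip det by (simp add: power_mult_distrib)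
    then show ?thesis using \<tau> by (simp add: pz)
  qed
  have SQ: "S \<subseteq> quadric A c"
  proof
    fix q assume q: "q \<in> S"
    then obtain \<gamma> s where g: "\<gamma> \<in> LH3" "geodesic \<gamma> s = p" "q = geodesic \<gamma> (s + r0)" using p(3) by (auto simp: geodesic_sphere_def)
    obtain v w where vw: "is_start v (fst \<gamma>)" "is_end w (snd \<gamma>)" by (rule obtain_lifts)
    obtain \<kappa> where \<kappa>: "\<kappa> > 0" "\<And>r. Phi A (geodesic \<gamma> r) = (\<kappa> * exp r * hquad A w + hquad A v / (\<kappa> * exp r)) / cmod (det2 v w)"
      "\<And>r. hgrad A (geodesic \<gamma> r) \<bullet> velocity \<gamma> r = (\<kappa> * exp r * hquad A w - hquad A v / (\<kappa> * exp r)) / cmod (det2 v w)"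
      using Phi_along_geodesic[OF g(1) vw] by blast
    define x where "x = \<kappa> * exp s * hquad A w / cmod (det2 v w)"
    define y where "y = hquad A v / (\<kappa> * exp s) / cmod (det2 v w)"
    have 1: "x + y = 2 * \<tau>" using \<kappa>(2)[of s] Phip g(2) by (simp add: x_def y_def add_divide_distrib)
    have 2: "x - y = 0" using \<kappa>(3)[of s] hp g(2) by (simp add: x_def y_def diff_divide_distrib)
    have "Phi A q = x * exp r0 + y * exp (- r0)"
      unfolding g(3) \<kappa>(2) x_def y_def by (simp add: exp_add exp_minus add_divide_distrib divide_inverse algebra_simps)
    also have "\<dots> = \<tau> * exp r0 + \<tau> * exp (- r0)" using 1 2 by simp
    also have "\<dots> = \<tau> * (exp r0 + exp (- r0))" by (simp add: distrib_left)
    also have "exp r0 + exp (- r0) = 2 * cosh r0" using cosh_plus_sinh[of r0] cosh_minus_sinh[of r0] by linarith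
    finally show "q \<in> quadric A c" using q S0(1) by (auto simp: quadric_def c_def)
  qed
  have "incident A \<gamma>" if g: "\<gamma> \<in> normal_congruence S N" for \<gamma>
  proof -
    obtain r where r: "\<gamma> \<in> LH3" "geodesic \<gamma> r \<in> S" "velocity \<gamma> r = N (geodesic \<gamma> r)"
      using g unfolding normal_congruence_def by blast
    define q where "q = geodesic \<gamma> r"
    have q: "q \<in> S" "q \<in> H3" "Phi A q = c" using r(2) SQ by (auto simp: q_def quadric_def)
    have t: "fst q > 0" using q(2) by (simp add: H3_def)
    obtain U \<phi> u where P: "H3_patch S U \<phi>" "u \<in> U" "q = \<phi> u" using S0(2)[OF q(1)] by blast
    define X where "X = frechet_derivative \<phi> (at u)"
    have d: "(\<phi> has_derivative X) (at u)" and inj: "inj X"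
      using P times_differentiable_on_SucD(1)[of 0 \<phi> U] unfolding H3_patch_def smooth_immersion_on_def X_def by blast+
    have lin: "linear X" using d has_derivative_bounded_linear bounded_linear.linear by blast
    have tan: "X v \<in> tangent_plane S q" for v unfolding tangent_plane_def X_def using P by blast
    define k where "k = cross (X 1) (X \<i>)"
    have k: "k \<noteq> 0" unfolding k_def by (rule cross_nonzero[OF lin inj])
    have NX: "N q \<bullet> X v = 0" for v using Nn(2)[OF q(1) tan] t by (simp add: hyp_inner_def)
    have hX: "hgrad A q \<bullet> X v = 0" for v by (rule tangent_plane_quadric[OF SQ tan])
    have Nk: "(k \<bullet> k) *\<^sub>R N q = (N q \<bullet> k) *\<^sub>R k" unfolding k_def by (rule normal_parallel_cross[OF NX NX])
    have hk: "(k \<bullet> k) *\<^sub>R hgrad A q = (hgrad A q \<bullet> k) *\<^sub>R k" unfolding k_def by (rule normal_parallel_cross[OF hX hX])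
    have "(fst q)\<^sup>2 * (hgrad A q \<bullet> hgrad A q) > 0" unfolding norm_hgrad[OF q(2)] q(3) using c4 by simp
    then have "hgrad A q \<noteq> 0" by auto
    then have hk0: "hgrad A q \<bullet> k \<noteq> 0" using hk k by auto
    define l where "l = (N q \<bullet> k) / (hgrad A q \<bullet> k)"
    have "(k \<bullet> k) *\<^sub>R N q = (k \<bullet> k) *\<^sub>R (l *\<^sub>R hgrad A q)"
    proof -
      have "(k \<bullet> k) *\<^sub>R (l *\<^sub>R hgrad A q) = l *\<^sub>R ((k \<bullet> k) *\<^sub>R hgrad A q)" by simp
      also have "\<dots> = (k \<bullet> k) *\<^sub>R N q" unfolding hk Nk using hk0 by (simp add: l_def)
      finally show ?thesis by simp
    qed
    then have "N q = l *\<^sub>R hgrad A q" using k by (metis scaleR_cancel_left inner_eq_zero_iff)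
    then show ?thesis using r(3) by (intro incident_of_parallel[OF r(1), of r l]) (simp add: q_def)
  qed
  moreover have "A \<noteq> 0" by (simp add: A_def zero_prod_def)
  ultimately show ?thesis by blast
qed

section \<open>The classification\<close>

lemma is_start_det2:
  assumes "is_start v s" "is_start v' s'" "det2 v v' = 0"
  shows "s = s'"
  using assms by (cases s; cases s') (auto simp: is_start_def det2_def algebra_simps)

lemma is_end_det2:
  assumes "is_end v s" "is_end v' s'" "det2 v v' = 0"
  shows "s = s'"
  using assms by (cases s; cases s') (auto simp: is_end_def det2_def algebra_simps)

text \<open>An isotropic vector that is also orthogonal to a second vector of a basis is in the kernel.\<close>

lemma incident_null_kernel:
  assumes D: "det2 v w \<noteq> 0" and E: "hform A v w = 0" and 0: "hquad A v = 0"
  shows "hform A v x = 0"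
proof -
  have "cnj (det2 v w) * hform A v x = 0"
    using hform_expand_right[of v w A x] E 0 of_real_hquad[of A v] by simp
  then show ?thesis using D by simp
qed

text \<open>After the choice of sign, every geodesic of the surface crosses the level \<open>c\<close> with \<open>c = 2 sqrt (hdet A) cosh 1\<close>,
  \<open>c = 0\<close> or \<open>c = \<plusminus>1\<close> for \<open>hdet A\<close> positive, negative or zero, and the crossing points form a piece of a
  sphere of radius one, of a totally geodesic plane or of a horosphere. Other levels crossed by all geodesics
  would give parallel surfaces with the same normals.\<close>

lemma alpha_surface_imp_congruence:
  assumes im: "immersed_surface M f" and al: "alpha_surface M f"
  shows "\<exists>S N. oriented_surface S N \<and> f ` M = normal_congruence S N \<and>
       (in_geodesic_sphere S \<or> horosphere S N \<or> totally_geodesic S)"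
proof -
  obtain A0 where "A0 \<noteq> 0" "\<forall>m\<in>M. incident A0 (f m)" using alpha_surface_imp_incident[OF al] by blast
  then obtain A where A: "A \<noteq> 0" and inc: "\<And>m. m \<in> M \<Longrightarrow> incident A (f m)" and pos: "hdet A > 0 \<Longrightarrow> fst A > 0"
    and sg: "\<And>m v w. hdet A \<le> 0 \<Longrightarrow> m \<in> M \<Longrightarrow> is_start v (fst (f m)) \<Longrightarrow> is_end w (snd (f m)) \<Longrightarrow> hquad A v \<le> 0 \<and> hquad A w \<ge> 0"
    using normalized_incidence_form[OF im, of A0] by blast
  have M: "M \<noteq> {}" and L: "\<And>m. m \<in> M \<Longrightarrow> f m \<in> LH3" using im by (auto simp: immersed_surface_def)
  have fin: "\<exists>S N. oriented_surface S N \<and> f ` M = normal_congruence S N \<and> (in_geodesic_sphere S \<or> horosphere S N \<or> totally_geodesic S)"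
    if c: "c\<^sup>2 > 4 * hdet A" and cr: "\<And>m. m \<in> M \<Longrightarrow> \<exists>r. crosses_at A c (f m) r"
      and ty: "\<And>S. openin (top_of_set (quadric A c)) S \<Longrightarrow> f ` M = normal_congruence S (unit_grad A c) \<Longrightarrow>
        S = {geodesic (f m) r | m r. m \<in> M \<and> crosses_at A c (f m) r} \<Longrightarrow>
        in_geodesic_sphere S \<or> horosphere S (unit_grad A c) \<or> totally_geodesic S" for c
  proof -
    note ss = section_surface[OF im A inc c cr]
    show ?thesis using oriented_surface_quadric[OF ss(1) c ss(3,2)] ss(4) ty[OF ss(1,4) refl] by blast
  qed
  have facts: "det2 v w \<noteq> 0" "hform A v w = 0" "hquad A v * hquad A w = hdet A * (cmod (det2 v w))\<^sup>2"
    if "m \<in> M" "is_start v (fst (f m))" "is_end w (snd (f m))" for m v w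
  proof -
    show D: "det2 v w \<noteq> 0" using LH3_iff_det2[OF that(2,3)] L[OF that(1)] by simp
    show E: "hform A v w = 0" using incident_iff_hform[OF that(2,3)] inc[OF that(1)] by simp
    show "hquad A v * hquad A w = hdet A * (cmod (det2 v w))\<^sup>2" using hform_gram[of A v w] E by simp
  qed
  obtain a d b where Ae: "A = (a, d, b)" by (cases A)
  consider "hdet A > 0" | "hdet A < 0" | "hdet A = 0" by linarith
  then show ?thesis
  proof cases
    case 1
    define s where "s = sqrt (hdet A)"
    have s: "s > 0" "s * s = hdet A" using 1 by (simp_all add: s_def)
    have a: "a > 0" using pos[OF 1] by (simp add: Ae)
    define c where "c = 2 * s * cosh 1"
    have c: "c\<^sup>2 > 4 * hdet A"
    proof -
      have "(2 * s * sinh 1)\<^sup>2 > 0" using s(1) by simp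
      then show ?thesis unfolding s(2)[symmetric] c_def power_mult_distrib cosh_square_eq by (simp add: power2_eq_square algebra_simps)
    qed
    show ?thesis
    proof (rule fin[OF c])
      fix m assume m: "m \<in> M"
      obtain v w where vw: "is_start v (fst (f m))" "is_end w (snd (f m))" by (rule obtain_lifts)
      note F = facts[OF m vw]
      define D where "D = cmod (det2 v w)"
      have D: "D > 0" using F(1) by (simp add: D_def)
      have prod: "hquad A v * hquad A w = s * s * D\<^sup>2" using F(3) by (simp add: D_def s(2))
      have "Phi A (geodesic (f m) 0) > 0" using sphere_center(2)[of a d b, OF a] 1 geodesic_in_H3[OF L[OF m]] by (simp add: Ae)
      then have "geo_point v w 1 \<in> H3 \<and> Phi A (geo_point v w 1) > 0"
        using sphere_center(2)[of a d b, OF a] 1 geo_point_in_H3[OF F(1), of 1] by (simp add: Ae)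
      then have "(hquad A w + hquad A v) / D > 0" using Phi_geo_point[OF F(1), of 1 A] by (simp add: D_def)
      then have sum: "hquad A w + hquad A v > 0" using D by (simp add: zero_less_divide_iff)
      have "hquad A v * hquad A w > 0" unfolding prod using s(1) D by simp
      then have w: "hquad A w > 0" using sum by (auto simp: zero_less_mult_iff)
      define e where "e = s * exp 1 * D / hquad A w"
      have ch: "exp 1 + exp (- 1) = 2 * cosh (1::real)" "exp 1 - exp (- 1) = 2 * sinh (1::real)"
        using cosh_plus_sinh[of "1::real"] cosh_minus_sinh[of "1::real"] by linarith+
      have e: "e > 0" using s(1) D w by (simp add: e_def)
      have ew: "e * hquad A w = s * D * exp 1" using w by (simp add: e_def)
      have "hquad A v = s * s * D\<^sup>2 / hquad A w" using prod w by (simp add: field_simps)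
      then have ev: "hquad A v / e = s * D * exp (- 1)" using s(1) D w by (simp add: e_def exp_minus power2_eq_square field_simps)
      show "\<exists>r. crosses_at A c (f m) r"
      proof (rule crosses_atI[OF L[OF m] vw e])
        have "e * hquad A w + hquad A v / e = s * D * (exp 1 + exp (- 1))" unfolding ew ev by (simp add: distrib_left)
        then show "e * hquad A w + hquad A v / e = c * cmod (det2 v w)" unfolding ch c_def D_def by simp
        have "e * hquad A w - hquad A v / e = s * D * (exp 1 - exp (- 1))" unfolding ew ev by (simp add: right_diff_distrib)
        then show "e * hquad A w - hquad A v / e > 0" unfolding ch using s(1) D by simp
      qed
    next
      fix S assume S: "S = {geodesic (f m) r | m r. m \<in> M \<and> crosses_at A c (f m) r}"
      have "S \<subseteq> geodesic_sphere (sqrt (hdet (a, d, b)) / a, - cnj b / of_real a) 1"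
      proof
        fix q assume "q \<in> S"
        then obtain m r where m: "m \<in> M" "crosses_at A c (f m) r" "q = geodesic (f m) r" unfolding S by blast
        have "geodesic (f m) (r - 1) = (sqrt (hdet (a, d, b)) / a, - cnj b / of_real a)"
          using m inc[OF m(1)] 1 by (intro sphere_normals_pass_center[OF a _ L[OF m(1)]]) (auto simp: Ae c_def s_def)
        moreover have "q = geodesic (f m) ((r - 1) + 1)" using m(3) by simp
        ultimately show "q \<in> geodesic_sphere (sqrt (hdet (a, d, b)) / a, - cnj b / of_real a) 1"
          unfolding geodesic_sphere_def using L[OF m(1)] by blast
      qed
      moreover have "(sqrt (hdet (a, d, b)) / a, - cnj b / of_real a) \<in> H3" using sphere_center(1)[OF a] 1 by (simp add: Ae)
      ultimately show "in_geodesic_sphere S \<or> horosphere S (unit_grad A c) \<or> totally_geodesic S"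
        unfolding in_geodesic_sphere_def using zero_less_one by blast
    qed
  next
    case 2
    show ?thesis
    proof (rule fin[of 0])
      show "0\<^sup>2 > 4 * hdet A" using 2 by simp
      fix m assume m: "m \<in> M"
      obtain v w where vw: "is_start v (fst (f m))" "is_end w (snd (f m))" by (rule obtain_lifts)
      note F = facts[OF m vw]
      have "hquad A v \<le> 0 \<and> hquad A w \<ge> 0" using sg[OF _ m vw] 2 by simp
      moreover have "hquad A v * hquad A w < 0" unfolding F(3) using 2 F(1) by (simp add: mult_neg_pos)
      ultimately have q: "hquad A v < 0" "hquad A w > 0" by (auto simp: mult_less_0_iff)
      \<comment> \<open>the zero of the pairing along the geodesic\<close>
      define e where "e = sqrt (- hquad A v / hquad A w)"
      have e: "e > 0" "e * e = - hquad A v / hquad A w" using q by (simp_all add: e_def divide_neg_pos)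
      have "e * (e * hquad A w) = - hquad A v" using e(2) q by (simp add: mult.assoc[symmetric])
      then have ee: "hquad A v / e = - (e * hquad A w)" using e(1) by (simp add: field_simps)
      show "\<exists>r. crosses_at A 0 (f m) r"
        by (rule crosses_atI[OF L[OF m] vw e(1)]) (use ee e q in auto)
    qed (use totally_geodesic_plane[OF 2] in blast)
  next
    case 3
    have z: "hquad A v = 0 \<or> hquad A w = 0" if "m \<in> M" "is_start v (fst (f m))" "is_end w (snd (f m))" for m v w
      using facts(3)[OF that] 3 by auto
    obtain m0 where m0: "m0 \<in> M" using M by blast
    obtain v0 w0 where vw0: "is_start v0 (fst (f m0))" "is_end w0 (snd (f m0))" by (rule obtain_lifts)
    have semi: "hquad A x * hquad A y \<ge> 0" for x y
    proof -
      have "hquad A x * hquad A y = (cmod (hform A x y))\<^sup>2" using hform_gram[of A x y] 3 by simp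
      then show ?thesis by (metis zero_le_power2)
    qed
    have nz: "hquad A v \<noteq> 0 \<or> hquad A w \<noteq> 0" if "m \<in> M" "is_start v (fst (f m))" "is_end w (snd (f m))" for m v w
      using herm_eq_0[OF facts(1)[OF that]] facts(2)[OF that] A by blast
    have c1: "(1::real)\<^sup>2 > 4 * hdet A" "(-1::real)\<^sup>2 > 4 * hdet A" using 3 by simp_all
    show ?thesis
    proof (cases "hquad A w0 > 0")
      case True
      have q: "hquad A v = 0 \<and> hquad A w > 0" if "m \<in> M" "is_start v (fst (f m))" "is_end w (snd (f m))" for m v w
      proof -
        have "hquad A v \<ge> 0" using semi[of v w0] True by (simp add: zero_le_mult_iff)
        then have "hquad A v = 0" using sg[OF _ that] 3 by simp
        then show ?thesis using nz[OF that] sg[OF _ that] 3 by auto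
      qed
      show ?thesis
      proof (rule fin[OF c1(1)])
        fix m assume m: "m \<in> M"
        obtain v w where vw: "is_start v (fst (f m))" "is_end w (snd (f m))" by (rule obtain_lifts)
        note F = facts[OF m vw] and Q = q[OF m vw]
        show "\<exists>r. crosses_at A 1 (f m) r"
          by (rule crosses_atI[OF L[OF m] vw, of "cmod (det2 v w) / hquad A w"]) (use Q F(1) in auto)
      next
        fix S assume S: "f ` M = normal_congruence S (unit_grad A 1)"
        have same: "fst (f m) = fst (f m0)" if m: "m \<in> M" for m
        proof -
          obtain v w where vw: "is_start v (fst (f m))" "is_end w (snd (f m))" by (rule obtain_lifts)
          have "hform A v v0 = 0" by (rule incident_null_kernel[OF facts(1,2)[OF m vw]]) (use q[OF m vw] in simp)
          then have "det2 v v0 = 0" using herm_eq_0[of v v0 A] q[OF m vw] q[OF m0 vw0] A by blast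
          then show ?thesis by (rule is_start_det2[OF vw(1) vw0(1)])
        qed
        have "tends_to_boundary (geodesic \<gamma>) (start_point (fst (f m0))) at_bot" if "\<gamma> \<in> f ` M" for \<gamma>
        proof -
          obtain m where m: "m \<in> M" "\<gamma> = f m" using \<open>\<gamma> \<in> f ` M\<close> by blast
          show ?thesis using geodesic_tends_to_end_point(2)[OF L[OF m(1)]] unfolding same[OF m(1)] m(2) .
        qed
        then show "in_geodesic_sphere S \<or> horosphere S (unit_grad A 1) \<or> totally_geodesic S"
          unfolding horosphere_def S by blast
      qed
    next
      case False
      then have w0: "hquad A w0 = 0" using sg[OF _ m0 vw0] 3 by simp
      then have v0: "hquad A v0 < 0" using nz[OF m0 vw0] sg[OF _ m0 vw0] 3 by force
      have q: "hquad A w = 0 \<and> hquad A v < 0" if "m \<in> M" "is_start v (fst (f m))" "is_end w (snd (f m))" for m v w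
      proof -
        have "hquad A w \<le> 0" using semi[of v0 w] v0 by (simp add: zero_le_mult_iff)
        then have "hquad A w = 0" using sg[OF _ that] 3 by simp
        then show ?thesis using nz[OF that] sg[OF _ that] 3 by force
      qed
      show ?thesis
      proof (rule fin[OF c1(2)])
        fix m assume m: "m \<in> M"
        obtain v w where vw: "is_start v (fst (f m))" "is_end w (snd (f m))" by (rule obtain_lifts)
        note F = facts[OF m vw] and Q = q[OF m vw]
        show "\<exists>r. crosses_at A (- 1) (f m) r"
          by (rule crosses_atI[OF L[OF m] vw, of "- hquad A v / cmod (det2 v w)"]) (use Q F(1) in \<open>auto simp: divide_neg_pos\<close>)
      next
        fix S assume S: "f ` M = normal_congruence S (unit_grad A (- 1))"
        have same: "snd (f m) = snd (f m0)" if m: "m \<in> M" for m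
        proof -
          obtain v w where vw: "is_start v (fst (f m))" "is_end w (snd (f m))" by (rule obtain_lifts)
          have "det2 w v \<noteq> 0" "hform A w v = 0"
            using facts(1,2)[OF m vw] hform_commute[of A w v] by (auto simp: det2_def algebra_simps)
          then have "hform A w w0 = 0" by (rule incident_null_kernel) (use q[OF m vw] in simp)
          then have "det2 w w0 = 0" using herm_eq_0[of w w0 A] q[OF m vw] q[OF m0 vw0] A by blast
          then show ?thesis by (rule is_end_det2[OF vw(2) vw0(2)])
        qed
        have "tends_to_boundary (geodesic \<gamma>) (end_point (snd (f m0))) at_top" if "\<gamma> \<in> f ` M" for \<gamma>
        proof -
          obtain m where m: "m \<in> M" "\<gamma> = f m" using \<open>\<gamma> \<in> f ` M\<close> by blast
          show ?thesis using geodesic_tends_to_end_point(1)[OF L[OF m(1)]] unfolding same[OF m(1)] m(2) .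
        qed
        then show "in_geodesic_sphere S \<or> horosphere S (unit_grad A (- 1)) \<or> totally_geodesic S"
          unfolding horosphere_def S by blast
      qed
    qed
  qed
qed

theorem theorem2:
  fixes M :: "'m::{t2_space,second_countable_topology} set"
    and f :: "'m \<Rightarrow> sphere \<times> sphere"
  assumes "immersed_surface M f"
  shows "alpha_surface M f \<longleftrightarrow>
    (\<exists>S N. oriented_surface S N \<and> f ` M = normal_congruence S N \<and>
       (in_geodesic_sphere S \<or> horosphere S N \<or> totally_geodesic S))"
proof
  assume "alpha_surface M f"
  then show "\<exists>S N. oriented_surface S N \<and> f ` M = normal_congruence S N \<and>
       (in_geodesic_sphere S \<or> horosphere S N \<or> totally_geodesic S)"
    by (rule alpha_surface_imp_congruence[OF assms])
next
  assume "\<exists>S N. oriented_surface S N \<and> f ` M = normal_congruence S N \<and>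
       (in_geodesic_sphere S \<or> horosphere S N \<or> totally_geodesic S)"
  then obtain S N where S: "oriented_surface S N" "f ` M = normal_congruence S N"
    "in_geodesic_sphere S \<or> horosphere S N \<or> totally_geodesic S" by blast
  then obtain A where "A \<noteq> 0" "\<forall>\<gamma>\<in>normal_congruence S N. incident A \<gamma>"
    using sphere_normals_incident horosphere_normals_incident totally_geodesic_normals_incident by blast
  then show "alpha_surface M f" using alpha_surface_of_incident[OF assms] S(2) by blast
qed

end
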